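(* Let $F$, $G_1$ and $G_2$ be $\varphi$-functions, and let the underlying measure space be $[0,\infty)$ with Lebesgue measure. Consider the following statements. (i) For some $c<\infty$, we have $\|f\|_{F,G_1}\le c\,\|f\|_{F,G_2}$ for all measurable $f$. (ii) $G_1\circ G_2^{-1}$ is almost convex. (iii) There is an N-function $H$ satisfying condition $(J)$ such that $G_1\circ G_2^{-1}\succ H^{-1}$. (iv) $G_1$ is almost more convex than $G_2$. Then: - if one of $G_1$ or $G_2$ is dilatory, then (ii)$\Rightarrow$(i); - if one of $G_1$ or $G_2$ is dilatory and $G_1$ satisfies the $\Delta_2$-condition, or if $G_2$ satisfies the $\Delta_2$-condition, then (i)$\Rightarrow$(ii); - if $G_2$ is dilatory and satisfies the $\Delta_2$-condition, then (ii)$\Leftrightarrow$(iv); - (ii)$\Leftrightarrow$(iii) always holds.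
   Context: A $\varphi$-function is a function $F:[0,\infty)\to[0,\infty)$ that is continuous and strictly increasing with $F(0)=0$ and $\lim_{t\to\infty}F(t)=\infty$. $F$ is dilatory if for some $c_1,c_2>1$ we have $F(c_1t)\ge c_2F(t)$ for all $t\ge0$; $F$ satisfies the $\Delta_2$-condition if $F^{-1}$ is dilatory. Put $\tilde F(t)=1/F(1/t)$ for $t>0$ and $\tilde F(0)=0$. $\mathbb N=\{1,2,3,\dots\}$. Two $\varphi$-functions $F,G$ are equivalent ($F\asymp G$) if for some $c<\infty$, $F(c^{-1}t)\le G(t)\le F(ct)$ for all $t\ge0$ (the same definition of equivalence is used for comparing a $\varphi$-function with a convex function). For a measurable (complex-valued) function $f$ on a measure space $(\Omega,\mathcal F,\mu)$, the non-increasing rearrangement is $f^*(x)=\sup\{t:\mu(|f|\ge t)\ge x\}$. The Luxemburg functional is $\|f\|_G=\inf\{c:\int_\Omega G(|f(\omega)|/c)\,d\mu(\omega)\le1\}$ (possibly $\infty$). The Orlicz–Lorentz functional is $\|f\|_{F,G}=\|f^*\circ\tilde F\circ\tilde G^{-1}\|_G$, the last functional being taken on $[0,\infty)$ with Lebesgue measure. A $\varphi$-function $G$ is almost convex if there are numbers $a>1$, $b>1$ and $N\in\mathbb N$ such that for all $m\in\mathbb N$, the cardinality of the set of $n\in\mathbb Z$ for which $G(a^{n+m})\ge a^{m-N}G(a^n)$ fails is less than $b^m$. $G_1$ is almost less convex than $G_2$ if there are $a>1$, $b>1$, $N\in\mathbb N$ such that for all $m\in\mathbb N$, the cardinality of the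 set of $n\in\mathbb Z$ for which $\frac{G_1(a^{n+m})}{G_1(a^n)}\le a^N\frac{G_2(a^{n+m})}{G_2(a^n)}$ fails is less than $b^m$. $G_1$ is almost more convex than $G_2$ if $G_2$ is almost less convex than $G_1$. For $\varphi$-functions $F,G$: $F\prec G$ means $G\circ F^{-1}$ is equivalent to a convex function; $F\succ G$ means $G\prec F$. A $\varphi$-function $F$ is an N-function if it is equivalent to a $\varphi$-function $F_0$ such that $F_0(t)/t$ is strictly increasing, $F_0(t)/t\to\infty$ as $t\to\infty$ and $F_0(t)/t\to0$ as $t\to0$. A $\varphi$-function $F$ is complementary to $G$ if for some $c<\infty$, $c^{-1}t\le F^{-1}(t)G^{-1}(t)\le ct$ for all $t\ge0$. For an N-function $H$, $H^*$ denotes a $\varphi$-function complementary to $H$ (it exists and is unique up to equivalence). An N-function $H$ satisfies condition $(J)$ if $\|1/(\widetilde{H^*})^{-1}\|_{H^*}<\infty$, i.e. the function $x\mapsto 1/(\widetilde{H^*})^{-1}(x)$ on $(0,\infty)$ with Lebesgue measure has finite Luxemburg functional with respect to $H^*$. *)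

theory Defs
  imports "HOL-Analysis.Analysis"
begin

text \<open>
  Functions \<open>[0,\<infinity>) \<rightarrow> [0,\<infinity>)\<close> are represented by functions of type \<open>real \<Rightarrow> real\<close>, whose values
  at negative arguments are arbitrary: every definition below only inspects arguments in
  \<open>[0,\<infinity>)\<close>, and inverses are taken relative to \<open>[0,\<infinity>)\<close>.
\<close>

definition phi_function :: "(real \<Rightarrow> real) \<Rightarrow> bool" where
  "phi_function F \<longleftrightarrow>
     continuous_on {0..} F \<and> strict_mono_on {0..} F \<and> F 0 = 0 \<and> filterlim F at_top at_top"

definition phi_inv :: "(real \<Rightarrow> real) \<Rightarrow> real \<Rightarrow> real" where
  "phi_inv F = inv_into {0..} F"

definition dilatory :: "(real \<Rightarrow> real) \<Rightarrow> bool" where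
  "dilatory F \<longleftrightarrow> (\<exists>c1>1. \<exists>c2>1. \<forall>t\<ge>0. F (c1 * t) \<ge> c2 * F t)"

definition Delta2 :: "(real \<Rightarrow> real) \<Rightarrow> bool" where
  "Delta2 F \<longleftrightarrow> dilatory (phi_inv F)"

definition phi_tilde :: "(real \<Rightarrow> real) \<Rightarrow> real \<Rightarrow> real" where
  "phi_tilde F t = (if t > 0 then 1 / F (1 / t) else 0)"

definition phi_equiv :: "(real \<Rightarrow> real) \<Rightarrow> (real \<Rightarrow> real) \<Rightarrow> bool" where
  "phi_equiv F G \<longleftrightarrow> (\<exists>c>0. \<forall>t\<ge>0. F (t / c) \<le> G t \<and> G t \<le> F (c * t))"

text \<open>
  The value \<open>\<infinity>\<close> is possible, and it is always attained at \<open>x = 0\<close>.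
\<close>

definition rearrangement :: "'a measure \<Rightarrow> ('a \<Rightarrow> complex) \<Rightarrow> real \<Rightarrow> ennreal" where
  "rearrangement M f x =
     Sup {ennreal t | t. t \<ge> 0 \<and> emeasure M {\<omega> \<in> space M. norm (f \<omega>) \<ge> t} \<ge> ennreal x}"

text \<open>
  Extension of a \<open>\<phi>\<close>-function to \<open>[0,\<infinity>]\<close> by \<open>G(\<infinity>) = \<infinity>\<close>.
\<close>

definition phi_ext :: "(real \<Rightarrow> real) \<Rightarrow> ennreal \<Rightarrow> ennreal" where
  "phi_ext G y = (if y = \<infinity> then \<infinity> else ennreal (G (enn2real y)))"

text \<open>
  The Luxemburg functional depends on \<open>f\<close> only through \<open>|f|\<close>. It is defined here for
  \<open>[0,\<infinity>]\<close>-valued functions, since it has to be applied to rearrangements.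
\<close>

definition luxemburg :: "'a measure \<Rightarrow> (real \<Rightarrow> real) \<Rightarrow> ('a \<Rightarrow> ennreal) \<Rightarrow> ennreal" where
  "luxemburg M G g =
     Inf {ennreal c | c. c > 0 \<and> (\<integral>\<^sup>+ \<omega>. phi_ext G (g \<omega> / ennreal c) \<partial>M) \<le> 1}"

definition orlicz_lorentz ::
    "'a measure \<Rightarrow> (real \<Rightarrow> real) \<Rightarrow> (real \<Rightarrow> real) \<Rightarrow> ('a \<Rightarrow> complex) \<Rightarrow> ennreal" where
  "orlicz_lorentz M F G f =
     luxemburg (lebesgue_on {0..}) G
       (rearrangement M f \<circ> phi_tilde F \<circ> phi_inv (phi_tilde G))"

definition almost_convex :: "(real \<Rightarrow> real) \<Rightarrow> bool" where
  "almost_convex G \<longleftrightarrow>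
     (\<exists>(a::real)>1. \<exists>(b::real)>1. \<exists>N::nat\<ge>1. \<forall>m::nat\<ge>1.
        let E = {n::int. \<not> (G (a powi (n + int m)) \<ge> a powi (int m - int N) * G (a powi n))}
        in finite E \<and> real (card E) < b ^ m)"

definition almost_less_convex :: "(real \<Rightarrow> real) \<Rightarrow> (real \<Rightarrow> real) \<Rightarrow> bool" where
  "almost_less_convex G1 G2 \<longleftrightarrow>
     (\<exists>(a::real)>1. \<exists>(b::real)>1. \<exists>N::nat\<ge>1. \<forall>m::nat\<ge>1.
        let E = {n::int. \<not> (G1 (a powi (n + int m)) / G1 (a powi n)
                          \<le> a ^ N * (G2 (a powi (n + int m)) / G2 (a powi n)))}
        in finite E \<and> real (card E) < b ^ m)"

definition almost_more_convex :: "(real \<Rightarrow> real) \<Rightarrow> (real \<Rightarrow> real) \<Rightarrow> bool" where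
  "almost_more_convex G1 G2 \<longleftrightarrow> almost_less_convex G2 G1"

definition phi_prec :: "(real \<Rightarrow> real) \<Rightarrow> (real \<Rightarrow> real) \<Rightarrow> bool" where
  "phi_prec F G \<longleftrightarrow> (\<exists>K. convex_on {0..} K \<and> phi_equiv (G \<circ> phi_inv F) K)"

definition phi_succ :: "(real \<Rightarrow> real) \<Rightarrow> (real \<Rightarrow> real) \<Rightarrow> bool" where
  "phi_succ F G \<longleftrightarrow> phi_prec G F"

definition N_function :: "(real \<Rightarrow> real) \<Rightarrow> bool" where
  "N_function F \<longleftrightarrow> phi_function F \<and>
     (\<exists>F0. phi_function F0 \<and> phi_equiv F F0 \<and>
           strict_mono_on {0<..} (\<lambda>t. F0 t / t) \<and>
           filterlim (\<lambda>t. F0 t / t) at_top at_top \<and>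
           ((\<lambda>t. F0 t / t) \<longlongrightarrow> 0) (at_right 0))"

definition complementary :: "(real \<Rightarrow> real) \<Rightarrow> (real \<Rightarrow> real) \<Rightarrow> bool" where
  "complementary F G \<longleftrightarrow>
     (\<exists>c>0. \<forall>t\<ge>0. t / c \<le> phi_inv F t * phi_inv G t \<and> phi_inv F t * phi_inv G t \<le> c * t)"

text \<open>
  For an N-function \<open>H\<close>, a complementary \<open>\<phi>\<close>-function \<open>H*\<close> exists and is unique up to equivalence;
  finiteness of the functional below is invariant under equivalence, so it does not matter
  which complementary function \<open>Hs\<close> is used.
\<close>

definition condition_J :: "(real \<Rightarrow> real) \<Rightarrow> bool" where
  "condition_J H \<longleftrightarrow>
     (\<exists>Hs. phi_function Hs \<and> complementary Hs H \<and>
        luxemburg (lebesgue_on {0<..}) Hs (\<lambda>x. ennreal (1 / phi_inv (phi_tilde Hs) x)) < \<infinity>)"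

end

(*
  Put K = G1 o G2^-1 and h(u) = f*(1 / F(u)). Substituting x = 1 / G(u) in the Luxemburg functional
  makes F irrelevant: in terms of w = G2 o h o G2^-1, statement (i) says, up to the treatment of
  constants, that the integral of w(v) / v^2 dv controls the integral of K(w) d(-1/K) for increasing w.

  The hub is a summable majorant: K(x) <= (C x / 2^n + tau_n) K(2^n) for 0 <= x <= 2^n, where
  the sum of tau_n over all integers n is finite. It gives (i) by summation over dyadic intervals,
  and it gives (ii) because tau_(n+m) > 2^-m can hold for at most 2^m (sum of tau) integers n.
  It follows from (iii): with P the inverse of H* and P(theta_n) = P(2^n) / c, convexity of K o H says
  that K(x) / K(v) is at most a constant times (x / v) (P(v) / P(x)), so that tau_n can be chosen
  proportional to theta_n / 2^n, which is summable by (J). For (ii) => (iii), a slowly growing P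
  with K(v) P(v) / v essentially increasing is built by hand.

  For (i) => (ii), failure of (ii) produces arbitrarily many exceptional n, for a common m, along which
  K(2^n) doubles; a step function f with a jump for each of them contradicts (i).
*)

theory Submission
  imports Defs
begin

subsection \<open>\<open>\<phi>\<close>-functions and their inverses\<close>

text \<open>The base \<open>b\<close> in almost convexity is arbitrary, so a majorant read off
  directly from the exceptional sets would lead to sums of terms like (b / a)^m, which may diverge.
  The way through (iii) avoids this, because the functional in (J) may be divided by any constant:
  dividing P by a^(R M) moves its argument back by R k grid steps, except at no more than R k D^k
  integers, and a^R can be made larger than any multiple of D^2 since D is independent of R.

  The constants in (i) are the other obstacle. A dilation of f acts inside K if G2 is dilatory and
  outside K if G1 is. Inside, the linear part of the majorant shrinks but tau does not; outside,
  everything shrinks, but the slices on which w almost reaches its largest possible value stay out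
  of reach of the majorant. In the converse direction the constant c is absorbed by a Delta_2
  condition.\<close>

lemma phi_strict: "phi_function F \<Longrightarrow> 0 \<le> x \<Longrightarrow> x < y \<Longrightarrow> F x < F y"
  unfolding phi_function_def strict_mono_on_def by auto

lemma phi_less_iff: "phi_function F \<Longrightarrow> 0 \<le> x \<Longrightarrow> 0 \<le> y \<Longrightarrow> F x < F y \<longleftrightarrow> x < y"
  by (metis linorder_neqE_linordered_idom order_less_asym phi_strict)

lemma phi_le_iff: "phi_function F \<Longrightarrow> 0 \<le> x \<Longrightarrow> 0 \<le> y \<Longrightarrow> F x \<le> F y \<longleftrightarrow> x \<le> y"
  by (meson linorder_not_le phi_less_iff)

lemma phi_mono: "phi_function F \<Longrightarrow> 0 \<le> x \<Longrightarrow> x \<le> y \<Longrightarrow> F x \<le> F y"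
  by (simp add: phi_le_iff)

lemma phi_zero: "phi_function F \<Longrightarrow> F 0 = 0"
  by (simp add: phi_function_def)

lemma phi_pos: "phi_function F \<Longrightarrow> 0 < x \<Longrightarrow> 0 < F x"
  by (metis order_refl phi_strict phi_zero)

lemma phi_nonneg: "phi_function F \<Longrightarrow> 0 \<le> x \<Longrightarrow> 0 \<le> F x"
  by (metis phi_mono phi_zero order_refl)

lemma phi_surj:
  assumes F: "phi_function F" and y: "0 \<le> y"
  shows "\<exists>x\<ge>0. F x = y"
proof -
  have "filterlim F at_top at_top" using F by (simp add: phi_function_def)
  then have "eventually (\<lambda>x. y \<le> F x \<and> x \<ge> 0) at_top"
    by (intro eventually_conj eventually_ge_at_top) (simp add: filterlim_at_top)
  then obtain b where b: "y \<le> F b" "b \<ge> 0"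
    unfolding eventually_at_top_linorder by blast
  have "continuous_on {0..b} F"
    using F by (auto simp: phi_function_def intro: continuous_on_subset)
  with IVT'[of F 0 y b] b y phi_zero[OF F] show ?thesis by auto
qed

lemma phi_inv_nonneg: "phi_function F \<Longrightarrow> 0 \<le> y \<Longrightarrow> 0 \<le> phi_inv F y"
  unfolding phi_inv_def using phi_surj[of F y] inv_into_into[of y F "{0..}"] by force

lemma phi_phi_inv: "phi_function F \<Longrightarrow> 0 \<le> y \<Longrightarrow> F (phi_inv F y) = y"
  unfolding phi_inv_def using phi_surj[of F y] f_inv_into_f[of y F "{0..}"] by force

lemma phi_inj: "phi_function F \<Longrightarrow> inj_on F {0..}"
  by (simp add: phi_function_def strict_mono_on_imp_inj_on)

lemma phi_inv_phi: "phi_function F \<Longrightarrow> 0 \<le> x \<Longrightarrow> phi_inv F (F x) = x"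
  unfolding phi_inv_def using phi_inj[of F] by simp

lemma phi_inv_zero: "phi_function F \<Longrightarrow> phi_inv F 0 = 0"
  by (metis phi_inv_phi phi_zero order_refl)

lemma phi_inv_less_iff:
  "phi_function F \<Longrightarrow> 0 \<le> x \<Longrightarrow> 0 \<le> y \<Longrightarrow> phi_inv F x < phi_inv F y \<longleftrightarrow> x < y"
  by (metis phi_inv_nonneg phi_less_iff phi_phi_inv)

lemma phi_inv_le_iff:
  "phi_function F \<Longrightarrow> 0 \<le> x \<Longrightarrow> 0 \<le> y \<Longrightarrow> phi_inv F x \<le> phi_inv F y \<longleftrightarrow> x \<le> y"
  by (meson linorder_not_le phi_inv_less_iff)

lemma phi_inv_pos: "phi_function F \<Longrightarrow> 0 < y \<Longrightarrow> 0 < phi_inv F y"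
  by (metis order.refl order.strict_implies_order phi_inv_less_iff phi_inv_zero)

lemma le_phi_inv_iff:
  "phi_function F \<Longrightarrow> 0 \<le> x \<Longrightarrow> 0 \<le> y \<Longrightarrow> x \<le> phi_inv F y \<longleftrightarrow> F x \<le> y"
  by (metis phi_inv_nonneg phi_le_iff phi_phi_inv)

lemma phi_inv_le_iff':
  "phi_function F \<Longrightarrow> 0 \<le> x \<Longrightarrow> 0 \<le> y \<Longrightarrow> phi_inv F y \<le> x \<longleftrightarrow> y \<le> F x"
  by (metis phi_inv_nonneg phi_le_iff phi_phi_inv)

text \<open>A strictly increasing surjection of [0, \<infinity>) cannot jump, so continuity and
  divergence at infinity come for free. Inverses, compositions and functions built in logarithmic
  coordinates are recognised through this rule.\<close>

lemma phi_functionI: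
  assumes mono: "\<And>x y. 0 \<le> x \<Longrightarrow> x < y \<Longrightarrow> F x < F y" and zero: "F 0 = 0"
    and surj: "\<And>y. 0 \<le> y \<Longrightarrow> \<exists>x\<ge>0. F x = y"
  shows "phi_function F"
proof -
  have le: "F x \<le> F y" if "0 \<le> x" "x \<le> y" for x y
    using mono[of x y] that by (cases "x = y") auto
  have "continuous_on {0..} F"
  proof (rule continuous_on_iff[THEN iffD2], intro ballI allI impI)
    fix x e :: real assume x: "x \<in> {0..}" and e: "0 < e"
    have Fx: "0 \<le> F x" using le[of 0 x] x zero by auto
    then obtain y where y: "0 \<le> y" "F y = F x + e" using surj[of "F x + e"] e by auto
    have xy: "x < y" using le[of y x] y e by (cases "x < y") auto
    have "\<exists>z<x. \<forall>x'\<ge>0. z < x' \<longrightarrow> F x - e < F x'"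
    proof (cases "F x - e < 0")
      case True
      have "F x - e < F x'" if "x' \<ge> 0" for x'
        using le[of 0 x'] that zero True by auto
      then show ?thesis by (intro exI[of _ "x - 1"]) auto
    next
      case False
      then obtain z where z: "0 \<le> z" "F z = F x - e" using surj[of "F x - e"] by auto
      have "z < x" using le[of x z] x z e by (cases "z < x") auto
      then show ?thesis using z mono[of z] by (intro exI[of _ z]) auto
    qed
    then obtain z where z: "z < x" "\<And>x'. x' \<ge> 0 \<Longrightarrow> z < x' \<Longrightarrow> F x - e < F x'" by auto
    show "\<exists>d>0. \<forall>x'\<in>{0..}. dist x' x < d \<longrightarrow> dist (F x') (F x) < e"
    proof (intro exI conjI ballI impI)
      show "0 < min (y - x) (x - z)" using xy z by auto
      fix x' assume x': "x' \<in> {0..}" "dist x' x < min (y - x) (x - z)"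
      then have "x' < y" "z < x'" by (auto simp: dist_real_def)
      then have "F x' < F x + e" "F x - e < F x'" using x' z mono[of x' y] y by auto
      then show "dist (F x') (F x) < e" by (auto simp: dist_real_def)
    qed
  qed
  moreover have "filterlim F at_top at_top"
    unfolding filterlim_at_top
  proof
    fix Z :: real
    obtain b where "b \<ge> 0" "F b = max Z 0" using surj[of "max Z 0"] by auto
    then show "eventually (\<lambda>x. Z \<le> F x) at_top"
      using le[of b] unfolding eventually_at_top_linorder by (metis max.boundedE)
  qed
  ultimately show ?thesis using mono zero
    unfolding phi_function_def by (auto simp: strict_mono_on_def)
qed

lemma phi_function_phi_inv:
  assumes "phi_function F" shows "phi_function (phi_inv F)"
proof (rule phi_functionI)
  fix y :: real assume "0 \<le> y"
  then show "\<exists>x\<ge>0. phi_inv F x = y"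
    using assms phi_inv_phi phi_nonneg by (intro exI[of _ "F y"]) auto
qed (use assms phi_inv_less_iff phi_inv_zero in auto)

lemma phi_function_comp:
  assumes F: "phi_function F" and G: "phi_function G" shows "phi_function (F \<circ> G)"
proof (rule phi_functionI)
  fix y :: real assume "0 \<le> y"
  then obtain z where "z \<ge> 0" "F z = y" using phi_surj[OF F] by auto
  moreover then obtain x where "x \<ge> 0" "G x = z" using phi_surj[OF G] by auto
  ultimately show "\<exists>x\<ge>0. (F \<circ> G) x = y" by auto
qed (use F G in \<open>auto simp: phi_zero phi_strict phi_nonneg\<close>)

lemma phi_inv_phi_inv: "phi_function F \<Longrightarrow> 0 \<le> x \<Longrightarrow> phi_inv (phi_inv F) x = F x"
  by (metis phi_function_phi_inv phi_inv_phi phi_nonneg phi_phi_inv)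

text \<open>\<open>phi_tilde G\<close> is strictly increasing, hence injective, and sends the
  right-hand side to x. This identity carries the substitution u = 1 / t.\<close>

lemma phi_inv_phi_tilde:
  assumes G: "phi_function G" and x: "x > 0"
  shows "phi_inv (phi_tilde G) x = 1 / phi_inv G (1 / x)"
proof -
  have mono: "phi_tilde G s < phi_tilde G t" if "0 \<le> s" "s < t" for s t
    using that phi_strict[OF G, of "1/t" "1/s"] phi_pos[OF G, of "1/t"]
    unfolding phi_tilde_def by (auto simp: frac_less2)
  have "inj_on (phi_tilde G) {0..}"
    by (rule strict_mono_on_imp_inj_on) (auto simp: strict_mono_on_def mono)
  moreover have "phi_tilde G (1 / phi_inv G (1 / x)) = x"
    using phi_phi_inv[OF G, of "1/x"] phi_inv_pos[OF G, of "1/x"] x by (simp add: phi_tilde_def)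
  ultimately show ?thesis
    unfolding phi_inv_def
    by (metis G atLeast_iff divide_pos_pos inv_into_f_f less_imp_le phi_inv_def phi_inv_pos x zero_less_one)
qed

lemma phi_small_near_zero:
  assumes K: "phi_function K" and e: "e > 0"
  shows "\<exists>d>0. \<forall>x. 0 \<le> x \<longrightarrow> x \<le> d \<longrightarrow> K x \<le> e"
  using phi_inv_pos[OF K e] le_phi_inv_iff[OF K, of _ e] e by (intro exI[of _ "phi_inv K e"]) auto

text \<open>Iterating the dilatory inequality k times turns \<open>c2\<close> into its k-th power,
  which exceeds any prescribed \<open>A\<close>.\<close>

lemma dilatory_iterate:
  assumes F: "phi_function F" and d: "dilatory F"
  shows "\<exists>C\<ge>1. \<forall>t\<ge>0. F (C * t) \<ge> A * F t"
proof -
  obtain c1 c2 where c: "c1 > 1" "c2 > 1" "\<And>t. t \<ge> 0 \<Longrightarrow> F (c1 * t) \<ge> c2 * F t"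
    using d unfolding dilatory_def by auto
  have it: "F (c1 ^ k * t) \<ge> c2 ^ k * F t" if "t \<ge> 0" for k t
  proof (induction k)
    case (Suc k)
    have "c2 ^ Suc k * F t \<le> c2 * F (c1 ^ k * t)" using Suc c by simp
    also have "\<dots> \<le> F (c1 * (c1 ^ k * t))" using c that by simp
    finally show ?case by (simp add: mult.assoc)
  qed simp
  obtain k where k: "A < c2 ^ k" using c real_arch_pow by blast
  show ?thesis
  proof (intro exI conjI allI impI)
    show "1 \<le> c1 ^ k" using c by simp
    fix t :: real assume t: "0 \<le> t"
    have "A * F t \<le> c2 ^ k * F t" using k phi_nonneg[OF F t] by (simp add: mult_right_mono)
    then show "A * F t \<le> F (c1 ^ k * t)" using it[OF t, of k] by simp
  qed
qed

lemma dilatory_shrink: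
  assumes F: "phi_function F" and d: "dilatory F" and e: "e > 0"
  shows "\<exists>C\<ge>1. \<forall>t\<ge>0. F (t / C) \<le> e * F t"
proof -
  obtain C where C: "C \<ge> 1" "\<And>t. t \<ge> 0 \<Longrightarrow> F (C * t) \<ge> (1 / e) * F t"
    using dilatory_iterate[OF F d, of "1/e"] by auto
  have "F (t / C) \<le> e * F t" if "t \<ge> 0" for t
    using C(2)[of "t / C"] C(1) that e by (simp add: field_simps)
  then show ?thesis using C(1) by auto
qed

text \<open>Dilatoriness of the inverse function, carried back to F, is the usual doubling
  inequality.\<close>

lemma Delta2_iterate:
  assumes F: "phi_function F" and d: "Delta2 F" and C: "C \<ge> 0"
  shows "\<exists>A\<ge>1. \<forall>t\<ge>0. F (C * t) \<le> A * F t"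
proof -
  obtain A where A: "A \<ge> 1" "\<And>t. t \<ge> 0 \<Longrightarrow> phi_inv F (A * t) \<ge> C * phi_inv F t"
    using dilatory_iterate[OF phi_function_phi_inv[OF F]] d unfolding Delta2_def by blast
  have "F (C * t) \<le> A * F t" if t: "t \<ge> 0" for t
  proof -
    have "C * t \<le> phi_inv F (A * F t)" using A(2)[of "F t"] F t by (simp add: phi_inv_phi phi_nonneg)
    then show ?thesis using C A(1) F t by (simp add: le_phi_inv_iff phi_nonneg)
  qed
  then show ?thesis using A(1) by auto
qed

subsection \<open>The modular of an increasing function\<close>

text \<open>After enumerating the integers by \<open>int_decode\<close>, every partial sum of the
  series is a sum over a finite set.\<close>

lemma nn_integral_count_space_int_le:
  fixes \<beta> :: "int \<Rightarrow> real"
  assumes nn: "\<And>n. 0 \<le> \<beta> n" and S: "\<And>A. finite A \<Longrightarrow> sum \<beta> A \<le> S"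
  shows "(\<integral>\<^sup>+n. ennreal (\<beta> n) \<partial>count_space UNIV) \<le> ennreal S"
proof -
  have "(\<integral>\<^sup>+n. ennreal (\<beta> n) \<partial>count_space UNIV)
      = (\<integral>\<^sup>+i. ennreal (\<beta> (int_decode i)) \<partial>count_space UNIV)"
    by (rule nn_integral_bij_count_space[symmetric]) (rule bij_int_decode)
  also have "\<dots> = (\<Sum>i. ennreal (\<beta> (int_decode i)))"
    by (rule nn_integral_count_space_nat)
  also have "\<dots> \<le> ennreal S"
  proof (rule suminf_le_const)
    fix k
    have "(\<Sum>i<k. ennreal (\<beta> (int_decode i))) = ennreal (\<Sum>i<k. \<beta> (int_decode i))"
      by (rule sum_ennreal) (rule nn)
    also have "(\<Sum>i<k. \<beta> (int_decode i)) = sum \<beta> (int_decode ` {..<k})"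
      by (subst sum.reindex) (simp_all add: inj_on_def int_decode_eq)
    also have "ennreal \<dots> \<le> ennreal S" by (rule ennreal_leI) (rule S, simp)
    finally show "(\<Sum>i<k. ennreal (\<beta> (int_decode i))) \<le> ennreal S" .
  qed simp
  finally show ?thesis .
qed

text \<open>\<open>\<phi>\<close> may fail to be measurable. It is replaced by the sum of all
  \<open>B n\<close>, one of which dominates it at each point, and only this sum is integrated
  termwise.\<close>

lemma nn_integral_le_cover:
  fixes \<phi> :: "real \<Rightarrow> ennreal" and B :: "int \<Rightarrow> real \<Rightarrow> ennreal" and \<beta> :: "int \<Rightarrow> real"
  assumes cover: "\<And>x. x > 0 \<Longrightarrow> \<exists>n. \<phi> x \<le> B n x"
    and meas: "\<And>n. B n \<in> borel_measurable lebesgue"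
    and le: "\<And>n. (\<integral>\<^sup>+x. B n x \<partial>lebesgue) \<le> ennreal (\<beta> n)"
    and nn: "\<And>n. 0 \<le> \<beta> n" and S: "\<And>A. finite A \<Longrightarrow> sum \<beta> A \<le> S"
  shows "(\<integral>\<^sup>+x. \<phi> x * indicator {0<..} x \<partial>lebesgue) \<le> ennreal S"
proof -
  have "\<phi> x * indicator {0<..} x \<le> (\<integral>\<^sup>+n. B n x \<partial>count_space UNIV)" for x
  proof (cases "x > 0")
    case True
    then obtain n where "\<phi> x \<le> B n x" using cover by blast
    also have "\<dots> \<le> (\<integral>\<^sup>+n. B n x \<partial>count_space UNIV)"
      by (rule nn_integral_ge_point) simp
    finally show ?thesis using True by simp
  qed simp
  then have "(\<integral>\<^sup>+x. \<phi> x * indicator {0<..} x \<partial>lebesgue)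
      \<le> (\<integral>\<^sup>+x. (\<integral>\<^sup>+n. B n x \<partial>count_space UNIV) \<partial>lebesgue)"
    by (intro nn_integral_mono) blast
  also have "\<dots> = (\<integral>\<^sup>+n. (\<integral>\<^sup>+x. B n x \<partial>lebesgue) \<partial>count_space UNIV)"
    by (rule nn_integral_count_space_nn_integral) (auto intro: meas)
  also have "\<dots> \<le> (\<integral>\<^sup>+n. ennreal (\<beta> n) \<partial>count_space UNIV)"
    by (intro nn_integral_mono le)
  also have "\<dots> \<le> ennreal S" using nn S by (rule nn_integral_count_space_int_le)
  finally show ?thesis .
qed

lemma nn_integral_step:
  fixes q l r :: "'i \<Rightarrow> real"
  assumes q: "\<And>n. n \<in> T \<Longrightarrow> 0 \<le> q n" and lr: "\<And>n. n \<in> T \<Longrightarrow> l n \<le> r n"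
  shows "(\<integral>\<^sup>+x. ennreal (\<Sum>n\<in>T. q n * indicator {l n<..r n} x) \<partial>lebesgue)
    = ennreal (\<Sum>n\<in>T. q n * (r n - l n))"
proof -
  have "(\<integral>\<^sup>+x. ennreal (\<Sum>n\<in>T. q n * indicator {l n<..r n} x) \<partial>lebesgue)
      = (\<integral>\<^sup>+x. (\<Sum>n\<in>T. ennreal (q n) * indicator {l n<..r n} x) \<partial>lebesgue)"
    by (intro nn_integral_cong)
      (subst sum_ennreal[symmetric], auto simp: q ennreal_mult' ennreal_indicator)
  also have "\<dots> = (\<Sum>n\<in>T. ennreal (q n) * emeasure lebesgue {l n<..r n})"
    by (subst nn_integral_sum)
      (auto intro!: measurable_completion simp: nn_integral_cmult_indicator)
  also have "\<dots> = (\<Sum>n\<in>T. ennreal (q n * (r n - l n)))"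
    by (intro sum.cong refl) (simp add: lr q ennreal_mult)
  also have "\<dots> = ennreal (\<Sum>n\<in>T. q n * (r n - l n))"
    by (rule sum_ennreal) (simp add: q lr)
  finally show ?thesis .
qed

lemma step_le_nn_integral:
  fixes q l r :: "'i \<Rightarrow> real"
  assumes q: "\<And>n. n \<in> T \<Longrightarrow> 0 \<le> q n" and lr: "\<And>n. n \<in> T \<Longrightarrow> 0 \<le> l n \<and> l n \<le> r n"
    and le: "\<And>x. x > 0 \<Longrightarrow> ennreal (\<Sum>n\<in>T. q n * indicator {l n<..r n} x) \<le> \<phi> x"
  shows "ennreal (\<Sum>n\<in>T. q n * (r n - l n)) \<le> (\<integral>\<^sup>+x. \<phi> x * indicator {0<..} x \<partial>lebesgue)"
proof -
  have "ennreal (\<Sum>n\<in>T. q n * (r n - l n))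
      = (\<integral>\<^sup>+x. ennreal (\<Sum>n\<in>T. q n * indicator {l n<..r n} x) \<partial>lebesgue)"
    using q lr by (intro nn_integral_step[symmetric]) auto
  also have "\<dots> \<le> (\<integral>\<^sup>+x. \<phi> x * indicator {0<..} x \<partial>lebesgue)"
  proof (rule nn_integral_mono)
    fix x :: real
    show "ennreal (\<Sum>n\<in>T. q n * indicator {l n<..r n} x) \<le> \<phi> x * indicator {0<..} x"
    proof (cases "x > 0")
      case False
      then have "(\<Sum>n\<in>T. q n * indicator {l n<..r n} x) = 0"
        using lr by (intro sum.neutral) (force simp: indicator_def)
      then show ?thesis by simp
    qed (use le in simp)
  qed
  finally show ?thesis .
qed

lemma sum_indicator_disjoint_le:
  fixes q :: "'i \<Rightarrow> real"
  assumes fin: "finite T" and disj: "disjoint_family_on I T"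
    and le: "\<And>n. n \<in> T \<Longrightarrow> x \<in> I n \<Longrightarrow> ennreal (q n) \<le> y"
  shows "ennreal (\<Sum>n\<in>T. q n * indicator (I n) x) \<le> y"
proof (cases "\<exists>n\<in>T. x \<in> I n")
  case True
  then obtain n where n: "n \<in> T" "x \<in> I n" by blast
  then have "x \<notin> I k" if "k \<in> T" "k \<noteq> n" for k
    using disj that unfolding disjoint_family_on_def by blast
  then have "(\<Sum>k\<in>T. q k * indicator (I k) x) = (\<Sum>k\<in>T. if k = n then q n else 0)"
    using n by (intro sum.cong) auto
  then show ?thesis using n le fin by simp
next
  case False
  then have "(\<Sum>n\<in>T. q n * indicator (I n) x) = 0" by (intro sum.neutral) auto
  then show ?thesis by simp
qed

text \<open>
  The substitution \<open>u = 1 / t\<close> turns the decreasing function \<open>f\<^sup>* \<circ> F\<^sup>~\<close> into the increasing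
  function \<open>h u = f\<^sup>* (1 / F u)\<close>, and the integral of the Luxemburg functional into the integral
  of \<open>G \<circ> h\<close> against \<open>d(- 1 / G)\<close>.
\<close>

definition modular :: "(real \<Rightarrow> real) \<Rightarrow> (real \<Rightarrow> ennreal) \<Rightarrow> ennreal" where
  "modular G h = (\<integral>\<^sup>+x. phi_ext G (h (phi_inv G (1 / x))) * indicator {0<..} x \<partial>lebesgue)"

text \<open>By \<open>phi_inv_phi_tilde\<close>, the composed function at x > 0 is the rearrangement
  at 1 / F u with u = \<open>phi_inv G (1 / x)\<close>, so F enters only through an increasing
  function of u. The point x = 0 is discarded as a null set.\<close>

lemma orlicz_lorentz_eq_modular:
  assumes F: "phi_function F" and G: "phi_function G"
  shows "orlicz_lorentz (lebesgue_on {0..}) F G f =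
    Inf {ennreal c | c. c > 0 \<and>
      modular G (\<lambda>u. rearrangement (lebesgue_on {0..}) f (1 / F u) / ennreal c) \<le> 1}"
proof -
  let ?g = "rearrangement (lebesgue_on {0..}) f \<circ> phi_tilde F \<circ> phi_inv (phi_tilde G)"
  have "(\<integral>\<^sup>+x. phi_ext G (?g x / ennreal c) \<partial>lebesgue_on {0..})
      = modular G (\<lambda>u. rearrangement (lebesgue_on {0..}) f (1 / F u) / ennreal c)" for c
  proof -
    have "(\<integral>\<^sup>+x. phi_ext G (?g x / ennreal c) \<partial>lebesgue_on {0..})
        = (\<integral>\<^sup>+x. phi_ext G (?g x / ennreal c) * indicator {0..} x \<partial>lebesgue)"
      by (rule nn_integral_restrict_space) simp
    also have "\<dots> = (\<integral>\<^sup>+x. phi_ext G (rearrangement (lebesgue_on {0..}) f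
        (1 / F (phi_inv G (1 / x))) / ennreal c) * indicator {0<..} x \<partial>lebesgue)"
    proof (rule nn_integral_cong_AE)
      have "AE x in lebesgue. x \<noteq> (0::real)" by (rule AE_completion) (rule AE_lborel_singleton)
      then show "AE x in lebesgue. phi_ext G (?g x / ennreal c) * indicator {0..} x
          = phi_ext G (rearrangement (lebesgue_on {0..}) f
              (1 / F (phi_inv G (1 / x))) / ennreal c) * indicator {0<..} x"
      proof (rule AE_mp, intro AE_I2 impI)
        fix x :: real assume "x \<noteq> 0"
        then consider "x < 0" | "x > 0" by linarith
        then show "phi_ext G (?g x / ennreal c) * indicator {0..} x
          = phi_ext G (rearrangement (lebesgue_on {0..}) f
              (1 / F (phi_inv G (1 / x))) / ennreal c) * indicator {0<..} x"
        proof cases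
          case 2
          then show ?thesis
            using phi_inv_pos[OF G, of "1/x"] by (simp add: phi_inv_phi_tilde[OF G] phi_tilde_def)
        qed simp
      qed
    qed
    finally show ?thesis by (simp add: modular_def)
  qed
  then show ?thesis unfolding orlicz_lorentz_def luxemburg_def by simp
qed

section \<open>Monotonicity, slices and lower bounds of the modular\<close>

lemma antimono_rearrangement:
  assumes "x \<le> y" shows "rearrangement M f y \<le> rearrangement M f x"
  unfolding rearrangement_def
  by (rule Sup_subset_mono) (use assms in \<open>force dest: order_trans[OF ennreal_leI]\<close>)

lemma mono_phi_ext:
  assumes G: "phi_function G" and "y \<le> z" shows "phi_ext G y \<le> phi_ext G z"
  using assms unfolding phi_ext_def
  by (auto simp: top_unique less_top[symmetric] intro!: ennreal_leI phi_mono[OF G] enn2real_mono)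

lemma phi_ext_ennreal: "0 \<le> y \<Longrightarrow> phi_ext G (ennreal y) = ennreal (G y)"
  by (simp add: phi_ext_def)

text \<open>Reciprocals reverse the order, so this half-open interval corresponds to \<alpha> \<le>
  u < \<beta>; its length is the mass that d(-1 / G) gives to that slice.\<close>

lemma phi_inv_slice:
  assumes G: "phi_function G" and ab: "0 < \<alpha>" "0 < \<beta>" and x: "x \<in> {1 / G \<beta><..1 / G \<alpha>}"
  shows "\<alpha> \<le> phi_inv G (1 / x)" and "phi_inv G (1 / x) < \<beta>"
proof -
  have pos: "0 < G \<alpha>" "0 < G \<beta>" using phi_pos[OF G] ab by auto
  have x0: "x > 0" using x pos by (auto intro: order.strict_trans[rotated])
  have "G \<alpha> \<le> 1 / x" "1 / x < G \<beta>" using x pos x0 by (auto simp: field_simps)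
  then show "\<alpha> \<le> phi_inv G (1 / x)" "phi_inv G (1 / x) < \<beta>"
    using ab x0 pos le_phi_inv_iff[OF G, of \<alpha> "1/x"] phi_inv_le_iff'[OF G, of \<beta> "1/x"]
      phi_inv_less_iff[OF G, of "1/x" "G \<beta>"] phi_inv_phi[OF G, of \<beta>] by auto
qed

lemma phi_inv_slice0:
  assumes G: "phi_function G" and a: "0 < \<alpha>" and x: "x \<in> {0<..1 / G \<alpha>}"
  shows "\<alpha> \<le> phi_inv G (1 / x)"
proof -
  have "G \<alpha> \<le> 1 / x" using x phi_pos[OF G a] by (auto simp: field_simps)
  then show ?thesis using a x le_phi_inv_iff[OF G, of \<alpha> "1/x"] by auto
qed

lemma modular_ge_steps:
  fixes l r y :: "'i \<Rightarrow> real"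
  assumes G: "phi_function G" and fin: "finite T"
    and disj: "disjoint_family_on (\<lambda>n. {l n<..r n}) T"
    and lr: "\<And>n. n \<in> T \<Longrightarrow> 0 \<le> l n \<and> l n \<le> r n" and y: "\<And>n. n \<in> T \<Longrightarrow> 0 \<le> y n"
    and le: "\<And>n x. n \<in> T \<Longrightarrow> l n < x \<Longrightarrow> x \<le> r n \<Longrightarrow> ennreal (y n) \<le> h (phi_inv G (1 / x))"
  shows "ennreal (\<Sum>n\<in>T. G (y n) * (r n - l n)) \<le> modular G h"
  unfolding modular_def
proof (rule step_le_nn_integral)
  fix x :: real
  show "ennreal (\<Sum>n\<in>T. G (y n) * indicator {l n<..r n} x) \<le> phi_ext G (h (phi_inv G (1 / x)))"
  proof (rule sum_indicator_disjoint_le[OF fin disj])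
    fix n assume n: "n \<in> T" "x \<in> {l n<..r n}"
    then have "phi_ext G (ennreal (y n)) \<le> phi_ext G (h (phi_inv G (1 / x)))"
      using le by (intro mono_phi_ext[OF G]) auto
    then show "ennreal (G (y n)) \<le> phi_ext G (h (phi_inv G (1 / x)))"
      using y[OF n(1)] by (simp add: phi_ext_ennreal)
  qed
qed (use lr y phi_nonneg[OF G] in auto)

lemma modular_ge_sum:
  fixes u y :: "int \<Rightarrow> real"
  assumes G: "phi_function G" and fin: "finite T"
    and u: "\<And>n. 0 < u n" "\<And>n m. n \<le> m \<Longrightarrow> u n \<le> u m" and y: "\<And>n. n \<in> T \<Longrightarrow> 0 \<le> y n"
    and le: "\<And>n v. n \<in> T \<Longrightarrow> u n \<le> v \<Longrightarrow> ennreal (y n) \<le> h v"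
  shows "ennreal (\<Sum>n\<in>T. G (y n) * (1 / G (u n) - 1 / G (u (n + 1)))) \<le> modular G h"
proof (rule modular_ge_steps[OF G fin _ _ y])
  have mono: "1 / G (u m) \<le> 1 / G (u n)" if "n \<le> m" for n m
    using that u phi_mono[OF G, of "u n" "u m"] phi_pos[OF G, of "u n"] by (simp add: frac_le less_imp_le)
  have "{1 / G (u (n + 1))<..1 / G (u n)} \<inter> {1 / G (u (m + 1))<..1 / G (u m)} = {}"
    if "n < m" for n m
    using mono[of "n + 1" m] that by auto
  then show "disjoint_family_on (\<lambda>n. {1 / G (u (n + 1))<..1 / G (u n)}) T"
    unfolding disjoint_family_on_def by (metis inf.commute linorder_neqE_linordered_idom)
  show "0 \<le> 1 / G (u (n + 1)) \<and> 1 / G (u (n + 1)) \<le> 1 / G (u n)" for n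
    using mono[of n "n + 1"] phi_pos[OF G u(1)[of "n + 1"]] by simp
  show "ennreal (y n) \<le> h (phi_inv G (1 / x))"
    if "n \<in> T" "1 / G (u (n + 1)) < x" "x \<le> 1 / G (u n)" for n x
    using that phi_inv_slice(1)[OF G u(1)[of n] u(1)[of "n + 1"], of x] by (intro le) auto
qed

text \<open>The first slice is the unbounded one, u \<ge> V 0, hence the left endpoint 0 for i = 0.
  Keeping its full mass 1 / G (V 0) is what yields h u \<le> u for functions of modular at most
  1.\<close>

lemma modular_ge_chain:
  fixes V y :: "nat \<Rightarrow> real"
  assumes G: "phi_function G"
    and V: "\<And>i. i < k \<Longrightarrow> 0 < V i" "\<And>i. Suc i < k \<Longrightarrow> V (Suc i) \<le> V i"
    and y: "\<And>i. i < k \<Longrightarrow> 0 \<le> y i"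
    and le: "\<And>i v. i < k \<Longrightarrow> V i \<le> v \<Longrightarrow> ennreal (y i) \<le> h v"
  shows "ennreal (\<Sum>i<k. G (y i) * (1 / G (V i) - (if i = 0 then 0 else 1 / G (V (i - 1)))))
    \<le> modular G h"
proof (rule modular_ge_steps[OF G])
  let ?l = "\<lambda>i. if i = 0 then 0 else 1 / G (V (i - 1))"
  have dec: "j < k \<Longrightarrow> i \<le> j \<Longrightarrow> V j \<le> V i" for i j
  proof (induction j)
    case (Suc j)
    then show ?case using V(2)[of j] by (cases "i = Suc j") auto
  qed simp
  have mono: "1 / G (V i) \<le> 1 / G (V j)" if "i \<le> j" "j < k" for i j
    using that dec[of j i] V(1)[of j] phi_mono[OF G, of "V j" "V i"] phi_pos[OF G, of "V j"]
    by (simp add: frac_le less_imp_le)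
  have "{?l i<..1 / G (V i)} \<inter> {?l j<..1 / G (V j)} = {}" if "i < j" "j < k" for i j
  proof -
    have j: "i \<le> j - 1" "j - 1 < k" "j \<noteq> 0" using that by auto
    then show ?thesis using mono[OF j(1,2)] by auto
  qed
  then show "disjoint_family_on (\<lambda>i. {?l i<..1 / G (V i)}) {..<k}"
    unfolding disjoint_family_on_def by (metis inf.commute lessThan_iff linorder_neqE_nat)
  show "0 \<le> ?l i \<and> ?l i \<le> 1 / G (V i)" if "i \<in> {..<k}" for i
    using mono[of "i - 1" i] that phi_pos[OF G V(1)[of "i - 1"]] phi_pos[OF G V(1)[of i]]
    by (cases i) (auto simp: less_imp_le)
  show "ennreal (y i) \<le> h (phi_inv G (1 / x))"
    if "i \<in> {..<k}" "?l i < x" "x \<le> 1 / G (V i)" for i x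
  proof -
    have "0 \<le> ?l i" using that phi_pos[OF G V(1)[of "i - 1"]] by (cases i) (auto simp: less_imp_le)
    then have "x \<in> {0<..1 / G (V i)}" using that by auto
    then show ?thesis using that phi_inv_slice0[OF G V(1)[of i], of x] by (intro le) auto
  qed
qed (use y in auto)

text \<open>The function in condition (J) is x -> \<open>phi_inv Hs (1 / x)\<close>, so its
  functional is governed by the modular of u -> u / c, and finiteness of the infimum means that some
  c is admissible.\<close>

lemma condition_J_iff:
  "condition_J H \<longleftrightarrow> (\<exists>Hs. phi_function Hs \<and> complementary Hs H \<and>
     (\<exists>c>0. modular Hs (\<lambda>u. ennreal (u / c)) \<le> 1))"
proof -
  have eq: "(\<integral>\<^sup>+ x. phi_ext Hs (ennreal (1 / phi_inv (phi_tilde Hs) x) / ennreal c) \<partial>lebesgue_on {0<..})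
      = modular Hs (\<lambda>u. ennreal (u / c))" if Hs: "phi_function Hs" and c: "c > 0" for Hs c
  proof -
    have "(\<integral>\<^sup>+ x. phi_ext Hs (ennreal (1 / phi_inv (phi_tilde Hs) x) / ennreal c) \<partial>lebesgue_on {0<..})
      = (\<integral>\<^sup>+ x. phi_ext Hs (ennreal (1 / phi_inv (phi_tilde Hs) x) / ennreal c) * indicator {0<..} x \<partial>lebesgue)"
      by (rule nn_integral_restrict_space) simp
    also have "\<dots> = modular Hs (\<lambda>u. ennreal (u / c))"
      unfolding modular_def
    proof (rule nn_integral_cong)
      fix x :: real
      show "phi_ext Hs (ennreal (1 / phi_inv (phi_tilde Hs) x) / ennreal c) * indicator {0<..} x
        = phi_ext Hs (ennreal (phi_inv Hs (1 / x) / c)) * indicator {0<..} x"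
        using c phi_inv_nonneg[OF Hs, of "1/x"]
        by (cases "x > 0") (simp_all add: phi_inv_phi_tilde[OF Hs] divide_ennreal)
    qed
    finally show ?thesis .
  qed
  have "luxemburg (lebesgue_on {0<..}) Hs (\<lambda>x. ennreal (1 / phi_inv (phi_tilde Hs) x)) < \<infinity> \<longleftrightarrow>
     (\<exists>c>0. modular Hs (\<lambda>u. ennreal (u / c)) \<le> 1)" if Hs: "phi_function Hs" for Hs
  proof -
    let ?I = "\<lambda>c. \<integral>\<^sup>+ x. phi_ext Hs (ennreal (1 / phi_inv (phi_tilde Hs) x) / ennreal c) \<partial>lebesgue_on {0<..}"
    have "Inf {ennreal c |c. 0 < c \<and> ?I c \<le> 1} < \<infinity> \<longleftrightarrow> (\<exists>c>0. ?I c \<le> 1)"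
      unfolding Inf_less_iff by (auto intro: ennreal_less_top)
    then show ?thesis using eq[OF Hs] unfolding luxemburg_def by (simp cong: conj_cong)
  qed
  then show ?thesis unfolding condition_J_def by auto
qed

subsection \<open>Summable majorants\<close>

text \<open>Summability over the integers is expressed by a common bound for all finite sums. The
  base 2 is fixed: the passage through condition (J) forgets the base in the definition of almost
  convexity.\<close>

definition summable_majorant :: "(real \<Rightarrow> real) \<Rightarrow> bool" where
  "summable_majorant K \<longleftrightarrow> (\<exists>C \<ge> 0. \<exists>\<tau> :: int \<Rightarrow> real. \<exists>S. (\<forall>n. 0 \<le> \<tau> n) \<and>
     (\<forall>A. finite A \<longrightarrow> sum \<tau> A \<le> S) \<and>
     (\<forall>n x. 0 \<le> x \<longrightarrow> x \<le> 2 powi n \<longrightarrow> K x \<le> (C * x / 2 powi n + \<tau> n) * K (2 powi n)))"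

lemma finite_card_le_if_subsets:
  assumes "\<And>A. finite A \<Longrightarrow> A \<subseteq> X \<Longrightarrow> real (card A) \<le> B"
  shows "finite X \<and> real (card X) \<le> B"
proof -
  have "card A \<le> nat \<lfloor>B\<rfloor>" if "A \<subseteq> X" "finite A" for A
    using assms[of A] that by (simp add: le_nat_floor)
  then have "finite X" using finite_if_finite_subsets_card_bdd by blast
  then show ?thesis using assms by blast
qed

lemma almost_convex_if_summable_majorant:
  assumes K: "phi_function K" and maj: "summable_majorant K"
  shows "almost_convex K"
proof -
  obtain C \<tau> S where C: "C \<ge> 0" and \<tau>: "\<And>n. 0 \<le> \<tau> n" "\<And>A. finite A \<Longrightarrow> sum \<tau> A \<le> S"
    and le: "\<And>n x. 0 \<le> x \<Longrightarrow> x \<le> 2 powi n \<Longrightarrow> K x \<le> (C * x / 2 powi n + \<tau> n) * K (2 powi n)"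
    using maj unfolding summable_majorant_def by metis
  have S: "S \<ge> 0" using \<tau>(2)[of "{}"] by simp
  \<comment> \<open>At x = 2^n the majorant of index n + m is C / 2^m + tau_(n+m), at most (C + 1) /
    2^m unless n is counted; N absorbs C + 1.\<close>
  obtain N where N: "C + 1 < 2 ^ N" using real_arch_pow[of 2 "C + 1"] by auto
  have N1: "N \<ge> 1" using N C by (cases N) auto
  have main: "finite E \<and> real (card E) < (2 * (S + 1)) ^ m"
    if m: "m \<ge> 1" and E: "E = {n. \<not> K (2 powi (n + int m)) \<ge> 2 powi (int m - int N) * K (2 powi n)}" for m E
  proof -
    have big: "\<tau> (n + int m) > 1 / 2 ^ m" if "n \<in> E" for n
    proof (rule ccontr)
      assume "\<not> ?thesis"
      then have t: "\<tau> (n + int m) \<le> 1 / 2 ^ m" by simp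
      have p: "(2::real) powi (n + int m) = 2 powi n * 2 ^ m" by (simp add: power_int_add)
      have Kp: "K (2 powi (n + int m)) > 0" by (rule phi_pos[OF K]) simp
      have "K (2 powi n) \<le> (C * 2 powi n / 2 powi (n + int m) + \<tau> (n + int m)) * K (2 powi (n + int m))"
        by (rule le) (simp_all add: p)
      also have "\<dots> \<le> ((C + 1) / 2 ^ m) * K (2 powi (n + int m))"
        using t Kp by (intro mult_right_mono) (simp_all add: p add_divide_distrib)
      also have "\<dots> \<le> (2 ^ N / 2 ^ m) * K (2 powi (n + int m))"
        using N Kp by (intro mult_right_mono divide_right_mono) auto
      finally have "2 ^ m / 2 ^ N * K (2 powi n) \<le> K (2 powi (n + int m))"
        by (simp add: field_simps)
      then show False using that E by (simp add: power_int_diff)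
    qed
    have "real (card A) \<le> S * 2 ^ m" if A: "finite A" "A \<subseteq> E" for A
    proof -
      have "real (card A) * (1 / 2 ^ m) \<le> (\<Sum>n\<in>A. \<tau> (n + int m))"
        using A big by (intro sum_bounded_below[where 'a=real, simplified]) (force intro: less_imp_le)
      also have "\<dots> = sum \<tau> ((\<lambda>n. n + int m) ` A)" by (simp add: sum.reindex inj_on_def)
      also have "\<dots> \<le> S" using A by (intro \<tau>) auto
      finally show ?thesis by (simp add: field_simps)
    qed
    then have fc: "finite E \<and> real (card E) \<le> S * 2 ^ m" by (rule finite_card_le_if_subsets)
    \<comment> \<open>Using S + 1 makes the bound strict and the base larger than 1 even if S =
      0.\<close>
    moreover have "S < (S + 1) ^ m" using self_le_power[of "S + 1" m] S m by auto
    then have "S * 2 ^ m < (2 * (S + 1)) ^ m" unfolding power_mult_distrib by simp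
    ultimately show ?thesis by auto
  qed
  show ?thesis
    unfolding almost_convex_def Let_def
    using main S N1 by (intro exI[of _ 2] conjI exI[of _ "2 * (S + 1)"] exI[of _ N]) auto
qed

lemma summable_majorant_if_condition_J:
  assumes K: "phi_function K" and H: "phi_function H" and J: "condition_J H"
    and succ: "phi_succ K (phi_inv H)"
  shows "summable_majorant K"
proof -
  obtain Hs c where Hs: "phi_function Hs" and comp: "complementary Hs H" and c: "c > 0"
    and mod: "modular Hs (\<lambda>u. ennreal (u / c)) \<le> 1"
    using J unfolding condition_J_iff by blast
  obtain d where d: "d > 0"
    and comp: "\<And>t. t \<ge> 0 \<Longrightarrow> t / d \<le> phi_inv Hs t * phi_inv H t \<and> phi_inv Hs t * phi_inv H t \<le> d * t"
    using comp unfolding complementary_def by blast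
  obtain Kc e where conv: "convex_on {0..} Kc" and e: "e > 0"
    and eqv: "\<And>t. t \<ge> 0 \<Longrightarrow> (K \<circ> phi_inv (phi_inv H)) (t / e) \<le> Kc t \<and> Kc t \<le> (K \<circ> phi_inv (phi_inv H)) (e * t)"
    using succ unfolding phi_succ_def phi_prec_def phi_equiv_def by blast
  have eqv: "K (H (t / e)) \<le> Kc t \<and> Kc t \<le> K (H (e * t))" if "t \<ge> 0" for t
    using eqv[OF that] phi_inv_phi_inv[OF H] that e by simp
  have Kc0: "Kc 0 = 0" using eqv[of 0] phi_zero[OF H] phi_zero[OF K] by simp
  \<comment> \<open>Convexity and Kc 0 = 0 give Kc (l y) \<le> l Kc y. As the constant e of the
    equivalence enters on both sides, this applies while e s \<le> t / e; otherwise s / t is bounded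
    below and monotonicity suffices.\<close>
  have KH: "K (H s) \<le> (e\<^sup>2 + 1) * (s / t) * K (H t)" if st: "0 \<le> s" "s \<le> t" "0 < t" for s t
  proof -
    have KHt: "K (H t) \<ge> 0" using st by (intro phi_nonneg[OF K] phi_nonneg[OF H]) auto
    have nn: "(s / t) * K (H t) \<ge> 0" using st KHt by simp
    show ?thesis
    proof (cases "e * s \<le> t / e")
      case True
      define l where "l = e * s / (t / e)"
      have l: "0 \<le> l" "l \<le> 1" using True st e by (auto simp: l_def field_simps)
      have "K (H s) \<le> Kc (e * s)" using eqv[of "e * s"] st e by simp
      also have "e * s = (1 - l) *\<^sub>R 0 + l *\<^sub>R (t / e)" using e st by (simp add: l_def)
      also have "Kc \<dots> \<le> (1 - l) * Kc 0 + l * Kc (t / e)"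
        by (rule convex_onD[OF conv]) (use l st e in auto)
      also have "\<dots> \<le> l * K (H t)"
        using eqv[of "t / e"] st e l by (simp add: Kc0 mult_left_mono)
      also have "\<dots> = e\<^sup>2 * ((s / t) * K (H t))" by (simp add: l_def power2_eq_square)
      also have "\<dots> \<le> (e\<^sup>2 + 1) * ((s / t) * K (H t))" using nn by (intro mult_right_mono) auto
      finally show ?thesis by (simp add: mult.assoc)
    next
      case False
      then have "1 \<le> e\<^sup>2 * (s / t)" using st e by (simp add: field_simps power2_eq_square)
      moreover have "0 \<le> s / t" using st by simp
      ultimately have "1 \<le> (e\<^sup>2 + 1) * (s / t)" unfolding distrib_right by linarith
      then have "K (H t) \<le> (e\<^sup>2 + 1) * (s / t) * K (H t)"
        using mult_right_mono[of 1 "(e\<^sup>2 + 1) * (s / t)" "K (H t)"] KHt by simp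
      moreover have "K (H s) \<le> K (H t)"
        using st by (intro phi_mono[OF K] phi_nonneg[OF H] phi_mono[OF H]) auto
      ultimately show ?thesis by linarith
    qed
  qed
  define P where "P = phi_inv Hs"
  define D where "D = (e\<^sup>2 + 1) * d\<^sup>2"
  have D: "D \<ge> 0" by (simp add: D_def)
  have Ppos: "P v > 0" if "v > 0" for v unfolding P_def by (rule phi_inv_pos[OF Hs that])
  \<comment> \<open>Complementarity says that the inverse of H is x / P x up to the factor d in
    either direction, so s / t becomes (x / v) (P v / P x) at the cost of d^2.\<close>
  have KP: "K x \<le> D * (x / v) * (P v / P x) * K v" if xv: "0 < x" "x \<le> v" for x v
  proof -
    have v: "v > 0" using xv by simp
    define s t where "s = phi_inv H x" and "t = phi_inv H v"
    have st: "0 < s" "s \<le> t" "0 < t"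
      unfolding s_def t_def using phi_inv_pos[OF H] phi_inv_le_iff[OF H] xv v by auto
    have "P x * s \<le> d * x" "v / d \<le> P v * t"
      using comp[of x] comp[of v] xv v unfolding s_def t_def P_def by auto
    then have s: "s \<le> d * x / P x" and t: "t \<ge> v / d / P v"
      using xv v Ppos[of x] Ppos[of v]
      by (simp_all only: pos_divide_le_eq pos_le_divide_eq mult.commute)
    have "s / t \<le> (d * x / P x) / (v / d / P v)"
      using s t st v d Ppos[of v] by (intro frac_le) auto
    also have "\<dots> = d\<^sup>2 * (x / v) * (P v / P x)" by (simp add: power2_eq_square ac_simps)
    finally have st': "s / t \<le> d\<^sup>2 * (x / v) * (P v / P x)" .
    have "K x = K (H s)" unfolding s_def using xv by (simp add: phi_phi_inv[OF H])
    also have "\<dots> \<le> (e\<^sup>2 + 1) * (s / t) * K (H t)" using KH st by simp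
    also have "\<dots> \<le> (e\<^sup>2 + 1) * (d\<^sup>2 * (x / v) * (P v / P x)) * K (H t)"
      using st' phi_nonneg[OF K] phi_nonneg[OF H] st by (intro mult_right_mono mult_left_mono) auto
    also have "K (H t) = K v" unfolding t_def using v by (simp add: phi_phi_inv[OF H])
    finally show ?thesis by (simp add: D_def mult.assoc)
  qed
  \<comment> \<open>The point where P has the value P (2^n) / c. From there up to 2^n the quotient
    of P in \<open>KP\<close> is at most c and the linear term suffices.\<close>
  define \<theta> where "\<theta> n = Hs (P (2 powi n) / c)" for n :: int
  have \<theta>nn: "\<theta> n > 0" for n
    unfolding \<theta>_def using Ppos[of "2 powi n"] c by (intro phi_pos[OF Hs]) auto
  define C where "C = D * c"
  \<comment> \<open>Hs takes the values 2^n along the grid P (2^n), so a slice has mass 2^-n / 2,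
    and the integrand u / c contributes at least \<theta> n there.\<close>
  have sum\<theta>: "(\<Sum>n\<in>A. \<theta> n / 2 powi n) \<le> 2" if A: "finite A" for A
  proof -
    have "ennreal (\<Sum>n\<in>A. Hs (P (2 powi n) / c) * (1 / Hs (P (2 powi n)) - 1 / Hs (P (2 powi (n + 1)))))
        \<le> modular Hs (\<lambda>u. ennreal (u / c))"
    proof (rule modular_ge_sum[OF Hs A])
      show "0 < P (2 powi n)" for n by (rule Ppos) simp
      then show "0 \<le> P (2 powi n) / c" for n using c by (simp add: less_imp_le)
      show "P (2 powi n) \<le> P (2 powi m)" if "n \<le> m" for n m
        unfolding P_def using that by (subst phi_inv_le_iff[OF Hs]) (auto intro: power_int_increasing)
    qed (use c in \<open>auto intro!: ennreal_leI divide_right_mono\<close>)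
    also have "\<dots> \<le> 1" by (rule mod)
    finally have "(\<Sum>n\<in>A. Hs (P (2 powi n) / c) * (1 / Hs (P (2 powi n)) - 1 / Hs (P (2 powi (n + 1))))) \<le> 1"
      by (simp add: ennreal_le_1)
    also have "(\<Sum>n\<in>A. Hs (P (2 powi n) / c) * (1 / Hs (P (2 powi n)) - 1 / Hs (P (2 powi (n + 1)))))
      = (\<Sum>n\<in>A. \<theta> n / 2 powi n / 2)"
    proof (rule sum.cong[OF refl])
      fix n
      have "Hs (P v) = v" if "v > 0" for v unfolding P_def using that by (simp add: phi_phi_inv[OF Hs])
      then show "Hs (P (2 powi n) / c) * (1 / Hs (P (2 powi n)) - 1 / Hs (P (2 powi (n + 1)))) = \<theta> n / 2 powi n / 2"
        by (simp add: \<theta>_def power_int_add field_simps)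
    qed
    also have "\<dots> = (\<Sum>n\<in>A. \<theta> n / 2 powi n) / 2" by (rule sum_divide_distrib[symmetric])
    finally show ?thesis by simp
  qed
  define \<tau> where "\<tau> n = (C + 1) * (\<theta> n / 2 powi n)" for n
  have C: "C \<ge> 0" using D c by (simp add: C_def)
  have main: "K x \<le> (C * x / 2 powi n + \<tau> n) * K (2 powi n)" if x: "0 \<le> x" "x \<le> 2 powi n" for n x
  proof (cases "x = 0")
    case True
    then show ?thesis using phi_zero[OF K] C \<theta>nn[of n] phi_nonneg[OF K, of "2 powi n"] by (simp add: \<tau>_def)
  next
    case False
    then have x0: "x > 0" using x by simp
    define v where "v = (2::real) powi n"
    have v: "v > 0" by (simp add: v_def)
    have Kv: "K v > 0" by (rule phi_pos[OF K v])
    have close: "K y \<le> C * (y / v) * K v" if y: "0 < y" "y \<le> v" "P v \<le> c * P y" for y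
    proof -
      have "K y \<le> D * (y / v) * (P v / P y) * K v" using KP y by simp
      also have "\<dots> \<le> D * (y / v) * c * K v"
        using y D v Kv Ppos[of y] by (intro mult_right_mono mult_left_mono) (auto simp: field_simps)
      finally show ?thesis by (simp add: C_def ac_simps)
    qed
    have "K x \<le> C * (x / v) * K v \<or> K x \<le> \<tau> n * K v"
    proof (cases "P v \<le> c * P x")
      case True
      then show ?thesis using close x0 x by (simp add: v_def)
    next
      case False
      then have "P x < P v / c" using c by (simp add: field_simps)
      then have "Hs (P x) < \<theta> n" unfolding \<theta>_def v_def[symmetric] using Ppos[OF x0] by (intro phi_strict[OF Hs]) auto
      then have x\<theta>: "x < \<theta> n" unfolding P_def using x by (simp add: phi_phi_inv[OF Hs])
      have "K x \<le> \<tau> n * K v"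
      proof (cases "\<theta> n \<le> v")
        case True
        have "P (\<theta> n) = P v / c" unfolding \<theta>_def v_def[symmetric] P_def
          using phi_inv_pos[OF Hs v] c by (simp add: phi_inv_phi[OF Hs])
        then have "K (\<theta> n) \<le> C * (\<theta> n / v) * K v" using True \<theta>nn c by (intro close) auto
        moreover have "K x \<le> K (\<theta> n)" using x\<theta> x by (intro phi_mono[OF K]) auto
        moreover have "C * (\<theta> n / v) * K v \<le> \<tau> n * K v"
          unfolding \<tau>_def v_def[symmetric] using \<theta>nn[of n] v Kv
          by (intro mult_right_mono) auto
        ultimately show ?thesis by linarith
      next
        case False
        \<comment> \<open>This case occurs when c < 1. The summand 1 in C + 1 then forces \<tau> n
          \<ge> 1, and K x \<le> K v is enough.\<close>
        then have "1 \<le> \<theta> n / v" using v by simp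
        then have "1 \<le> \<tau> n" unfolding \<tau>_def v_def[symmetric]
          using C mult_mono[of 1 "C + 1" 1 "\<theta> n / v"] by simp
        then have "K v \<le> \<tau> n * K v" using Kv by simp
        moreover have "K x \<le> K v" using x by (intro phi_mono[OF K]) (auto simp: v_def)
        ultimately show ?thesis by linarith
      qed
      then show ?thesis ..
    qed
    moreover have "\<tau> n * K v \<ge> 0" "C * (x / v) * K v \<ge> 0"
      using C \<theta>nn[of n] Kv v x by (auto simp: \<tau>_def)
    ultimately show ?thesis unfolding v_def[symmetric] by (auto simp: distrib_right)
  qed
  show ?thesis
    unfolding summable_majorant_def
  proof (intro exI conjI allI impI)
    show "0 \<le> C" by (rule C)
    show "0 \<le> \<tau> n" for n using C \<theta>nn[of n] by (simp add: \<tau>_def)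
    show "sum \<tau> A \<le> (C + 1) * 2" if "finite A" for A
      unfolding \<tau>_def sum_distrib_left[symmetric] using sum\<theta>[OF that] C by (intro mult_left_mono) auto
  qed (use main in auto)
qed

subsection \<open>Bounds for the Orlicz--Lorentz functional\<close>

text \<open>If h u > z > u, monotonicity gives h \<ge> z on the whole ray from u, and the modular is
  at least G z / G u > 1. So modular at most 1 forces h u \<le> u; in particular h is
  finite.\<close>

lemma modular_le_one_real:
  assumes G: "phi_function G" and mono: "\<And>u v. 0 < u \<Longrightarrow> u \<le> v \<Longrightarrow> h u \<le> h v"
    and mod: "modular G h \<le> 1"
  obtains r :: "real \<Rightarrow> real" where "\<And>u. 0 < u \<Longrightarrow> h u = ennreal (r u)"
    "\<And>u. 0 < u \<Longrightarrow> 0 \<le> r u \<and> r u \<le> u" "\<And>u v. 0 < u \<Longrightarrow> u \<le> v \<Longrightarrow> r u \<le> r v"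
proof -
  have le: "h u \<le> ennreal u" if u: "u > 0" for u
  proof (rule ccontr)
    assume "\<not> ?thesis"
    then have "ennreal u < h u" by simp
    then obtain y where y: "ennreal u < y" "y < h u" using dense by blast
    then obtain z where z: "y = ennreal z" "z \<ge> 0" by (cases y) auto
    have uz: "u < z" using y z u by (simp add: ennreal_less_iff)
    have "ennreal (\<Sum>i<1::nat. G z * (1 / G u - (if i = 0 then 0 else 1 / G u))) \<le> modular G h"
    proof (rule modular_ge_chain[OF G])
      show "ennreal z \<le> h v" if "u \<le> v" for v
        using y z mono[OF u that] by simp
    qed (use u z in auto)
    then have "ennreal (G z / G u) \<le> modular G h" by simp
    then have "ennreal (G z / G u) \<le> 1" using mod by (rule order_trans)
    then have "G z / G u \<le> 1" by (simp only: ennreal_le_1)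
    then show False using phi_strict[OF G, of u z] u uz phi_pos[OF G u] by (simp add: field_simps)
  qed
  then have r: "h u = ennreal (enn2real (h u))" if "0 < u" for u
    using that by (metis ennreal_enn2real ennreal_less_top order_le_less_trans)
  show thesis
  proof (rule that[of "\<lambda>u. enn2real (h u)"])
    show "h u = ennreal (enn2real (h u))" if "0 < u" for u by (rule r[OF that])
    show "0 \<le> enn2real (h u) \<and> enn2real (h u) \<le> u" if "0 < u" for u
      using enn2real_mono[OF le[OF that]] that by simp
    show "enn2real (h u) \<le> enn2real (h v)" if "0 < u" "u \<le> v" for u v
      using that le[of v] by (intro enn2real_mono mono) (auto simp: order_le_less_trans)
  qed
qed

text \<open>
  The part of the modular over \<open>v1 \<le> u < v2\<close> is at most \<open>b\<close>. Passing to a measurable majorant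
  \<open>B\<close> makes it possible to add up slices without any measurability of \<open>h\<close>.
\<close>

definition slice_le :: "(real \<Rightarrow> real) \<Rightarrow> (real \<Rightarrow> ennreal) \<Rightarrow> real \<Rightarrow> real \<Rightarrow> real \<Rightarrow> bool" where
  "slice_le G h v1 v2 b \<longleftrightarrow>
     (\<exists>B \<in> borel_measurable lebesgue. (\<integral>\<^sup>+x. B x \<partial>lebesgue) \<le> ennreal b \<and>
       (\<forall>x\<in>{1 / G v2<..1 / G v1}. phi_ext G (h (phi_inv G (1 / x))) \<le> B x))"

text \<open>The mass of a step is bounded by 1 / G (V (Suc i)), dropping the subtracted 1 / G (V i).
  This leaves quotients to which the majorant or dilatoriness applies directly.\<close>

lemma slice_le_steps:
  fixes V z :: "nat \<Rightarrow> real"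
  assumes G: "phi_function G"
    and V: "\<And>i. i \<le> k \<Longrightarrow> 0 < V i" "\<And>i. i < k \<Longrightarrow> V (Suc i) \<le> V i"
    and z: "\<And>i. i < k \<Longrightarrow> 0 \<le> z i"
    and le: "\<And>i v. i < k \<Longrightarrow> V (Suc i) \<le> v \<Longrightarrow> v < V i \<Longrightarrow> h v \<le> ennreal (z i)"
    and \<beta>: "(\<Sum>i<k. G (z i) / G (V (Suc i))) \<le> \<beta>"
  shows "slice_le G h (V k) (V 0) \<beta>"
  unfolding slice_le_def
proof (intro bexI conjI ballI)
  let ?I = "\<lambda>i. {1 / G (V i)<..1 / G (V (Suc i))}"
  let ?B = "\<lambda>x. ennreal (\<Sum>i<k. G (z i) * indicator (?I i) x)"
  have Gz: "0 \<le> G (z i)" if "i < k" for i using phi_nonneg[OF G z[OF that]] .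
  have GV: "0 < G (V i)" if "i \<le> k" for i using phi_pos[OF G V(1)[OF that]] .
  have inc: "1 / G (V i) \<le> 1 / G (V (Suc i))" if "i < k" for i
    using that V(1)[of "Suc i"] V(2)[of i] GV[of "Suc i"] by (intro frac_le phi_mono[OF G]) auto
  show "?B \<in> borel_measurable lebesgue"
    by (rule measurable_completion) measurable
  have "(\<integral>\<^sup>+x. ?B x \<partial>lebesgue) = ennreal (\<Sum>i<k. G (z i) * (1 / G (V (Suc i)) - 1 / G (V i)))"
    using Gz inc by (intro nn_integral_step) auto
  also have "\<dots> \<le> ennreal (\<Sum>i<k. G (z i) / G (V (Suc i)))"
    using Gz GV by (intro ennreal_leI sum_mono)
      (auto simp: right_diff_distrib less_imp_le intro!: divide_nonneg_nonneg)
  also have "\<dots> \<le> ennreal \<beta>" using \<beta> by (rule ennreal_leI)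
  finally show "(\<integral>\<^sup>+x. ?B x \<partial>lebesgue) \<le> ennreal \<beta>" .
  fix x assume x: "x \<in> {1 / G (V 0)<..1 / G (V k)}"
  have "\<exists>i<j. x \<in> ?I i" if "1 / G (V 0) < x" "x \<le> 1 / G (V j)" for j
    using that
  proof (induction j)
    case (Suc j)
    then show ?case by (cases "x \<le> 1 / G (V j)") (auto intro: less_SucI)
  qed simp
  then obtain i where i: "i < k" "x \<in> ?I i" using x by auto
  have "phi_ext G (h (phi_inv G (1 / x))) \<le> phi_ext G (ennreal (z i))"
    using phi_inv_slice[OF G V(1)[of "Suc i"] V(1)[of i] i(2)] i(1)
    by (intro mono_phi_ext[OF G] le) auto
  also have "\<dots> = ennreal (G (z i) * indicator (?I i) x)" using i z[OF i(1)] by (simp add: phi_ext_ennreal)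
  also have "\<dots> \<le> ?B x"
    using Gz i by (intro ennreal_leI member_le_sum) auto
  finally show "phi_ext G (h (phi_inv G (1 / x))) \<le> ?B x" .
qed

lemma modular_le_cover:
  fixes u :: "int \<Rightarrow> real"
  assumes G: "phi_function G" and u: "\<And>n. 0 < u n"
    and cover: "\<And>v. 0 < v \<Longrightarrow> \<exists>n. u n \<le> v \<and> v < u (n + 1)"
    and slice: "\<And>n. slice_le G h (u n) (u (n + 1)) (\<beta> n)"
    and nn: "\<And>n. 0 \<le> \<beta> n" and S: "\<And>A. finite A \<Longrightarrow> sum \<beta> A \<le> S"
  shows "modular G h \<le> ennreal S"
proof -
  obtain B where B: "\<And>n. B n \<in> borel_measurable lebesgue" "\<And>n. (\<integral>\<^sup>+x. B n x \<partial>lebesgue) \<le> ennreal (\<beta> n)"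
    "\<And>n x. x\<in>{1 / G (u (n + 1))<..1 / G (u n)} \<Longrightarrow> phi_ext G (h (phi_inv G (1 / x))) \<le> B n x"
    using slice unfolding slice_le_def by metis
  show ?thesis
    unfolding modular_def
  proof (rule nn_integral_le_cover[OF _ B(1,2) nn S])
    fix x :: real assume x: "x > 0"
    obtain n where n: "u n \<le> phi_inv G (1 / x)" "phi_inv G (1 / x) < u (n + 1)"
      using cover[of "phi_inv G (1 / x)"] phi_inv_pos[OF G, of "1/x"] x by auto
    have "G (u n) \<le> 1 / x" "1 / x < G (u (n + 1))"
      using n x u[of n] u[of "n + 1"] le_phi_inv_iff[OF G, of "u n" "1/x"]
        phi_less_iff[OF G, of "phi_inv G (1 / x)" "u (n + 1)"] phi_inv_nonneg[OF G, of "1/x"]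
        phi_phi_inv[OF G, of "1/x"] by auto
    then have "x \<in> {1 / G (u (n + 1))<..1 / G (u n)}"
      using x phi_pos[OF G u[of n]] phi_pos[OF G u[of "n + 1"]] by (auto simp: field_simps)
    then show "\<exists>n. phi_ext G (h (phi_inv G (1 / x))) \<le> B n x" using B(3) by blast
  qed auto
qed

section \<open>Geometric grids and small tails\<close>

lemma powi_cover:
  assumes a: "(a::real) > 1" and v: "v > 0"
  shows "\<exists>j::int. a powi j \<le> v \<and> v < a powi (j + 1)"
proof -
  have p: "a powi n = a powr of_int n" for n :: int using a by (simp add: powr_real_of_int')
  have "a powi \<lfloor>log a v\<rfloor> \<le> a powr log a v" unfolding p using a by (intro powr_mono) auto
  moreover have "a powr log a v < a powi (\<lfloor>log a v\<rfloor> + 1)"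
    unfolding p using a by (intro powr_less_mono) (linarith, simp)
  ultimately show ?thesis using a v by auto
qed

text \<open>A finite set whose sum comes within e of the supremum of all finite sums leaves at most
  e for any finite set disjoint from it.\<close>

lemma finite_set_small_tail:
  fixes \<tau> :: "'i \<Rightarrow> real"
  assumes nn: "\<And>n. 0 \<le> \<tau> n" and S: "\<And>A. finite A \<Longrightarrow> sum \<tau> A \<le> S" and e: "e > 0"
  obtains A where "finite A" "\<And>B. finite B \<Longrightarrow> B \<inter> A = {} \<Longrightarrow> sum \<tau> B \<le> e"
proof -
  let ?X = "sum \<tau> ` {A. finite A}"
  have bdd: "bdd_above ?X" using S by (auto intro!: bdd_aboveI)
  have "Sup ?X - e < Sup ?X" using e by simp
  then obtain A where A: "finite A" "Sup ?X - e < sum \<tau> A"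
    using less_cSup_iff[of ?X "Sup ?X - e"] bdd by auto
  have "sum \<tau> B \<le> e" if B: "finite B" "B \<inter> A = {}" for B
  proof -
    have "sum \<tau> B + sum \<tau> A = sum \<tau> (B \<union> A)" using A B by (simp add: sum.union_disjoint)
    also have "\<dots> \<le> Sup ?X" using A B bdd by (intro cSup_upper) auto
    finally show ?thesis using A by simp
  qed
  then show thesis using that A by blast
qed

lemma grid_properties:
  assumes G: "phi_function G" and u: "u = (\<lambda>n::int. phi_inv G (2 powi n))"
  shows "0 < u n" "n \<le> m \<Longrightarrow> u n \<le> u m" "G (u n) = 2 powi n"
    "0 < v \<Longrightarrow> \<exists>n. u n \<le> v \<and> v < u (n + 1)"
proof -
  show "0 < u n" "G (u n) = 2 powi n" unfolding u by (simp_all add: phi_inv_pos[OF G] phi_phi_inv[OF G])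
  show "u n \<le> u m" if "n \<le> m"
    unfolding u using that by (subst phi_inv_le_iff[OF G]) (auto intro: power_int_increasing)
  show "\<exists>n. u n \<le> v \<and> v < u (n + 1)" if v: "0 < v"
  proof -
    obtain n :: int where n: "2 powi n \<le> G v" "G v < 2 powi (n + 1)"
      using powi_cover[of 2, OF _ phi_pos[OF G v]] by auto
    moreover have "v < u (n + 1)"
      using n v phi_inv_less_iff[OF G, of "G v" "2 powi (n + 1)"] phi_inv_phi[OF G, of v] phi_nonneg[OF G, of v]
      by (simp add: u)
    ultimately show ?thesis
      using v by (intro exI[of _ n]) (auto simp: u phi_inv_le_iff'[OF G])
  qed
qed

text \<open>The discrete form of having modular at most 1: between consecutive grid points the mass
  is 2^-n / 2.\<close>

lemma grid_sum_le:
  assumes G: "phi_function G" and r: "\<And>v. 0 < v \<Longrightarrow> h v = ennreal (r v)" "\<And>v. 0 < v \<Longrightarrow> 0 \<le> r v"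
    "\<And>v w. 0 < v \<Longrightarrow> v \<le> w \<Longrightarrow> r v \<le> r w"
    and mod: "modular G h \<le> 1" and A: "finite A"
  shows "(\<Sum>n\<in>A. G (r (phi_inv G (2 powi (n::int)))) / 2 powi n) \<le> 2"
proof -
  define u where "u = (\<lambda>n::int. phi_inv G (2 powi n))"
  note u = grid_properties[OF G u_def]
  have "ennreal (\<Sum>n\<in>A. G (r (u n)) * (1 / G (u n) - 1 / G (u (n + 1)))) \<le> modular G h"
  proof (rule modular_ge_sum[OF G A u(1,2)])
    show "ennreal (r (u n)) \<le> h v" if "u n \<le> v" for n v
      using r(1)[of v] r(3)[OF u(1) that] u(1)[of n] that by (auto intro: ennreal_leI)
  qed (use r(2) u(1) in auto)
  then have "ennreal (\<Sum>n\<in>A. G (r (u n)) * (1 / G (u n) - 1 / G (u (n + 1)))) \<le> 1"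
    using mod by (rule order_trans)
  then have "(\<Sum>n\<in>A. G (r (u n)) * (1 / G (u n) - 1 / G (u (n + 1)))) \<le> 1"
    by (simp only: ennreal_le_1)
  also have "(\<Sum>n\<in>A. G (r (u n)) * (1 / G (u n) - 1 / G (u (n + 1))))
      = (\<Sum>n\<in>A. G (r (u n)) / 2 powi n / 2)"
    by (intro sum.cong refl) (simp add: u(3) power_int_add field_simps)
  also have "\<dots> = (\<Sum>n\<in>A. G (r (u n)) / 2 powi n) / 2" by (rule sum_divide_distrib[symmetric])
  finally show ?thesis by (simp add: u_def)
qed

text \<open>Dividing h by C replaces the argument x of K by at most \<epsilon> x. This shrinks the
  linear part of the majorant but not \<tau>, so \<tau> is used only outside a finite set A that
  leaves a small tail, and on A continuity of K at 0 takes over. The budget is 1/2 on A, 1/4 for the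
  linear part and 1/4 for the tail of \<tau>.\<close>

lemma modular_bound_if_dilatory_right:
  assumes G1: "phi_function G1" and G2: "phi_function G2"
    and maj: "summable_majorant (G1 \<circ> phi_inv G2)" and dil: "dilatory G2"
  shows "\<exists>C>0. \<forall>h. (\<forall>u v. 0 < u \<longrightarrow> u \<le> v \<longrightarrow> h u \<le> h v) \<longrightarrow> modular G2 h \<le> 1 \<longrightarrow>
    modular G1 (\<lambda>u. h u / ennreal C) \<le> 1"
proof -
  define K where "K = G1 \<circ> phi_inv G2"
  have K: "phi_function K"
    unfolding K_def by (intro phi_function_comp phi_function_phi_inv G1 G2)
  obtain C0 \<tau> S where C0: "C0 \<ge> 0" and \<tau>: "\<And>n. 0 \<le> \<tau> n" "\<And>A. finite A \<Longrightarrow> sum \<tau> A \<le> S"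
    and le: "\<And>n x. 0 \<le> x \<Longrightarrow> x \<le> 2 powi n \<Longrightarrow> K x \<le> (C0 * x / 2 powi n + \<tau> n) * K (2 powi n)"
    using maj unfolding summable_majorant_def K_def by metis
  define u where "u = (\<lambda>n::int. phi_inv G2 (2 powi n))"
  note u = grid_properties[OF G2 u_def]
  obtain A where A: "finite A" "\<And>B. finite B \<Longrightarrow> B \<inter> A = {} \<Longrightarrow> sum \<tau> B \<le> 1 / 4"
    using finite_set_small_tail[of \<tau> S "1/4"] \<tau> by auto
  have "\<exists>d>0. \<forall>x. 0 \<le> x \<longrightarrow> x \<le> d \<longrightarrow> K x \<le> K (2 powi n) / (2 * (real (card A) + 1))" for n :: int
    using phi_pos[OF K, of "2 powi n"] by (intro phi_small_near_zero[OF K]) simp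
  then obtain d where d: "\<And>n::int. d n > 0"
    "\<And>n x. 0 \<le> x \<Longrightarrow> x \<le> d n \<Longrightarrow> K x \<le> K (2 powi n) / (2 * (real (card A) + 1))" by metis
  \<comment> \<open>The bound 1/2 brings x (n + 1) \<le> 2^(n+1) below 2^n, where the majorant of
    index n applies; 1 / (16 (C0 + 1)) makes the linear coefficient at most 1/8; the last family
    pushes the argument below \<open>d n\<close> for n in A.\<close>
  define \<epsilon> where "\<epsilon> = Min (insert (1 / 2) (insert (1 / (16 * (C0 + 1))) ((\<lambda>n. d n / 2 powi (n + 1)) ` A)))"
  have \<epsilon>: "\<epsilon> > 0" "\<epsilon> \<le> 1 / 2" "\<epsilon> \<le> 1 / (16 * (C0 + 1))" "\<And>n. n \<in> A \<Longrightarrow> \<epsilon> \<le> d n / 2 powi (n + 1)"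
  proof -
    show "\<epsilon> > 0" unfolding \<epsilon>_def using A d(1) C0 by (subst Min_gr_iff) auto
    show "\<epsilon> \<le> 1 / 2" "\<epsilon> \<le> 1 / (16 * (C0 + 1))"
      unfolding \<epsilon>_def by (rule Min_le; use A(1) in simp)+
    show "\<epsilon> \<le> d n / 2 powi (n + 1)" if "n \<in> A" for n
      unfolding \<epsilon>_def by (rule Min_le) (use A(1) that in \<open>simp_all\<close>)
  qed
  obtain C where C: "C \<ge> 1" "\<And>t. t \<ge> 0 \<Longrightarrow> G2 (t / C) \<le> \<epsilon> * G2 t"
    using dilatory_shrink[OF G2 dil \<epsilon>(1)] by auto
  have "modular G1 (\<lambda>u. h u / ennreal C) \<le> 1"
    if mono: "\<And>u v. 0 < u \<Longrightarrow> u \<le> v \<Longrightarrow> h u \<le> h v" and mod: "modular G2 h \<le> 1" for h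
  proof -
    obtain r where r: "\<And>v. 0 < v \<Longrightarrow> h v = ennreal (r v)" "\<And>v. 0 < v \<Longrightarrow> 0 \<le> r v \<and> r v \<le> v"
      "\<And>v w. 0 < v \<Longrightarrow> v \<le> w \<Longrightarrow> r v \<le> r w"
      using modular_le_one_real[OF G2 mono mod] by blast
    define x where "x n = G2 (r (u n))" for n
    have x: "0 \<le> x n" "x n \<le> 2 powi n" for n
      unfolding x_def using r(2)[OF u(1)[of n]] u(3)[of n] phi_mono[OF G2, of "r (u n)" "u n"]
      by (auto intro: phi_nonneg[OF G2])
    have sumx: "(\<Sum>n\<in>B. x n / 2 powi n) \<le> 2" if "finite B" for B
      using grid_sum_le[OF G2 r(1) _ r(3) mod that] r(2) by (simp add: x_def u_def)
    \<comment> \<open>On the slice from u n to u (n + 1) the increasing function is bounded by its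
      value at the right end, hence the index n + 1.\<close>
    define z where "z n = r (u (n + 1)) / C" for n
    have z0: "0 \<le> z n" for n unfolding z_def using r(2)[OF u(1)[of "n + 1"]] C by simp
    define \<beta> where "\<beta> n = G1 (z n) / G1 (u n)" for n
    have Ku: "G1 (u n) = K (2 powi n)" for n by (simp add: K_def u_def)
    have Kp: "K (2 powi n) > 0" for n :: int by (rule phi_pos[OF K]) simp
    have z: "G1 (z n) \<le> K (\<epsilon> * x (n + 1))" for n
    proof -
      have "G1 (z n) = K (G2 (z n))" using z0[of n] by (simp add: K_def phi_inv_phi[OF G2])
      also have "\<dots> \<le> K (\<epsilon> * x (n + 1))"
        using C(2)[of "r (u (n + 1))"] r(2)[OF u(1)[of "n + 1"]] z0[of n]
        by (intro phi_mono[OF K] phi_nonneg[OF G2]) (auto simp: z_def x_def)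
      finally show ?thesis .
    qed
    have \<epsilon>x: "0 \<le> \<epsilon> * x (n + 1)" "\<epsilon> * x (n + 1) \<le> 2 powi n" for n
      using \<epsilon>(1,2) x[of "n + 1"] mult_mono[of \<epsilon> "1/2" "x (n + 1)" "2 powi (n + 1)"]
      by (auto simp: power_int_add)
    have \<beta>out: "\<beta> n \<le> 1 / 8 * (x (n + 1) / 2 powi (n + 1)) + \<tau> n" for n
    proof -
      have "G1 (z n) \<le> (C0 * (\<epsilon> * x (n + 1)) / 2 powi n + \<tau> n) * K (2 powi n)"
        using z[of n] le[OF \<epsilon>x] by (rule order_trans)
      then have "\<beta> n \<le> C0 * (\<epsilon> * x (n + 1)) / 2 powi n + \<tau> n"
        unfolding \<beta>_def Ku using Kp[of n] by (simp add: pos_divide_le_eq)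
      also have "C0 * (\<epsilon> * x (n + 1)) / 2 powi n = (2 * C0 * \<epsilon>) * (x (n + 1) / 2 powi (n + 1))"
        by (simp add: power_int_add)
      also have "\<dots> \<le> 1 / 8 * (x (n + 1) / 2 powi (n + 1))"
      proof (rule mult_right_mono)
        have "C0 * \<epsilon> \<le> (C0 + 1) * (1 / (16 * (C0 + 1)))"
          using \<epsilon>(1,3) C0 by (intro mult_mono) auto
        also have "\<dots> = 1 / 16" using C0 by simp
        finally show "2 * C0 * \<epsilon> \<le> 1 / 8" by simp
      qed (use x in simp)
      finally show ?thesis by simp
    qed
    have \<beta>in: "\<beta> n \<le> 1 / (2 * (real (card A) + 1))" if "n \<in> A" for n
    proof -
      have "\<epsilon> * x (n + 1) \<le> d n / 2 powi (n + 1) * 2 powi (n + 1)"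
        using \<epsilon>(1) \<epsilon>(4)[OF that] x[of "n + 1"] d(1)[of n] by (intro mult_mono) auto
      then have "K (\<epsilon> * x (n + 1)) \<le> K (2 powi n) / (2 * (real (card A) + 1))"
        using \<epsilon>x by (intro d(2)) auto
      then show ?thesis unfolding \<beta>_def Ku using z[of n] Kp[of n]
        by (simp add: pos_divide_le_eq)
    qed
    have \<beta>0: "0 \<le> \<beta> n" for n
      unfolding \<beta>_def using phi_nonneg[OF G1 z0] phi_nonneg[OF G1] u(1)[of n] by (simp add: less_imp_le)
    have sum\<beta>: "sum \<beta> B \<le> 1" if B: "finite B" for B
    proof -
      have "sum \<beta> B = sum \<beta> (B \<inter> A) + sum \<beta> (B - A)"
        using B by (rule sum.Int_Diff)
      also have "sum \<beta> (B \<inter> A) \<le> real (card (B \<inter> A)) * (1 / (2 * (real (card A) + 1)))"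
        using \<beta>in by (intro sum_bounded_above) auto
      also have "\<dots> \<le> real (card A) * (1 / (2 * (real (card A) + 1)))"
        using A(1) by (intro mult_right_mono) (auto intro: card_mono)
      also have "\<dots> \<le> 1 / 2" by (simp add: field_simps)
      also have "sum \<beta> (B - A) \<le> (\<Sum>n\<in>B - A. 1 / 8 * (x (n + 1) / 2 powi (n + 1)) + \<tau> n)"
        by (intro sum_mono \<beta>out)
      also have "\<dots> = 1 / 8 * (\<Sum>n\<in>B - A. x (n + 1) / 2 powi (n + 1)) + sum \<tau> (B - A)"
        by (simp only: sum.distrib sum_distrib_left)
      also have "(\<Sum>n\<in>B - A. x (n + 1) / 2 powi (n + 1)) = (\<Sum>n\<in>(\<lambda>n. n + 1) ` (B - A). x n / 2 powi n)"
        by (simp add: sum.reindex inj_on_def)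
      also have "\<dots> \<le> 2" using B by (intro sumx) auto
      also have "sum \<tau> (B - A) \<le> 1 / 4" using B by (intro A(2)) auto
      finally show ?thesis by simp
    qed
    have "modular G1 (\<lambda>u. h u / ennreal C) \<le> ennreal 1"
    proof (rule modular_le_cover[OF G1 u(1) u(4) _ \<beta>0 sum\<beta>])
      fix n
      let ?V = "\<lambda>i::nat. if i = 0 then u (n + 1) else u n"
      have "slice_le G1 (\<lambda>u. h u / ennreal C) (?V 1) (?V 0) (\<beta> n)"
      proof (rule slice_le_steps[OF G1, where z = "\<lambda>_. z n" and h = "\<lambda>u. h u / ennreal C"])
        show "h v / ennreal C \<le> ennreal (z n)" if "i < 1" "?V (Suc i) \<le> v" "v < ?V i" for i v
        proof -
          have v: "0 < v" "v \<le> u (n + 1)" using that u(1)[of n] by auto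
          then have "h v / ennreal C = ennreal (r v / C)"
            using r(1,2)[of v] C(1) by (simp add: divide_ennreal)
          also have "\<dots> \<le> ennreal (z n)"
            unfolding z_def using r(3)[OF v] C(1) by (intro ennreal_leI divide_right_mono) auto
          finally show ?thesis .
        qed
      qed (use u(1,2) z0 in \<open>auto simp: \<beta>_def\<close>)
      then show "slice_le G1 (\<lambda>u. h u / ennreal C) (u n) (u (n + 1)) (\<beta> n)"
        by simp
    qed auto
    then show ?thesis by simp
  qed
  then show ?thesis using C(1) by (intro exI[of _ C]) auto
qed

text \<open>
  The slice will be evaluated for a function that may grow arbitrarily fast between \<open>a\<close> and \<open>b\<close>,
  hence the bounded number of cuts. They are \<open>r b\<close> and \<open>r (r b)\<close>: if the values of \<open>G\<close> at
  \<open>b, r b, r (r b), r (r (r b))\<close> have the successive ratios \<open>r0, r1, r2\<close>, the bound for the modular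
  yields \<open>r0 + r2 \<le> 1\<close>, hence \<open>r0 r1 r2 \<le> 1 / 4\<close>.
\<close>

lemma modular_slice_cuts:
  assumes G: "phi_function G" and r: "\<And>v. 0 < v \<Longrightarrow> h v = ennreal (r v)" "\<And>v. 0 < v \<Longrightarrow> 0 \<le> r v \<and> r v \<le> v"
    "\<And>v w. 0 < v \<Longrightarrow> v \<le> w \<Longrightarrow> r v \<le> r w"
    and mod: "modular G h \<le> 1" and ab: "0 < a" "a \<le> b" "G b \<le> 2 * G a"
  obtains V1 V2 where "a \<le> V2" "V2 \<le> V1" "V1 \<le> b" "\<And>v. V1 \<le> v \<Longrightarrow> v < b \<Longrightarrow> r v \<le> V1"
    "\<And>v. V2 \<le> v \<Longrightarrow> v < V1 \<Longrightarrow> r v \<le> V2" "\<And>v. a \<le> v \<Longrightarrow> v < V2 \<Longrightarrow> r v \<le> a"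
proof -
  have b: "0 < b" using ab by simp
  have chain: "(\<Sum>i<k. G (r (V i)) * (1 / G (V i) - (if i = 0 then 0 else 1 / G (V (i - 1))))) \<le> 1"
    if V: "\<And>i. i < k \<Longrightarrow> 0 < V i" "\<And>i. Suc i < k \<Longrightarrow> V (Suc i) \<le> V i" for k and V :: "nat \<Rightarrow> real"
  proof -
    have "ennreal (\<Sum>i<k. G (r (V i)) * (1 / G (V i) - (if i = 0 then 0 else 1 / G (V (i - 1)))))
      \<le> modular G h"
    proof (rule modular_ge_chain[OF G, where V = V and k = k and y = "\<lambda>i. r (V i)"])
      show "ennreal (r (V i)) \<le> h v" if "i < k" "V i \<le> v" for i v
        using r(1)[of v] r(3)[of "V i" v] V(1)[OF that(1)] that by (auto intro: ennreal_leI)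
    qed (use r(2) V in auto)
    then have "ennreal (\<Sum>i<k. G (r (V i)) * (1 / G (V i) - (if i = 0 then 0 else 1 / G (V (i - 1))))) \<le> 1"
      using mod by (rule order_trans)
    then show ?thesis by (simp only: ennreal_le_1)
  qed
  consider "r b \<le> a" | "a < r b" "r (r b) \<le> a" | "a < r b" "a < r (r b)" "r (r b) = r b"
    | "a < r b" "a < r (r b)" "r (r b) < r b"
    using r(2)[of "r b"] ab by force
  then show thesis
  proof cases
    case 1
    have "r v \<le> a" if "a \<le> v" "v < b" for v using r(3)[of v b] that ab 1 by auto
    then show thesis by (intro that[of a a]) (use ab in auto)
  next
    case 2
    have "r v \<le> r b" if "a \<le> v" "v < b" for v using r(3)[of v b] that ab by auto
    moreover have "r v \<le> a" if "a \<le> v" "v < r b" for v using r(3)[of v "r b"] that ab 2 by auto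
    ultimately show thesis using 2 ab r(2)[OF b] by (intro that[of a "r b"]) auto
  next
    case 3
    define c where "c = r b"
    have c: "0 < c" "r c = c" using 3 ab by (auto simp: c_def)
    \<comment> \<open>The value r c = c on the ray from c already uses up the whole modular 1, so r
      must vanish below c.\<close>
    have "r v \<le> a" if v: "a \<le> v" "v < c" for v
    proof -
      have "G c * (1 / G c) + G (r v) * (1 / G v - 1 / G c) \<le> 1"
        using chain[of 2 "\<lambda>i. if i = 0 then c else v"] v ab c
        by (simp add: numeral_2_eq_2 less_Suc_eq split: if_splits)
      moreover have "1 / G v - 1 / G c > 0"
        using phi_strict[OF G, of v c] v ab phi_pos[OF G, of v] by (simp add: frac_less2)
      ultimately have "G (r v) \<le> 0" using phi_pos[OF G c(1)] by (simp add: mult_le_0_iff)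
      then show ?thesis using phi_pos[OF G, of "r v"] ab by force
    qed
    moreover have "r v \<le> r b" if "a \<le> v" "v < b" for v using r(3)[of v b] that ab by auto
    ultimately show thesis using 3 ab r(2)[OF b] by (intro that[of a "r b"]) (auto simp: c_def)
  next
    case 4
    define c d where "c = r b" and "d = r c"
    have c: "a < d" "d < c" "c \<le> b" using 4 ab r(2)[OF b] by (auto simp: c_def d_def)
    have "r d \<le> a"
    proof (rule ccontr)
      assume "\<not> ?thesis"
      then have ad: "a < r d" "r d \<le> d" using r(2)[of d] c ab by auto
      define g0 g1 g2 g3 where g: "g0 = G b" "g1 = G c" "g2 = G d" "g3 = G (r d)"
      have le: "g1 \<le> g0" "g2 < g1" "g3 \<le> g2" "g0 < 2 * g3" "0 < g3"
        unfolding g using ad c ab phi_mono[OF G, of c b] phi_strict[OF G, of d c]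
          phi_mono[OF G, of "r d" d] phi_strict[OF G, of a "r d"] phi_pos[OF G, of "r d"] by auto
      have pos: "0 < g0" "0 < g1" "0 < g2" using le by auto
      have "g1 * (1 / g0) + g2 * (1 / g1 - 1 / g0) + g3 * (1 / g2 - 1 / g1) \<le> 1"
        using chain[of 3 "\<lambda>i. if i = 0 then b else if i = 1 then c else d"] c ab b
        by (simp add: numeral_3_eq_3 less_Suc_eq g c_def[symmetric] d_def[symmetric] split: if_splits)
      moreover define r0 r1 r2 where rr: "r0 = g1 / g0" "r1 = g2 / g1" "r2 = g3 / g2"
      moreover have "r0 + r1 * (1 - r0) + r2 * (1 - r1)
          = g1 * (1 / g0) + g2 * (1 / g1 - 1 / g0) + g3 * (1 / g2 - 1 / g1)"
        unfolding rr using pos by (simp add: field_simps)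
      ultimately have "r2 * (1 - r1) \<le> (1 - r0) * (1 - r1)" by (simp add: algebra_simps)
      \<comment> \<open>Dividing by 1 - r1 requires d < c, which is why the fixed point r (r b) = r
        b is a case of its own.\<close>
      moreover have r1: "r1 < 1" "0 < r0" "0 < r2" unfolding rr using le pos by auto
      ultimately have "r2 \<le> 1 - r0" by simp
      then have "r0 * r2 \<le> r0 * (1 - r0)" using r1 by simp
      also have "\<dots> \<le> 1 / 4" using zero_le_power2[of "r0 - 1 / 2"] by (simp add: power2_eq_square algebra_simps)
      finally have "r0 * r2 * r1 \<le> 1 / 4 * 1" using r1 pos by (intro mult_mono) (auto simp: rr)
      moreover have "r0 * r2 * r1 = g3 / g0" unfolding rr using pos by simp
      \<comment> \<open>From a < r d and G b \<le> 2 G a: all four values lie within a factor less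
        than 2.\<close>
      moreover have "1 / 2 < g3 / g0" using le pos by (simp add: field_simps)
      ultimately show False by linarith
    qed
    then have "r v \<le> a" if "a \<le> v" "v < d" for v using r(3)[of v d] that ab by auto
    moreover have "r v \<le> c" if "a \<le> v" "v < b" for v using r(3)[of v b] that ab by (auto simp: c_def)
    moreover have "r v \<le> d" if "a \<le> v" "v < c" for v using r(3)[of v c] that ab by (auto simp: d_def)
    ultimately show thesis using c by (intro that[of d c]) auto
  qed
qed

text \<open>Dividing h by C multiplies G1 o h by at most 1 / W, so the entire majorant shrinks. It
  says nothing about slices with x (n + 1) > 2^n, within which G1 may grow arbitrarily. There
  \<open>modular_slice_cuts\<close> leaves three steps that cost 3 / W together, and this is charged
  to x (n + 1) / 2^(n+1) > 1/2.\<close>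

lemma modular_bound_if_dilatory_left:
  assumes G1: "phi_function G1" and G2: "phi_function G2"
    and maj: "summable_majorant (G1 \<circ> phi_inv G2)" and dil: "dilatory G1"
  shows "\<exists>C>0. \<forall>h. (\<forall>u v. 0 < u \<longrightarrow> u \<le> v \<longrightarrow> h u \<le> h v) \<longrightarrow> modular G2 h \<le> 1 \<longrightarrow>
    modular G1 (\<lambda>u. h u / ennreal C) \<le> 1"
proof -
  define K where "K = G1 \<circ> phi_inv G2"
  have K: "phi_function K"
    unfolding K_def by (intro phi_function_comp phi_function_phi_inv G1 G2)
  obtain C0 \<tau> S where C0: "C0 \<ge> 0" and \<tau>: "\<And>n. 0 \<le> \<tau> n" "\<And>A. finite A \<Longrightarrow> sum \<tau> A \<le> S"
    and le: "\<And>n x. 0 \<le> x \<Longrightarrow> x \<le> 2 powi n \<Longrightarrow> K x \<le> (C0 * x / 2 powi n + \<tau> n) * K (2 powi n)"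
    using maj unfolding summable_majorant_def K_def by metis
  have S: "S \<ge> 0" using \<tau>(2)[of "{}"] by simp
  define u where "u = (\<lambda>n::int. phi_inv G2 (2 powi n))"
  note u = grid_properties[OF G2 u_def]
  \<comment> \<open>Twice the coefficient 2 C0 + 6 of the terms x (n + 1) / 2^(n+1), whose sum is at
    most 2, plus the bound S for the sum of \<tau>.\<close>
  define W where "W = 4 * C0 + S + 12"
  have W: "W > 0" using C0 S by (simp add: W_def)
  obtain C where C: "C \<ge> 1" "\<And>t. t \<ge> 0 \<Longrightarrow> G1 (t / C) \<le> 1 / W * G1 t"
    using dilatory_shrink[OF G1 dil, of "1 / W"] W by auto
  have "modular G1 (\<lambda>u. h u / ennreal C) \<le> 1"
    if mono: "\<And>u v. 0 < u \<Longrightarrow> u \<le> v \<Longrightarrow> h u \<le> h v" and mod: "modular G2 h \<le> 1" for h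
  proof -
    obtain r where r: "\<And>v. 0 < v \<Longrightarrow> h v = ennreal (r v)" "\<And>v. 0 < v \<Longrightarrow> 0 \<le> r v \<and> r v \<le> v"
      "\<And>v w. 0 < v \<Longrightarrow> v \<le> w \<Longrightarrow> r v \<le> r w"
      using modular_le_one_real[OF G2 mono mod] by blast
    define x where "x n = G2 (r (u n))" for n
    have x: "0 \<le> x n" for n
      unfolding x_def using r(2)[OF u(1)[of n]] by (auto intro: phi_nonneg[OF G2])
    have sumx: "(\<Sum>n\<in>B. x n / 2 powi n) \<le> 2" if "finite B" for B
      using grid_sum_le[OF G2 r(1) _ r(3) mod that] r(2) by (simp add: x_def u_def)
    define \<beta> where "\<beta> n = (1 / W) * ((2 * C0 + 6) * (x (n + 1) / 2 powi (n + 1)) + \<tau> n)" for n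
    have \<beta>0: "0 \<le> \<beta> n" for n
      unfolding \<beta>_def using C0 x[of "n + 1"] \<tau>(1)[of n] W by simp
    have sum\<beta>: "sum \<beta> B \<le> 1" if B: "finite B" for B
    proof -
      have "sum \<beta> B = (1 / W) * ((2 * C0 + 6) * (\<Sum>n\<in>B. x (n + 1) / 2 powi (n + 1)) + sum \<tau> B)"
        unfolding \<beta>_def by (simp only: sum_distrib_left[symmetric] sum.distrib)
      also have "(\<Sum>n\<in>B. x (n + 1) / 2 powi (n + 1)) = (\<Sum>n\<in>(\<lambda>n. n + 1) ` B. x n / 2 powi n)"
        by (simp add: sum.reindex inj_on_def)
      also have "(1 / W) * ((2 * C0 + 6) * (\<Sum>n\<in>(\<lambda>n. n + 1) ` B. x n / 2 powi n) + sum \<tau> B)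
        \<le> (1 / W) * ((2 * C0 + 6) * 2 + S)"
        using W C0 B by (intro mult_left_mono add_mono sumx \<tau>) auto
      also have "\<dots> = 1" using W by (simp add: W_def)
      finally show ?thesis .
    qed
    have hz: "h v / ennreal C \<le> ennreal (z / C)" if "0 < v" "r v \<le> z" for v z
      using r(1,2)[OF that(1)] C(1) that by (simp add: divide_ennreal divide_right_mono ennreal_leI)
    have "modular G1 (\<lambda>u. h u / ennreal C) \<le> ennreal 1"
    proof (rule modular_le_cover[OF G1 u(1) u(4) _ \<beta>0 sum\<beta>])
      fix n
      have up: "0 < u n" "u n \<le> u (n + 1)" using u by auto
      show "slice_le G1 (\<lambda>u. h u / ennreal C) (u n) (u (n + 1)) (\<beta> n)"
      proof (cases "x (n + 1) \<le> 2 powi n")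
        case True
        let ?V = "\<lambda>i::nat. if i = 0 then u (n + 1) else u n"
        define z where "z = r (u (n + 1))"
        have z0: "0 \<le> z" unfolding z_def using r(2)[OF u(1)[of "n + 1"]] by simp
        have Kp: "K (2 powi n) > 0" by (rule phi_pos[OF K]) simp
        have "G1 z = K (x (n + 1))" using z0 by (simp add: K_def x_def z_def[symmetric] phi_inv_phi[OF G2])
        also have "\<dots> \<le> (C0 * x (n + 1) / 2 powi n + \<tau> n) * K (2 powi n)" using le[OF x True] .
        finally have "G1 z / G1 (u n) \<le> C0 * x (n + 1) / 2 powi n + \<tau> n"
          using Kp by (simp add: K_def u_def pos_divide_le_eq)
        also have "C0 * x (n + 1) / 2 powi n = 2 * C0 * (x (n + 1) / 2 powi (n + 1))"
          by (simp add: power_int_add)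
        also have "\<dots> \<le> (2 * C0 + 6) * (x (n + 1) / 2 powi (n + 1))"
          using x[of "n + 1"] by (intro mult_right_mono) auto
        finally have *: "G1 z / G1 (u n) \<le> (2 * C0 + 6) * (x (n + 1) / 2 powi (n + 1)) + \<tau> n" by simp
        have "G1 (z / C) / G1 (u n) \<le> (1 / W * G1 z) / G1 (u n)"
          using C(2)[OF z0] phi_pos[OF G1 up(1)] by (intro divide_right_mono) auto
        also have "\<dots> = 1 / W * (G1 z / G1 (u n))" by simp
        also have "\<dots> \<le> \<beta> n" unfolding \<beta>_def using * W by (intro mult_left_mono) auto
        finally have \<beta>: "G1 (z / C) / G1 (u n) \<le> \<beta> n" .
        have "slice_le G1 (\<lambda>u. h u / ennreal C) (?V 1) (?V 0) (\<beta> n)"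
        proof (rule slice_le_steps[OF G1, where z = "\<lambda>_. z / C" and h = "\<lambda>u. h u / ennreal C"])
          show "h v / ennreal C \<le> ennreal (z / C)" if "i < 1" "?V (Suc i) \<le> v" "v < ?V i" for i v
            unfolding z_def using that up r(3)[of v "u (n + 1)"] by (intro hz) auto
        qed (use up z0 \<beta> C in auto)
        then show ?thesis by simp
      next
        case False
        have double: "G2 (u (n + 1)) \<le> 2 * G2 (u n)" by (simp add: u(3) power_int_add)
        obtain V1 V2 where V: "u n \<le> V2" "V2 \<le> V1" "V1 \<le> u (n + 1)"
          "\<And>v. V1 \<le> v \<Longrightarrow> v < u (n + 1) \<Longrightarrow> r v \<le> V1"
          "\<And>v. V2 \<le> v \<Longrightarrow> v < V1 \<Longrightarrow> r v \<le> V2" "\<And>v. u n \<le> v \<Longrightarrow> v < V2 \<Longrightarrow> r v \<le> u n"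
          by (rule modular_slice_cuts[OF G2 r mod up double]) (assumption | rule that)+
        let ?V = "\<lambda>i::nat. if i = 0 then u (n + 1) else if i = 1 then V1 else if i = 2 then V2 else u n"
        have Vp: "0 < ?V i" for i using V up by auto
        have i3: "i < 3 \<longleftrightarrow> i = 0 \<or> i = 1 \<or> i = (2::nat)" for i by auto
        have "3 \<le> 6 * (x (n + 1) / 2 powi (n + 1))" using False by (simp add: power_int_add pos_le_divide_eq)
        also have "\<dots> \<le> (2 * C0 + 6) * (x (n + 1) / 2 powi (n + 1))"
          using C0 x[of "n + 1"] by (intro mult_right_mono) auto
        also have "\<dots> \<le> (2 * C0 + 6) * (x (n + 1) / 2 powi (n + 1)) + \<tau> n"
          using \<tau>(1)[of n] by simp
        finally have *: "3 \<le> (2 * C0 + 6) * (x (n + 1) / 2 powi (n + 1)) + \<tau> n" .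
        \<comment> \<open>Each step is bounded by its own left endpoint, so dilatoriness gives the
          quotient 1 / W however fast G1 grows.\<close>
        have "(\<Sum>i<3. G1 (?V (Suc i) / C) / G1 (?V (Suc i))) \<le> of_nat (card {..<3::nat}) * (1 / W)"
        proof (rule sum_bounded_above)
          show "G1 (?V (Suc i) / C) / G1 (?V (Suc i)) \<le> 1 / W" for i
            using C(2)[of "?V (Suc i)"] Vp[of "Suc i"] phi_pos[OF G1 Vp[of "Suc i"]] by (subst pos_divide_le_eq) auto
        qed
        also have "\<dots> = (1 / W) * 3" by simp
        also have "\<dots> \<le> \<beta> n" unfolding \<beta>_def using * W by (intro mult_left_mono) auto
        finally have \<beta>: "(\<Sum>i<3. G1 (?V (Suc i) / C) / G1 (?V (Suc i))) \<le> \<beta> n" .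
        have "slice_le G1 (\<lambda>u. h u / ennreal C) (?V 3) (?V 0) (\<beta> n)"
        proof (rule slice_le_steps[OF G1, where z = "\<lambda>i. ?V (Suc i) / C" and h = "\<lambda>u. h u / ennreal C"])
          show "h v / ennreal C \<le> ennreal (?V (Suc i) / C)" if "i < 3" "?V (Suc i) \<le> v" "v < ?V i" for i v
            by (rule hz) (use that V up in \<open>auto simp: i3 split: if_splits\<close>)
          show "?V (Suc i) \<le> ?V i" if "i < 3" for i
            using that V up unfolding i3 by auto
          show "0 \<le> ?V (Suc i) / C" for i using Vp[of "Suc i"] C(1) by (intro divide_nonneg_nonneg) auto
        qed (use Vp \<beta> in auto)
        then show ?thesis by simp
      qed
    qed auto
    then show ?thesis by simp
  qed
  then show ?thesis using C(1) by (intro exI[of _ C]) auto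
qed

text \<open>Homogeneity: if c is admissible for G2, the modular bound applied to h / c makes c C
  admissible for G1.\<close>

lemma orlicz_lorentz_bound:
  assumes F: "phi_function F" and G1: "phi_function G1" and G2: "phi_function G2"
    and maj: "summable_majorant (G1 \<circ> phi_inv G2)" and dil: "dilatory G1 \<or> dilatory G2"
  shows "\<exists>c>0. \<forall>f. orlicz_lorentz (lebesgue_on {0..}) F G1 f
    \<le> ennreal c * orlicz_lorentz (lebesgue_on {0..}) F G2 f"
proof -
  obtain C where C: "C > 0" and bd: "\<And>h. (\<And>u v. 0 < u \<Longrightarrow> u \<le> v \<Longrightarrow> h u \<le> h v) \<Longrightarrow>
      modular G2 h \<le> 1 \<Longrightarrow> modular G1 (\<lambda>u. h u / ennreal C) \<le> 1"
    using modular_bound_if_dilatory_left[OF G1 G2 maj] modular_bound_if_dilatory_right[OF G1 G2 maj] dil by metis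
  have "orlicz_lorentz (lebesgue_on {0..}) F G1 f
    \<le> ennreal C * orlicz_lorentz (lebesgue_on {0..}) F G2 f" for f
  proof -
    let ?h = "\<lambda>u. rearrangement (lebesgue_on {0..}) f (1 / F u)"
    have "orlicz_lorentz (lebesgue_on {0..}) F G1 f / ennreal C \<le> orlicz_lorentz (lebesgue_on {0..}) F G2 f"
      unfolding orlicz_lorentz_eq_modular[OF F G2]
    proof (rule Inf_greatest, clarify)
      fix c :: real assume c: "c > 0" and mod: "modular G2 (\<lambda>u. ?h u / ennreal c) \<le> 1"
      have "?h u \<le> ?h v" if "0 < u" "u \<le> v" for u v
        using phi_mono[OF F, of u v] phi_pos[OF F, of u] that
        by (intro antimono_rearrangement divide_left_mono) auto
      then have "modular G1 (\<lambda>u. ?h u / ennreal c / ennreal C) \<le> 1"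
        by (intro bd mod divide_right_mono_ennreal)
      moreover have "y / ennreal c / ennreal C = y / ennreal (c * C)" for y
        using c C by (simp add: ennreal_mult divide_ennreal_def ennreal_inverse_mult ac_simps)
      ultimately have "modular G1 (\<lambda>u. ?h u / ennreal (c * C)) \<le> 1" by simp
      then have "orlicz_lorentz (lebesgue_on {0..}) F G1 f \<le> ennreal (c * C)"
        unfolding orlicz_lorentz_eq_modular[OF F G1] using c C by (intro Inf_lower) auto
      then have "orlicz_lorentz (lebesgue_on {0..}) F G1 f / ennreal C \<le> ennreal (c * C) / ennreal C"
        by (rule divide_right_mono_ennreal)
      also have "\<dots> = ennreal c" using c C by (simp add: divide_ennreal)
      finally show "orlicz_lorentz (lebesgue_on {0..}) F G1 f / ennreal C \<le> ennreal c" .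
    qed
    then have "ennreal C * (orlicz_lorentz (lebesgue_on {0..}) F G1 f / ennreal C)
      \<le> ennreal C * orlicz_lorentz (lebesgue_on {0..}) F G2 f" by (intro mult_left_mono) auto
    moreover have "ennreal C * (orlicz_lorentz (lebesgue_on {0..}) F G1 f / ennreal C)
      = orlicz_lorentz (lebesgue_on {0..}) F G1 f"
      unfolding ennreal_times_divide using C by (subst mult.commute, intro mult_divide_eq_ennreal) auto
    ultimately show ?thesis by simp
  qed
  then show ?thesis using C by blast
qed

subsection \<open>Necessity of almost convexity\<close>

text \<open>In increasing order the terms at least double, so the sum of all terms below the largest
  one is at most that term.\<close>

lemma sum_doubling_le:
  fixes k :: "'i::linorder \<Rightarrow> real"
  assumes fin: "finite T" and ne: "T \<noteq> {}" and k: "\<And>n. n \<in> T \<Longrightarrow> 0 \<le> k n"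
    and dbl: "\<And>n n'. n \<in> T \<Longrightarrow> n' \<in> T \<Longrightarrow> n < n' \<Longrightarrow> 2 * k n \<le> k n'"
  shows "sum k T \<le> 2 * k (Max T)"
  using assms
proof (induction T rule: finite_linorder_max_induct)
  case (insert b A)
  then have Max: "Max (insert b A) = b" by (intro Max_eqI) (auto intro: less_imp_le)
  have b: "b \<notin> A" using insert by auto
  show ?case
  proof (cases "A = {}")
    case True
    then show ?thesis using insert by simp
  next
    case False
    then have "sum k A \<le> 2 * k (Max A)" using insert by auto
    also have "\<dots> \<le> k b" using insert False by auto
    finally show ?thesis using insert b Max by simp
  qed
qed simp

text \<open>Distinct integers of equal parity differ by at least 2. For integer parts of log K this
  is the gap that guarantees a factor 2 between the values of K.\<close>

lemma large_set_same_parity: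
  fixes X :: "int set"
  assumes "infinite X \<or> 2 * k \<le> card X"
  obtains Y where "Y \<subseteq> X" "finite Y" "card Y = k" "\<And>y z. y \<in> Y \<Longrightarrow> z \<in> Y \<Longrightarrow> even (y - z)"
proof -
  obtain X0 where X0: "X0 \<subseteq> X" "finite X0" "2 * k \<le> card X0"
  proof (cases "finite X")
    case False
    then obtain B where "finite B" "card B = 2 * k" "B \<subseteq> X" using infinite_arbitrarily_large by blast
    then show thesis using that by auto
  qed (use assms that in auto)
  have "card X0 = card {x \<in> X0. even x} + card {x \<in> X0. odd x}"
    using X0(2) by (subst card_Un_disjoint[symmetric]) (auto intro: arg_cong[of _ _ card])
  then consider "k \<le> card {x \<in> X0. even x}" | "k \<le> card {x \<in> X0. odd x}" using X0(3) by linarith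
  then show thesis
  proof cases
    case 1
    then obtain Y where "Y \<subseteq> {x \<in> X0. even x}" "card Y = k" "finite Y"
      by (rule obtain_subset_with_card_n)
    then show thesis using X0 by (intro that[of Y]) auto
  next
    case 2
    then obtain Y where "Y \<subseteq> {x \<in> X0. odd x}" "card Y = k" "finite Y"
      by (rule obtain_subset_with_card_n)
    then show thesis using X0 by (intro that[of Y]) auto
  qed
qed

text \<open>Every exceptional n contributes at least 2^N / 2^m to the sum, so \<delta> 2^m / 2 of
  them exceed A by the choice of N. The cap on the cardinality will keep the test function in the
  unit ball for G2. For the doubling, the exceptional set has to meet at least 2 * 2^m distinct
  levels, the integer parts of log K.\<close>

lemma not_almost_convex_select:
  assumes K: "phi_function K" and nac: "\<not> almost_convex K" and \<delta>: "0 < \<delta>" "\<delta> \<le> 1"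
  obtains m :: nat and T :: "int set" where "finite T" "real (card T) \<le> \<delta> * 2 ^ m"
    "\<And>n n'. n \<in> T \<Longrightarrow> n' \<in> T \<Longrightarrow> n < n' \<Longrightarrow> 2 * K (2 powi n) \<le> K (2 powi n')"
    "A < (\<Sum>n\<in>T. K (2 powi n) / K (2 powi (n + int m)))"
proof -
  have Kp: "K (2 powi n) > 0" for n :: int by (rule phi_pos[OF K]) simp
  have Kmono: "K (2 powi n) \<le> K (2 powi n')" if "n \<le> n'" for n n' :: int
    using that by (intro phi_mono[OF K] power_int_increasing) auto
  obtain N where N: "max (2 / \<delta>) (2 * A / \<delta>) < 2 ^ N" using real_arch_pow[of 2 "max (2 / \<delta>) (2 * A / \<delta>)"] by auto
  then have N2: "2 < \<delta> * 2 ^ N" "2 * A < \<delta> * 2 ^ N" using \<delta> by (auto simp: field_simps)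
  have N1: "N \<ge> 1" using N2(1) \<delta> by (cases N) auto
  define E where "E m = {n. \<not> K (2 powi (n + int m)) \<ge> 2 powi (int m - int N) * K (2 powi n)}" for m :: nat
  define lev where "lev n = \<lfloor>log 2 (K (2 powi n))\<rfloor>" for n :: int
  have lev: "2 powr of_int (lev n) \<le> K (2 powi n)" "K (2 powi n) < 2 powr (of_int (lev n) + 1)" for n
    using Kp[of n] unfolding lev_def
    by (simp_all add: le_log_iff[symmetric] log_less_iff[symmetric])
  have levmono: "lev n \<le> lev n'" if "n \<le> n'" for n n'
    unfolding lev_def using Kmono[OF that] Kp by (intro floor_mono) (simp add: log_le_cancel_iff)
  have levless: "2 * K (2 powi n) \<le> K (2 powi n')" if "lev n + 2 \<le> lev n'" for n n'
  proof -
    have "2 * K (2 powi n) \<le> 2 powr 1 * 2 powr (of_int (lev n) + 1)" using lev(2)[of n] by simp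
    also have "\<dots> = 2 powr (1 + (of_int (lev n) + 1))" by (rule powr_add[symmetric])
    also have "\<dots> \<le> 2 powr (of_int (lev n'))" using that by (intro powr_mono) auto
    also have "\<dots> \<le> K (2 powi n')" by (rule lev)
    finally show ?thesis .
  qed
  have fiber: "finite {n. lev n = y}" for y
  proof -
    obtain i :: int where i: "2 powi i \<le> phi_inv K (2 powr of_int y)"
      using powi_cover[of 2 "phi_inv K (2 powr of_int y)"] phi_inv_pos[OF K] by auto
    obtain j :: int where j: "phi_inv K (2 powr (of_int y + 1)) < 2 powi (j + 1)"
      using powi_cover[of 2 "phi_inv K (2 powr (of_int y + 1))"] phi_inv_pos[OF K] by auto
    have "n \<in> {i..j + 1}" if "lev n = y" for n
    proof -
      have "phi_inv K (2 powr of_int y) \<le> 2 powi n" "2 powi n \<le> phi_inv K (2 powr (of_int y + 1))"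
        using lev[of n] that by (auto simp: phi_inv_le_iff'[OF K] le_phi_inv_iff[OF K])
      then have "(2::real) powi i \<le> 2 powi n" "(2::real) powi n \<le> 2 powi (j + 1)" using i j by auto
      then show ?thesis
        using power_int_strict_increasing[of n i "2::real"] power_int_strict_increasing[of "j + 1" n "2::real"]
        by force
    qed
    then have "{n. lev n = y} \<subseteq> {i..j + 1}" by blast
    then show ?thesis by (rule finite_subset) simp
  qed
  have ex: "\<exists>m\<ge>1. \<not> (finite (E m) \<and> real (card (E m)) < b ^ m)" if "b > 1" for b
  proof (rule ccontr)
    assume "\<not> ?thesis"
    then have "almost_convex K" unfolding almost_convex_def Let_def E_def
      using that N1 by (intro exI[of _ 2] conjI exI[of _ b] exI[of _ N]) auto
    then show False using nac by simp
  qed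
  have "\<exists>m\<ge>1. E m \<noteq> {} \<and> (infinite (lev ` E m) \<or> 2 * 2 ^ m \<le> card (lev ` E m))"
  proof (cases "\<exists>m\<ge>1. infinite (E m)")
    case True
    then obtain m where m: "m \<ge> 1" "infinite (E m)" by auto
    have "infinite (lev ` E m)"
    proof
      assume "finite (lev ` E m)"
      then obtain n0 where "infinite {n \<in> E m. lev n = lev n0}"
        using pigeonhole_infinite[OF m(2)] by blast
      moreover have "{n \<in> E m. lev n = lev n0} \<subseteq> {n. lev n = lev n0}" by blast
      ultimately show False using fiber[of "lev n0"] finite_subset by metis
    qed
    then show ?thesis using m by (intro exI[of _ m]) auto
  next
    case False
    then have fin: "finite (E m)" if "m \<ge> 1" for m using that by blast
    \<comment> \<open>Outside S the values K (2^n) at least double within N + 1 steps, so at most N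
      + 1 points of T0 share a level.\<close>
    define S where "S = E (N + 1)"
    \<comment> \<open>Almost convexity fails for every base b. The base 2 q is so large that 2 * 2^m
      levels remain after S is removed and N + 1 points are counted for each level.\<close>
    define q where "q = card S + 2 * (N + 1)"
    obtain m where m: "m \<ge> 1" "\<not> (finite (E m) \<and> real (card (E m)) < (2 * real q) ^ m)"
      using ex[of "2 * real q"] by (auto simp: q_def)
    then have "real ((2 * q) ^ m) \<le> real (card (E m))" using fin by simp
    then have big: "(2 * q) ^ m \<le> card (E m)" by (simp only: of_nat_le_iff)
    define T0 where "T0 = E m - S"
    have finT0: "finite T0" using fin[OF m(1)] by (simp add: T0_def)
    have fib: "card {n \<in> T0. lev n = y} \<le> N + 1" for y
    proof (cases "{n \<in> T0. lev n = y} = {}")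
      case True
      show ?thesis unfolding True by simp
    next
      case False
      define n0 where "n0 = Min {n \<in> T0. lev n = y}"
      have n0: "n0 \<in> T0" "lev n0 = y" using Min_in[of "{n \<in> T0. lev n = y}"] finT0 False by (auto simp: n0_def)
      have "n \<in> {n0..<n0 + int (N + 1)}" if n: "n \<in> T0" "lev n = y" for n
      proof -
        have "n0 \<le> n" using n finT0 by (auto simp: n0_def)
        moreover have "n < n0 + int (N + 1)"
        proof (rule ccontr)
          assume "\<not> ?thesis"
          then have le: "K (2 powi (n0 + int (N + 1))) \<le> K (2 powi n)" by (intro Kmono) simp
          have "n0 \<notin> S" using n0 by (simp add: T0_def)
          then have "2 * K (2 powi n0) \<le> K (2 powi (n0 + int (N + 1)))" by (simp add: S_def E_def)
          with le have "2 * K (2 powi n0) \<le> K (2 powi n)" by simp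
          moreover have "2 powr (of_int y + 1) \<le> 2 * K (2 powi n0)"
            using lev(1)[of n0] n0 by (simp add: powr_add)
          ultimately show False using lev(2)[of n] n by simp
        qed
        ultimately show ?thesis by simp
      qed
      then have "card {n \<in> T0. lev n = y} \<le> card {n0..<n0 + int (N + 1)}" by (intro card_mono) auto
      then show ?thesis by simp
    qed
    have "card T0 = (\<Sum>y\<in>lev ` T0. card {n \<in> T0. lev n = y})"
      using sum.image_gen[OF finT0, of "\<lambda>_. 1::nat" lev] by simp
    also have "\<dots> \<le> card (lev ` T0) * (N + 1)"
      using sum_bounded_above[of "lev ` T0" "\<lambda>y. card {n \<in> T0. lev n = y}" "N + 1"] fib by simp
    also have "\<dots> \<le> card (lev ` E m) * (N + 1)"
      using fin[OF m(1)] by (intro mult_right_mono card_mono) (auto simp: T0_def)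
    finally have c1: "card T0 \<le> card (lev ` E m) * (N + 1)" .
    have "card (E m) \<le> card T0 + card S"
      unfolding T0_def using diff_card_le_card_Diff[of S "E m"] fin[of "N + 1"] by (simp add: S_def)
    moreover have "card S + (N + 1) * (2 * 2 ^ m) \<le> (2 * q) ^ m"
    proof -
      have "card S * 1 + (N + 1) * (2 * 2 ^ m) \<le> card S * 2 ^ m + (N + 1) * (2 * 2 ^ m)"
        by (intro add_right_mono mult_left_mono) auto
      also have "\<dots> = 2 ^ m * q" by (simp add: q_def algebra_simps)
      also have "\<dots> \<le> 2 ^ m * q ^ m"
        using m(1) by (intro mult_left_mono self_le_power) (auto simp: q_def)
      finally show ?thesis by (simp add: power_mult_distrib)
    qed
    ultimately have "(N + 1) * (2 * 2 ^ m) \<le> (N + 1) * card (lev ` E m)"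
      using c1 big by (simp only: mult.commute)
    then have "2 * 2 ^ m \<le> card (lev ` E m)"
      by (simp only: Suc_eq_plus1[symmetric] Suc_mult_le_cancel1)
    then show ?thesis using m(1) by (intro exI[of _ m]) auto
  qed
  then obtain m where m: "m \<ge> 1" "E m \<noteq> {}" "infinite (lev ` E m) \<or> 2 * 2 ^ m \<le> card (lev ` E m)" by blast
  \<comment> \<open>For m \<le> N the growth condition follows from monotonicity, so no n is
    exceptional. With m > N, \<delta> 2^m exceeds 2 and rounding it down loses at most half.\<close>
  have mN: "N < m"
  proof (rule ccontr)
    assume "\<not> ?thesis"
    obtain n where n: "n \<in> E m" using m by auto
    have "2 powi (int m - int N) * K (2 powi n) \<le> 1 * K (2 powi n)"
      using Kp[of n] \<open>\<not> N < m\<close> power_int_increasing[of "int m - int N" 0 "2::real"] by (intro mult_right_mono) auto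
    also have "\<dots> \<le> K (2 powi (n + int m))" using Kmono[of n "n + int m"] by simp
    finally show False using n by (simp add: E_def)
  qed
  define J where "J = nat \<lfloor>\<delta> * 2 ^ m\<rfloor>"
  have "2 < \<delta> * 2 ^ m"
  proof -
    have "\<delta> * 2 ^ N \<le> \<delta> * 2 ^ m" using mN \<delta> by (intro mult_left_mono power_increasing) auto
    then show ?thesis using N2 by linarith
  qed
  then have J: "real J \<le> \<delta> * 2 ^ m" "\<delta> * 2 ^ m / 2 \<le> real J" unfolding J_def by linarith+
  have "real J \<le> 1 * 2 ^ m" using J(1) \<delta> by (intro order_trans[OF J(1)] mult_right_mono) auto
  then have "real J \<le> real (2 ^ m)" by simp
  then have "J \<le> 2 ^ m" by (simp only: of_nat_le_iff)
  then have "infinite (lev ` E m) \<or> 2 * J \<le> card (lev ` E m)" using m(3) by auto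
  then obtain Y where Y: "Y \<subseteq> lev ` E m" "finite Y" "card Y = J" "\<And>y z. y \<in> Y \<Longrightarrow> z \<in> Y \<Longrightarrow> even (y - z)"
    using large_set_same_parity by metis
  define T where "T = inv_into (E m) lev ` Y"
  have TY: "lev n \<in> Y" "n \<in> E m" if "n \<in> T" for n
    using that Y(1) by (auto simp: T_def f_inv_into_f inv_into_into subset_iff)
  have Tinj: "n = n'" if "n \<in> T" "n' \<in> T" "lev n = lev n'" for n n'
    using that Y(1) by (auto simp: T_def f_inv_into_f subset_iff)
  show thesis
  proof (rule that[of T m])
    show "finite T" using Y by (simp add: T_def)
    have cT: "card T = J" unfolding T_def using Y inj_on_inv_into[OF Y(1)] by (simp add: card_image)
    then show "real (card T) \<le> \<delta> * 2 ^ m" using J by simp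
    show "2 * K (2 powi n) \<le> K (2 powi n')" if "n \<in> T" "n' \<in> T" "n < n'" for n n'
    proof (rule levless)
      have "lev n \<le> lev n'" "lev n \<noteq> lev n'" using levmono Tinj that by auto
      then show "lev n + 2 \<le> lev n'" using Y(4)[OF TY(1)[OF that(1)] TY(1)[OF that(2)]] by presburger
    qed
    have "A < \<delta> * 2 ^ N / 2" using N2 by simp
    also have "\<dots> = \<delta> * 2 ^ m / 2 * (2 ^ N / 2 ^ m)" by simp
    also have "\<dots> \<le> real (card T) * (2 ^ N / 2 ^ m)" unfolding cT using J by (intro mult_right_mono) auto
    also have "\<dots> \<le> (\<Sum>n\<in>T. K (2 powi n) / K (2 powi (n + int m)))"
    proof (rule sum_bounded_below)
      fix n assume "n \<in> T"
      then have "K (2 powi (n + int m)) \<le> 2 ^ m / 2 ^ N * K (2 powi n)"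
        using TY(2)[of n] by (simp add: E_def power_int_diff)
      then show "2 ^ N / 2 ^ m \<le> K (2 powi n) / K (2 powi (n + int m))"
        using Kp[of "n + int m"] by (simp add: field_simps)
    qed
    finally show "A < (\<Sum>n\<in>T. K (2 powi n) / K (2 powi (n + int m)))" .
  qed
qed

section \<open>The test function and its rearrangement\<close>

lemma modular_mono:
  assumes G: "phi_function G" and le: "\<And>u. h u \<le> h' u"
  shows "modular G h \<le> modular G h'"
  unfolding modular_def by (intro nn_integral_mono mult_right_mono mono_phi_ext[OF G] le) simp

text \<open>f is decreasing, and left-continuous since the steps are closed on the right; this
  matches the non-strict inequalities in the rearrangement, so f is its own rearrangement on x >
  0.\<close>

lemma rearrangement_step:
  fixes s y :: "'i \<Rightarrow> real"
  assumes fin: "finite T" and ne: "T \<noteq> {}" and y: "\<And>n. n \<in> T \<Longrightarrow> 0 \<le> y n"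
    and f: "f = (\<lambda>x. Max ((\<lambda>n. y n * indicator {..s n} x) ` T))"
  shows "(\<lambda>x. complex_of_real (f x)) \<in> borel_measurable (lebesgue_on {0..})"
    and "0 < x \<Longrightarrow> rearrangement (lebesgue_on {0..}) (\<lambda>x. complex_of_real (f x)) x = ennreal (f x)"
    and "n \<in> T \<Longrightarrow> x \<le> s n \<Longrightarrow> y n \<le> f x"
    and "f x = 0 \<or> (\<exists>n\<in>T. x \<le> s n \<and> f x = y n)"
proof -
  have meas0: "f \<in> borel_measurable borel"
    unfolding f using fin by (intro borel_measurable_Max) auto
  then have "f \<in> borel_measurable lebesgue" by (intro measurable_completion) simp
  then show meas: "(\<lambda>x. complex_of_real (f x)) \<in> borel_measurable (lebesgue_on {0..})"
    by (intro measurable_restrict_space1) measurable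
  have ge: "y n * indicator {..s n} x \<le> f x" if "n \<in> T" for n x
    unfolding f using fin that by (intro Max_ge) auto
  then show ge': "y n \<le> f x" if "n \<in> T" "x \<le> s n" for n x
    using ge[OF that(1), of x] that by simp
  have cases: "f x = 0 \<or> (\<exists>n\<in>T. x \<le> s n \<and> f x = y n)" for x
  proof -
    have "f x \<in> (\<lambda>n. y n * indicator {..s n} x) ` T"
      unfolding f using fin ne by (intro Max_in) auto
    then show ?thesis by (auto simp: indicator_def)
  qed
  then show "f x = 0 \<or> (\<exists>n\<in>T. x \<le> s n \<and> f x = y n)" .
  have f0: "0 \<le> f x" for x using cases[of x] y by auto
  have anti: "f x' \<le> f x" if "x \<le> x'" for x x'
    using cases[of x'] f0[of x] ge' that by force
  show "rearrangement (lebesgue_on {0..}) (\<lambda>x. complex_of_real (f x)) x = ennreal (f x)" if x: "0 < x" for x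
  proof (rule antisym)
    let ?M = "lebesgue_on {0::real..}"
    have iv: "emeasure ?M {0..b} = ennreal b" if "0 \<le> b" for b
      using that by (subst emeasure_restrict_space) (auto simp: max_def)
    have norm: "norm (complex_of_real (f \<omega>)) = f \<omega>" for \<omega> using f0 by simp
    show "rearrangement ?M (\<lambda>x. complex_of_real (f x)) x \<le> ennreal (f x)"
      unfolding rearrangement_def norm
    proof (rule Sup_least, clarify)
      fix t :: real
      assume t: "0 \<le> t" and em: "ennreal x \<le> emeasure ?M {\<omega> \<in> space ?M. t \<le> f \<omega>}"
      show "ennreal t \<le> ennreal (f x)"
      proof (rule ccontr)
        assume "\<not> ?thesis"
        then have ft: "f x < t" by (meson ennreal_leI linorder_not_le)
        then have t0: "0 < t" using f0[of x] by simp
        \<comment> \<open>The element 0 keeps the maximum defined and non-negative if no step of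
          height at least t reaches into [0, \<infinity>).\<close>
        define Z where "Z = insert 0 (s ` {n \<in> T. t \<le> y n})"
        have Z: "finite Z" "0 \<in> Z" using fin by (auto simp: Z_def)
        have "z < x" if "z \<in> Z" for z
          using that x ge'[of _ x] ft by (force simp: Z_def not_less[symmetric])
        then have Mx: "Max Z < x" using Z by (subst Max_less_iff) auto
        have M0: "0 \<le> Max Z" using Z by (intro Max_ge) auto
        have "{\<omega> \<in> space ?M. t \<le> f \<omega>} \<subseteq> {0..Max Z}"
        proof
          fix \<omega> assume \<omega>: "\<omega> \<in> {\<omega> \<in> space ?M. t \<le> f \<omega>}"
          then obtain n where "n \<in> T" "\<omega> \<le> s n" "t \<le> y n" using cases[of \<omega>] t0 by auto
          moreover then have "s n \<le> Max Z" using Z by (intro Max_ge) (auto simp: Z_def)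
          ultimately show "\<omega> \<in> {0..Max Z}" using \<omega> by (auto simp: space_restrict_space)
        qed
        then have "emeasure ?M {\<omega> \<in> space ?M. t \<le> f \<omega>} \<le> emeasure ?M {0..Max Z}"
          by (intro emeasure_mono) (auto simp: sets_restrict_space_iff)
        also have "\<dots> = ennreal (Max Z)" using M0 by (rule iv)
        finally have "ennreal x \<le> ennreal (Max Z)" using em by simp
        then show False using Mx M0 x by (simp add: ennreal_le_iff)
      qed
    qed
    have "{0..x} \<subseteq> {\<omega> \<in> space ?M. f x \<le> f \<omega>}" using anti by (auto simp: space_restrict_space)
    moreover have "f \<in> borel_measurable ?M"
      using \<open>f \<in> borel_measurable lebesgue\<close> by (rule measurable_restrict_space1)
    then have "{\<omega> \<in> space ?M. f x \<le> f \<omega>} \<in> sets ?M" by measurable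
    ultimately have "emeasure ?M {0..x} \<le> emeasure ?M {\<omega> \<in> space ?M. f x \<le> f \<omega>}"
      by (rule emeasure_mono)
    then show "ennreal (f x) \<le> rearrangement ?M (\<lambda>x. complex_of_real (f x)) x"
      unfolding rearrangement_def norm using f0[of x] x iv[of x]
      by (intro Sup_upper) auto
  qed
qed

text \<open>In the variable v, the test function has height at least \<open>y n\<close> from
  \<open>u n\<close> on, for each selected n. For G2 a step costs at most 2^n / \<delta> times
  2^-(n+m), and the cap on their number keeps the total at most 1. For G1 the steps contribute, up
  to constants, the sum of K (2^n) / K (2^(n+m)), which was selected to be large.\<close>

lemma almost_convex_if_orlicz_lorentz_bound:
  assumes F: "phi_function F" and G1: "phi_function G1" and G2: "phi_function G2"
    and D: "Delta2 G1 \<or> Delta2 G2" and c: "c > 0"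
    and bd: "\<And>f :: real \<Rightarrow> complex. f \<in> borel_measurable (lebesgue_on {0..}) \<Longrightarrow>
      orlicz_lorentz (lebesgue_on {0..}) F G1 f \<le> ennreal c * orlicz_lorentz (lebesgue_on {0..}) F G2 f"
  shows "almost_convex (G1 \<circ> phi_inv G2)"
proof (rule ccontr)
  assume nac: "\<not> almost_convex (G1 \<circ> phi_inv G2)"
  define K where "K = G1 \<circ> phi_inv G2"
  have K: "phi_function K"
    unfolding K_def by (intro phi_function_comp phi_function_phi_inv G1 G2)
  \<comment> \<open>Delta_2 absorbs the dilation by c + 1, either in the values (for G1: a factor C,
    with \<delta> = 1) or in the heights of the steps (for G2: a factor 1 / \<delta>, with C =
    1).\<close>
  have "\<exists>\<delta> C. 0 < \<delta> \<and> \<delta> \<le> 1 \<and> 1 \<le> C \<and>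
    (\<forall>n::int. K (2 powi n) \<le> C * G1 (phi_inv G2 (2 powi n / \<delta>) / (c + 1)))"
    using D
  proof
    assume "Delta2 G1"
    then obtain C where C: "C \<ge> 1" "\<And>t. t \<ge> 0 \<Longrightarrow> G1 ((c + 1) * t) \<le> C * G1 t"
      using Delta2_iterate[OF G1, of "c + 1"] c by auto
    have "K (2 powi n) \<le> C * G1 (phi_inv G2 (2 powi n / 1) / (c + 1))" for n :: int
      using C(2)[of "phi_inv G2 (2 powi n / 1) / (c + 1)"] c phi_inv_nonneg[OF G2, of "2 powi n"] by (simp add: K_def)
    then show ?thesis using C(1) by (intro exI[of _ 1] exI[of _ C]) auto
  next
    assume "Delta2 G2"
    then obtain C where C: "C \<ge> 1" "\<And>t. t \<ge> 0 \<Longrightarrow> G2 ((c + 1) * t) \<le> C * G2 t"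
      using Delta2_iterate[OF G2, of "c + 1"] c by auto
    have "K (2 powi n) \<le> 1 * G1 (phi_inv G2 (2 powi n / (1 / C)) / (c + 1))" for n :: int
    proof -
      have u: "phi_inv G2 (2 powi n) \<ge> 0" by (rule phi_inv_nonneg[OF G2]) simp
      have "G2 ((c + 1) * phi_inv G2 (2 powi n)) \<le> C * 2 powi n"
        using C(2)[OF u] by (simp add: phi_phi_inv[OF G2])
      then have "(c + 1) * phi_inv G2 (2 powi n) \<le> phi_inv G2 (C * 2 powi n)"
        using u c C(1) by (subst le_phi_inv_iff[OF G2]) auto
      then have "phi_inv G2 (2 powi n) \<le> phi_inv G2 (2 powi n / (1 / C)) / (c + 1)"
        using c by (simp add: field_simps)
      then show ?thesis using u by (simp add: K_def phi_mono[OF G1])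
    qed
    then show ?thesis using C(1) by (intro exI[of _ "1 / C"] exI[of _ 1]) auto
  qed
  then obtain \<delta> C where \<delta>: "0 < \<delta>" "\<delta> \<le> 1" and C: "1 \<le> C"
    and KC: "\<And>n::int. K (2 powi n) \<le> C * G1 (phi_inv G2 (2 powi n / \<delta>) / (c + 1))" by blast
  obtain m T where T: "finite T" "real (card T) \<le> \<delta> * 2 ^ m"
    and dbl: "\<And>n n'. n \<in> T \<Longrightarrow> n' \<in> T \<Longrightarrow> n < n' \<Longrightarrow> 2 * K (2 powi n) \<le> K (2 powi n')"
    and big: "2 * C < (\<Sum>n\<in>T. K (2 powi n) / K (2 powi (n + int m)))"
    by (rule not_almost_convex_select[OF K nac[folded K_def] \<delta>, of "2 * C"]) (assumption | rule that)+
  have ne: "T \<noteq> {}" using big C by auto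
  define u where "u n = phi_inv G2 (2 powi (n + int m))" for n
  define y where "y n = phi_inv G2 (2 powi n / \<delta>)" for n
  define s where "s n = 1 / F (u n)" for n
  have up: "0 < u n" for n unfolding u_def by (rule phi_inv_pos[OF G2]) simp
  have y0: "0 \<le> y n" for n unfolding y_def using \<delta> by (intro phi_inv_nonneg[OF G2]) simp
  define f where "f = (\<lambda>x. Max ((\<lambda>n. y n * indicator {..s n} x) ` T))"
  note step = rearrangement_step[OF T(1) ne y0 f_def]
  let ?f = "\<lambda>x. complex_of_real (f x)"
  let ?h = "\<lambda>v. rearrangement (lebesgue_on {0..}) ?f (1 / F v)"
  have h: "?h v = ennreal (f (1 / F v))" if "0 < v" for v
    using that phi_pos[OF F that] by (intro step(2)) simp
  have s_iff: "1 / F v \<le> s n \<longleftrightarrow> u n \<le> v" if "0 < v" for v n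
    unfolding s_def using that up[of n] phi_pos[OF F that] phi_pos[OF F up[of n]]
    by (simp add: divide_le_cancel field_simps phi_le_iff[OF F])
  have "modular G2 (\<lambda>v. ?h v / ennreal 1) \<le> 1"
  proof -
    have "modular G2 (\<lambda>v. ?h v / ennreal 1)
      \<le> (\<integral>\<^sup>+x. ennreal (\<Sum>n\<in>T. (2 powi n / \<delta>) * indicator {0<..(1::real) / 2 powi (n + int m)} x) \<partial>lebesgue)"
      unfolding modular_def
    proof (rule nn_integral_mono)
      fix x :: real
      show "phi_ext G2 (?h (phi_inv G2 (1 / x)) / ennreal 1) * indicator {0<..} x
        \<le> ennreal (\<Sum>n\<in>T. (2 powi n / \<delta>) * indicator {0<..1 / 2 powi (n + int m)} x)"
      proof (cases "x > 0")
        case True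
        define v where "v = phi_inv G2 (1 / x)"
        have v: "0 < v" unfolding v_def using True by (intro phi_inv_pos[OF G2]) simp
        have f0: "0 \<le> f (1 / F v)" using step(4)[of "1 / F v"] y0 by auto
        have "G2 (f (1 / F v)) \<le> (\<Sum>n\<in>T. (2 powi n / \<delta>) * indicator {0<..1 / 2 powi (n + int m)} x)"
          using step(4)[of "1 / F v"]
        proof
          assume "f (1 / F v) = 0"
          then show ?thesis using \<delta> by (simp add: phi_zero[OF G2] sum_nonneg)
        next
          assume "\<exists>n\<in>T. 1 / F v \<le> s n \<and> f (1 / F v) = y n"
          then obtain n where n: "n \<in> T" "u n \<le> v" "f (1 / F v) = y n" using s_iff[OF v] by auto
          have "2 powi (n + int m) \<le> 1 / x"
            using n(2) True unfolding u_def v_def by (simp add: phi_inv_le_iff[OF G2])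
          then have x: "x \<le> 1 / 2 powi (n + int m)" using True by (simp add: field_simps)
          have "G2 (f (1 / F v)) = (2 powi n / \<delta>) * indicator {0<..1 / 2 powi (n + int m)} x"
            unfolding n(3) y_def using \<delta> x True by (simp add: phi_phi_inv[OF G2])
          also have "\<dots> \<le> (\<Sum>n\<in>T. (2 powi n / \<delta>) * indicator {0<..1 / 2 powi (n + int m)} x)"
            using \<delta> by (intro member_le_sum n(1) T(1)) auto
          finally show ?thesis .
        qed
        then show ?thesis
          using True h[OF v] f0
          by (simp add: v_def[symmetric] phi_ext_ennreal ennreal_leI divide_ennreal del: ennreal_1)
      qed simp
    qed
    also have "\<dots> = ennreal (\<Sum>n\<in>T. (2 powi n / \<delta>) * (1 / 2 powi (n + int m) - 0))"
      using \<delta> by (intro nn_integral_step) auto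
    also have "(\<Sum>n\<in>T. (2 powi n / \<delta>) * (1 / 2 powi (n + int m) - 0)) = (\<Sum>n\<in>T. 1 / (\<delta> * 2 ^ m))"
      by (intro sum.cong refl) (simp add: power_int_add)
    also have "\<dots> \<le> 1" using T(2) \<delta> by (simp add: field_simps)
    finally show ?thesis by (simp add: ennreal_leI)
  qed
  then have "orlicz_lorentz (lebesgue_on {0..}) F G2 ?f \<le> ennreal 1"
    unfolding orlicz_lorentz_eq_modular[OF F G2] by (intro Inf_lower CollectI exI[of _ 1]) auto
  then have "ennreal c * orlicz_lorentz (lebesgue_on {0..}) F G2 ?f \<le> ennreal c * ennreal 1"
    by (intro mult_left_mono) auto
  then have "orlicz_lorentz (lebesgue_on {0..}) F G1 ?f \<le> ennreal c"
    using bd[OF step(1)] by simp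
  \<comment> \<open>The infimum need not be attained; a strictly larger constant is certainly
    admissible.\<close>
  also have "\<dots> < ennreal (c + 1)" using c by (simp add: ennreal_less_iff)
  finally obtain c' where c': "c' > 0" "ennreal c' < ennreal (c + 1)" "modular G1 (\<lambda>v. ?h v / ennreal c') \<le> 1"
    unfolding orlicz_lorentz_eq_modular[OF F G1] Inf_less_iff by auto
  have "modular G1 (\<lambda>v. ?h v / ennreal (c + 1)) \<le> modular G1 (\<lambda>v. ?h v / ennreal c')"
  proof (rule modular_mono[OF G1])
    have "c' < c + 1" using c'(1,2) by (simp add: ennreal_less_iff)
    then have "ennreal (inverse (c + 1)) \<le> ennreal (inverse c')"
      using c' by (intro ennreal_leI le_imp_inverse_le) auto
    moreover have "0 < c + 1" using c by simp
    ultimately show "?h v / ennreal (c + 1) \<le> ?h v / ennreal c'" for v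
      unfolding divide_ennreal_def inverse_ennreal[OF c'(1)] inverse_ennreal[OF \<open>0 < c + 1\<close>]
      by (intro mult_left_mono) simp_all
  qed
  then have mod1: "modular G1 (\<lambda>v. ?h v / ennreal (c + 1)) \<le> 1" using c'(3) by (rule order_trans)
  have Kp: "K (2 powi n) > 0" for n :: int by (rule phi_pos[OF K]) simp
  have "ennreal (\<Sum>n\<in>T. K (2 powi n) / (2 * C) * (1 / K (2 powi (n + int m)) - 0))
    \<le> modular G1 (\<lambda>v. ?h v / ennreal (c + 1))"
    unfolding modular_def
  proof (rule step_le_nn_integral)
    fix x :: real assume x: "x > 0"
    define v where "v = phi_inv G1 (1 / x)"
    have v: "0 < v" unfolding v_def using x by (intro phi_inv_pos[OF G1]) simp
    define T' where "T' = {n \<in> T. x \<le> 1 / K (2 powi (n + int m))}"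
    have T': "finite T'" using T by (simp add: T'_def)
    have f0: "0 \<le> f (1 / F v)" using step(4)[of "1 / F v"] y0 by auto
    have "(\<Sum>n\<in>T. K (2 powi n) / (2 * C) * indicator {0<..1 / K (2 powi (n + int m))} x)
      = (\<Sum>n\<in>T. if n \<in> T' then K (2 powi n) / (2 * C) else 0)"
      using x by (intro sum.cong refl) (auto simp: T'_def indicator_def)
    also have "\<dots> = (\<Sum>n\<in>T'. K (2 powi n) / (2 * C))"
      by (simp add: T'_def sum.inter_filter[OF T(1)])
    also have "\<dots> = (\<Sum>n\<in>T'. K (2 powi n)) / (2 * C)" by (rule sum_divide_distrib[symmetric])
    also have "\<dots> \<le> G1 (f (1 / F v) / (c + 1))"
    proof (cases "T' = {}")
      case True
      then show ?thesis using f0 c by (simp add: phi_nonneg[OF G1])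
    next
      case False
      define n where "n = Max T'"
      have n: "n \<in> T" "x \<le> 1 / K (2 powi (n + int m))"
        using Max_in[OF T' False] by (auto simp: n_def T'_def)
      \<comment> \<open>The test function is a maximum of steps, while a sum over all active steps
        is wanted. The doubling makes the highest active step comparable with this sum.\<close>
      have "(\<Sum>n\<in>T'. K (2 powi n)) \<le> 2 * K (2 powi n)"
        unfolding n_def using Kp dbl by (intro sum_doubling_le[OF T' False]) (auto simp: T'_def less_imp_le)
      also have "\<dots> \<le> 2 * (C * G1 (y n / (c + 1)))" using KC[of n] by (simp add: y_def)
      finally have "(\<Sum>n\<in>T'. K (2 powi n)) / (2 * C) \<le> G1 (y n / (c + 1))" using C by (simp add: field_simps)
      also have "\<dots> \<le> G1 (f (1 / F v) / (c + 1))"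
      proof (rule phi_mono[OF G1])
        have "G1 (u n) \<le> 1 / x" using n(2) x Kp[of "n + int m"] by (simp add: K_def u_def field_simps)
        then have "u n \<le> v" unfolding v_def using up[of n] x by (simp add: le_phi_inv_iff[OF G1])
        then show "y n / (c + 1) \<le> f (1 / F v) / (c + 1)"
          using s_iff[OF v] step(3)[OF n(1)] c by (intro divide_right_mono) auto
      qed (use y0 c in simp)
      finally show ?thesis .
    qed
    finally show "ennreal (\<Sum>n\<in>T. K (2 powi n) / (2 * C) * indicator {0<..1 / K (2 powi (n + int m))} x)
      \<le> phi_ext G1 (?h (phi_inv G1 (1 / x)) / ennreal (c + 1))"
      using h[OF v] f0 c
      by (simp add: v_def[symmetric] divide_ennreal phi_ext_ennreal ennreal_leI del: ennreal_plus ennreal_1)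
  qed (use Kp C in \<open>auto simp: less_imp_le\<close>)
  then have "ennreal (\<Sum>n\<in>T. K (2 powi n) / (2 * C) * (1 / K (2 powi (n + int m)) - 0)) \<le> 1"
    using mod1 by (rule order_trans)
  then have "(\<Sum>n\<in>T. K (2 powi n) / (2 * C) * (1 / K (2 powi (n + int m)) - 0)) \<le> 1"
    by (simp only: ennreal_le_1)
  also have "(\<Sum>n\<in>T. K (2 powi n) / (2 * C) * (1 / K (2 powi (n + int m)) - 0))
    = (\<Sum>n\<in>T. K (2 powi n) / K (2 powi (n + int m))) / (2 * C)"
    unfolding sum_divide_distrib by (intro sum.cong refl) simp
  finally show False using big C by (simp add: field_simps)
qed

subsection \<open>Comparison of growth along grids\<close>

text \<open>A common form of (ii) and (iv), which count the same failures along two grids: a^n for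
  (iv), and for (ii) the inverse images of a^n under G2, where the quotient of G2 is exactly a^m. A
  free constant C replaces a^N so that it can change with the grid.\<close>

definition grid_more_convex :: "(real \<Rightarrow> real) \<Rightarrow> (real \<Rightarrow> real) \<Rightarrow> (int \<Rightarrow> real) \<Rightarrow> bool" where
  "grid_more_convex G1 G2 x \<longleftrightarrow> (\<exists>C\<ge>1. \<exists>b>1. \<forall>m\<ge>1.
     let E = {n::int. \<not> G2 (x (n + int m)) / G2 (x n) \<le> C * (G1 (x (n + int m)) / G1 (x n))}
     in finite E \<and> real (card E) < b ^ m)"

lemma finite_card_less_subset:
  assumes "A \<subseteq> B" "finite B \<and> real (card B) < r" shows "finite A \<and> real (card A) < r"
  using assms card_mono[of B A] finite_subset[of A B] by (auto intro: order.strict_trans1)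

lemma almost_more_convex_iff_grid:
  assumes G1: "phi_function G1"
  shows "almost_more_convex G1 G2 \<longleftrightarrow> (\<exists>a>1. grid_more_convex G1 G2 (\<lambda>n. a powi n))"
proof
  assume "almost_more_convex G1 G2"
  then obtain a b N where "a > 1" "b > 1" and fin: "\<forall>m\<ge>1.
    let E = {n. \<not> G2 (a powi (n + int m)) / G2 (a powi n) \<le> a ^ N * (G1 (a powi (n + int m)) / G1 (a powi n))}
    in finite E \<and> real (card E) < b ^ m"
    unfolding almost_more_convex_def almost_less_convex_def by blast
  then have "grid_more_convex G1 G2 (\<lambda>n. a powi n)"
    unfolding grid_more_convex_def by (intro exI[of _ "a ^ N"] conjI exI[of _ b]) auto
  then show "\<exists>a>1. grid_more_convex G1 G2 (\<lambda>n. a powi n)" using \<open>a > 1\<close> by blast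
next
  assume "\<exists>a>1. grid_more_convex G1 G2 (\<lambda>n. a powi n)"
  then obtain a C b where a: "a > 1" and "C \<ge> 1" "b > 1" and fin: "\<And>m. m \<ge> 1 \<Longrightarrow>
    finite {n. \<not> G2 (a powi (n + int m)) / G2 (a powi n) \<le> C * (G1 (a powi (n + int m)) / G1 (a powi n))} \<and>
    real (card {n. \<not> G2 (a powi (n + int m)) / G2 (a powi n) \<le> C * (G1 (a powi (n + int m)) / G1 (a powi n))}) < b ^ m"
    unfolding grid_more_convex_def Let_def by blast
  obtain N where N: "C < a ^ N" using real_arch_pow[OF a] by blast
  have N1: "N \<ge> 1" using N \<open>C \<ge> 1\<close> by (cases N) auto
  have "{n. \<not> G2 (a powi (n + int m)) / G2 (a powi n) \<le> a ^ N * (G1 (a powi (n + int m)) / G1 (a powi n))}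
    \<subseteq> {n. \<not> G2 (a powi (n + int m)) / G2 (a powi n) \<le> C * (G1 (a powi (n + int m)) / G1 (a powi n))}" for m
  proof (intro Collect_mono, intro impI, erule contrapos_nn)
    fix n assume "G2 (a powi (n + int m)) / G2 (a powi n) \<le> C * (G1 (a powi (n + int m)) / G1 (a powi n))"
    also have "\<dots> \<le> a ^ N * (G1 (a powi (n + int m)) / G1 (a powi n))"
      using N a phi_nonneg[OF G1] by (intro mult_right_mono) auto
    finally show "G2 (a powi (n + int m)) / G2 (a powi n) \<le> a ^ N * (G1 (a powi (n + int m)) / G1 (a powi n))" .
  qed
  from finite_card_less_subset[OF this fin] show "almost_more_convex G1 G2"
    unfolding almost_more_convex_def almost_less_convex_def Let_def
    using a \<open>b > 1\<close> N1 by (intro exI[of _ a] conjI exI[of _ b] exI[of _ N]) auto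
qed

lemma comp_phi_inv_growth_iff:
  assumes G1: "phi_function G1" and G2: "phi_function G2" and a: "a > 1"
  shows "a powi (int m - int N) * (G1 \<circ> phi_inv G2) (a powi n) \<le> (G1 \<circ> phi_inv G2) (a powi (n + int m)) \<longleftrightarrow>
    G2 (phi_inv G2 (a powi (n + int m))) / G2 (phi_inv G2 (a powi n))
      \<le> a ^ N * (G1 (phi_inv G2 (a powi (n + int m))) / G1 (phi_inv G2 (a powi n)))"
proof -
  have *: "p / r * g \<le> h \<longleftrightarrow> p \<le> r * (h / g)" if "0 < r" "0 < g" for p r g h :: real
    using that by (simp add: field_simps)
  have "G2 (phi_inv G2 (a powi (n + int m))) / G2 (phi_inv G2 (a powi n)) = a ^ m"
    using a by (simp add: phi_phi_inv[OF G2] power_int_add)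
  moreover have "a powi (int m - int N) = a ^ m / a ^ N" using a by (simp add: power_int_diff)
  moreover have "0 < G1 (phi_inv G2 (a powi n))" "0 < a ^ N"
    using a by (auto intro!: phi_pos[OF G1] phi_inv_pos[OF G2])
  ultimately show ?thesis using * by simp
qed

lemma almost_convex_comp_iff_grid:
  assumes G1: "phi_function G1" and G2: "phi_function G2"
  shows "almost_convex (G1 \<circ> phi_inv G2) \<longleftrightarrow> (\<exists>a>1. grid_more_convex G1 G2 (\<lambda>n. phi_inv G2 (a powi n)))"
proof
  assume "almost_convex (G1 \<circ> phi_inv G2)"
  then obtain a b N where a: "a > 1" and "b > 1" and fin: "\<And>m. m \<ge> 1 \<Longrightarrow>
    finite {n. \<not> (G1 \<circ> phi_inv G2) (a powi (n + int m)) \<ge> a powi (int m - int N) * (G1 \<circ> phi_inv G2) (a powi n)} \<and>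
    real (card {n. \<not> (G1 \<circ> phi_inv G2) (a powi (n + int m)) \<ge> a powi (int m - int N) * (G1 \<circ> phi_inv G2) (a powi n)}) < b ^ m"
    unfolding almost_convex_def Let_def by blast
  note comp_phi_inv_growth_iff[OF G1 G2 a]
  then have "grid_more_convex G1 G2 (\<lambda>n. phi_inv G2 (a powi n))"
    unfolding grid_more_convex_def Let_def using fin \<open>b > 1\<close> a
    by (intro exI[of _ "a ^ N"] conjI exI[of _ b]) auto
  then show "\<exists>a>1. grid_more_convex G1 G2 (\<lambda>n. phi_inv G2 (a powi n))" using a by blast
next
  assume "\<exists>a>1. grid_more_convex G1 G2 (\<lambda>n. phi_inv G2 (a powi n))"
  then obtain a C b where a: "a > 1" and "C \<ge> 1" "b > 1" and fin: "\<And>m. m \<ge> 1 \<Longrightarrow>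
    finite {n. \<not> G2 (phi_inv G2 (a powi (n + int m))) / G2 (phi_inv G2 (a powi n)) \<le> C * (G1 (phi_inv G2 (a powi (n + int m))) / G1 (phi_inv G2 (a powi n)))} \<and>
    real (card {n. \<not> G2 (phi_inv G2 (a powi (n + int m))) / G2 (phi_inv G2 (a powi n)) \<le> C * (G1 (phi_inv G2 (a powi (n + int m))) / G1 (phi_inv G2 (a powi n)))}) < b ^ m"
    unfolding grid_more_convex_def Let_def by blast
  obtain N where N: "C < a ^ N" using real_arch_pow[OF a] by blast
  have N1: "N \<ge> 1" using N \<open>C \<ge> 1\<close> by (cases N) auto
  have "{n. \<not> (G1 \<circ> phi_inv G2) (a powi (n + int m)) \<ge> a powi (int m - int N) * (G1 \<circ> phi_inv G2) (a powi n)}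
    \<subseteq> {n. \<not> G2 (phi_inv G2 (a powi (n + int m))) / G2 (phi_inv G2 (a powi n)) \<le> C * (G1 (phi_inv G2 (a powi (n + int m))) / G1 (phi_inv G2 (a powi n)))}" for m
  proof (intro Collect_mono, intro impI, erule contrapos_nn)
    fix n
    have p: "0 < G1 (phi_inv G2 (a powi n))" for n
      using a by (intro phi_pos[OF G1] phi_inv_pos[OF G2]) simp
    assume "G2 (phi_inv G2 (a powi (n + int m))) / G2 (phi_inv G2 (a powi n)) \<le> C * (G1 (phi_inv G2 (a powi (n + int m))) / G1 (phi_inv G2 (a powi n)))"
    also have "\<dots> \<le> a ^ N * (G1 (phi_inv G2 (a powi (n + int m))) / G1 (phi_inv G2 (a powi n)))"
      using N p by (intro mult_right_mono) (auto simp: less_imp_le)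
    finally show "a powi (int m - int N) * (G1 \<circ> phi_inv G2) (a powi n) \<le> (G1 \<circ> phi_inv G2) (a powi (n + int m))"
      unfolding comp_phi_inv_growth_iff[OF G1 G2 a] .
  qed
  from finite_card_less_subset[OF this fin] show "almost_convex (G1 \<circ> phi_inv G2)"
    unfolding almost_convex_def Let_def
    using a \<open>b > 1\<close> N1 by (intro exI[of _ a] conjI exI[of _ b] exI[of _ N]) auto
qed

text \<open>Let k n be the cell of the grid x that contains y n. By \<open>lower\<close>, k is
  strictly increasing; by \<open>upper\<close>, its increments are at most q. A failure for y at (n,
  m) forces one for x at (k n + 1, m') with 1 \<le> m' \<le> q m, and distinct n give distinct k n +
  1.\<close>

lemma grid_more_convex_change:
  fixes x y :: "int \<Rightarrow> real" and q :: nat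
  assumes G1: "phi_function G1" and G2: "phi_function G2"
    and x: "\<And>j. 0 < x j" "\<And>i j. i \<le> j \<Longrightarrow> x i \<le> x j" and y: "\<And>n. 0 < y n"
    and cover: "\<And>v. 0 < v \<Longrightarrow> \<exists>j. x j \<le> v \<and> v < x (j + 1)"
    and A: "\<And>j. G2 (x (j + 1)) \<le> A * G2 (x j)"
    and lower: "\<And>j n. x j \<le> y n \<Longrightarrow> x (j + 1) \<le> y (n + 1)"
    and upper: "\<And>j n. y n < x j \<Longrightarrow> y (n + 1) < x (j + int q)"
    and gx: "grid_more_convex G1 G2 x"
  shows "grid_more_convex G1 G2 y"
proof -
  obtain C b where C: "C \<ge> 1" and b: "b > 1" and fin: "\<And>m. m \<ge> 1 \<Longrightarrow>
    finite {n. \<not> G2 (x (n + int m)) / G2 (x n) \<le> C * (G1 (x (n + int m)) / G1 (x n))} \<and>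
    real (card {n. \<not> G2 (x (n + int m)) / G2 (x n) \<le> C * (G1 (x (n + int m)) / G1 (x n))}) < b ^ m"
    using gx unfolding grid_more_convex_def Let_def by blast
  define E where "E m = {n. \<not> G2 (x (n + int m)) / G2 (x n) \<le> C * (G1 (x (n + int m)) / G1 (x n))}" for m :: nat
  have fin: "finite (E m)" "real (card (E m)) < b ^ m" if "m \<ge> 1" for m
    using fin[OF that] by (simp_all add: E_def)
  define E' where "E' m = {n. \<not> G2 (y (n + int m)) / G2 (y n) \<le> C * A\<^sup>2 * (G1 (y (n + int m)) / G1 (y n))}" for m :: nat
  have G2x: "0 < G2 (x j)" and G1x: "0 < G1 (x j)" and G2y: "0 < G2 (y j)" and G1y: "0 < G1 (y j)" for j
    using phi_pos[OF G1] phi_pos[OF G2] x y by auto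
  have A1: "A \<ge> 1"
  proof -
    have "G2 (x 0) \<le> G2 (x (0 + 1))" using x(1)[of 0] by (intro phi_mono[OF G2] x) auto
    then show ?thesis using A[of 0] G2x[of 0] by (metis linorder_not_le mult.commute mult_less_cancel_left2 order_trans not_less)
  qed
  obtain k where k: "\<And>n. x (k n) \<le> y n" "\<And>n. y n < x (k n + 1)" using cover[OF y] by metis
  have xless: "i < j" if "x i < x j" for i j using x(2)[of j i] that by force
  have k1: "k n + int m \<le> k (n + int m)" for n m
  proof (induction m)
    case (Suc m)
    have "x (k (n + int m) + 1) \<le> y (n + int m + 1)" by (intro lower k)
    also have "\<dots> < x (k (n + int m + 1) + 1)" by (rule k)
    finally show ?case using xless Suc by (force simp: ac_simps)
  qed simp
  have k2: "k (n + int m) \<le> k n + int (q * m)" for n m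
  proof -
    have "y (n + int m) < x (k n + 1 + int (q * m))"
    proof (induction m)
      case (Suc m)
      show ?case using upper[OF Suc] by (simp add: ac_simps)
    qed (use k in simp)
    with k(1) have "x (k (n + int m)) < x (k n + 1 + int (q * m))" by (rule order.strict_trans1)
    then show ?thesis using xless by force
  qed
  have "inj k"
  proof (rule linorder_injI)
    fix i j :: int assume "i < j"
    then show "k i \<noteq> k j" using k1[of i "nat (j - i)"] by auto
  qed
  have main: "\<exists>m'\<in>{1..q * m}. k n + 1 \<in> E m'" if m: "m \<ge> 1" and n: "n \<in> E' m" for n m
  proof (rule ccontr)
    assume neg: "\<not> ?thesis"
    \<comment> \<open>The points of x from k n + 1 to k (n + m) lie between y n and y (n + m), up to
      equality, so passing to y can only increase the quotient of G1. The quotient of G2 changes by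
      at most one cell, a factor A, at each end.\<close>
    define m' where "m' = nat (k (n + int m) - k n - 1)"
    have m': "k (n + int m) = k n + 1 + int m'" using k1[of n m] m by (simp add: m'_def)
    have m'q: "m' \<le> q * m" using k2[of n m] unfolding m' by linarith
    have le: "G2 (y (n + int m)) \<le> A * G2 (x (k n + 1 + int m'))"
    proof -
      have "G2 (y (n + int m)) \<le> G2 (x (k (n + int m) + 1))"
        using k(2)[of "n + int m"] y[of "n + int m"] by (intro phi_mono[OF G2]) auto
      also have "\<dots> \<le> A * G2 (x (k (n + int m)))" by (rule A)
      finally show ?thesis by (simp only: m')
    qed
    have ge: "G2 (x (k n + 1)) \<le> A * G2 (y n)"
    proof -
      have "G2 (x (k n + 1)) \<le> A * G2 (x (k n))" by (rule A)
      also have "\<dots> \<le> A * G2 (y n)" using A1 k(1)[of n] x(1)[of "k n"] by (intro mult_left_mono phi_mono[OF G2]) auto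
      finally show ?thesis .
    qed
    have g1: "G1 (x (k n + 1 + int m')) \<le> G1 (y (n + int m))" "G1 (y n) \<le> G1 (x (k n + 1))"
      using k(1)[of "n + int m"] k(2)[of n] x(1)[of "k (n + int m)"] y[of n]
      by (auto simp: m' intro!: phi_mono[OF G1])
    have "G2 (x (k n + 1 + int m')) / G2 (x (k n + 1)) \<le> C * (G1 (x (k n + 1 + int m')) / G1 (x (k n + 1)))"
    proof (cases "m' = 0")
      case True
      then show ?thesis using C G1x[of "k n + 1"] G2x[of "k n + 1"] by simp
    next
      case False
      then have "m' \<in> {1..q * m}" using m'q by simp
      then have "k n + 1 \<notin> E m'" using neg by blast
      then show ?thesis by (simp add: E_def)
    qed
    also have "\<dots> \<le> C * (G1 (y (n + int m)) / G1 (y n))"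
      using C g1 G1y[of n] G1y[of "n + int m"] by (intro mult_left_mono frac_le) auto
    finally have *: "G2 (x (k n + 1 + int m')) / G2 (x (k n + 1)) \<le> C * (G1 (y (n + int m)) / G1 (y n))" .
    have "G2 (y (n + int m)) / G2 (y n) \<le> (A * G2 (x (k n + 1 + int m'))) / (G2 (x (k n + 1)) / A)"
      using le ge A1 G2x[of "k n + 1"] G2x[of "k n + 1 + int m'"] G2y[of n] by (intro frac_le) (auto simp: field_simps)
    also have "\<dots> = A\<^sup>2 * (G2 (x (k n + 1 + int m')) / G2 (x (k n + 1)))" by (simp add: power2_eq_square)
    also have "\<dots> \<le> A\<^sup>2 * (C * (G1 (y (n + int m)) / G1 (y n)))" using * by (intro mult_left_mono) auto
    finally show False using n by (simp add: E'_def ac_simps)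
  qed
  \<comment> \<open>There are at most q m lengths m', each with fewer than b^(q m) failures; the
    factor q m is absorbed into the base by q m < (2 (q + 1))^m.\<close>
  have "finite (E' m) \<and> real (card (E' m)) < (2 * (real q + 1) * b ^ q) ^ m" if m: "m \<ge> 1" for m
  proof -
    have sub: "(\<lambda>n. k n + 1) ` E' m \<subseteq> (\<Union>m'\<in>{1..q * m}. E m')" using main[OF m] by blast
    have finU: "finite (\<Union>m'\<in>{1..q * m}. E m')" using fin by auto
    have inj: "inj_on (\<lambda>n. k n + 1) (E' m)" using \<open>inj k\<close> by (auto simp: inj_on_def)
    have "finite (E' m)" using finite_subset[OF sub finU] inj by (rule finite_imageD)
    have "card (E' m) = card ((\<lambda>n. k n + 1) ` E' m)" using inj by (simp add: card_image)
    also have "\<dots> \<le> card (\<Union>m'\<in>{1..q * m}. E m')" using sub finU by (intro card_mono)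
    also have "\<dots> \<le> (\<Sum>m'\<in>{1..q * m}. card (E m'))" by (intro card_UN_le) simp
    finally have "real (card (E' m)) \<le> (\<Sum>m'\<in>{1..q * m}. real (card (E m')))"
      by (simp only: of_nat_sum[symmetric] of_nat_le_iff)
    also have "\<dots> \<le> of_nat (card {1..q * m}) * b ^ (q * m)"
    proof (rule sum_bounded_above)
      fix m' assume m': "m' \<in> {1..q * m}"
      then have "real (card (E m')) \<le> b ^ m'" using fin[of m'] by simp
      also have "\<dots> \<le> b ^ (q * m)" using b m' by (intro power_increasing) auto
      finally show "real (card (E m')) \<le> b ^ (q * m)" .
    qed
    also have "\<dots> = real q * real m * b ^ (q * m)" by simp
    also have "\<dots> < (real q + 1) ^ m * 2 ^ m * b ^ (q * m)"
    proof (rule mult_strict_right_mono)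
      have "real q < (real q + 1) ^ m" using self_le_power[of "real q + 1" m] m by simp
      moreover have "real m < 2 ^ m" by (rule of_nat_less_two_power)
      ultimately show "real q * real m < (real q + 1) ^ m * 2 ^ m"
        by (intro mult_strict_mono') auto
    qed (use b in simp)
    also have "\<dots> = (2 * (real q + 1) * b ^ q) ^ m"
      unfolding power_mult_distrib power_mult by (simp only: mult.commute)
    finally show ?thesis using \<open>finite (E' m)\<close> by simp
  qed
  moreover have "2 * (real q + 1) * b ^ q > 1"
  proof -
    have "1 * 1 < (2 * (real q + 1)) * b ^ q" using b by (intro mult_less_le_imp_less) auto
    then show ?thesis by simp
  qed
  moreover have "C * A\<^sup>2 \<ge> 1" using C A1 mult_mono[of 1 C 1 "A\<^sup>2"] by simp
  ultimately show ?thesis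
    unfolding grid_more_convex_def Let_def E'_def by blast
qed

text \<open>Passing from t to \<alpha> t multiplies G2 by a factor that dilatoriness bounds below
  and Delta_2 bounds above. With a suitable ratio, each step of the new grid therefore crosses at
  least one and boundedly many cells of the old one. The two conditions exchange their tasks between
  the two directions.\<close>

lemma almost_convex_iff_almost_more_convex:
  assumes G1: "phi_function G1" and G2: "phi_function G2" and dil: "dilatory G2" and D: "Delta2 G2"
  shows "almost_convex (G1 \<circ> phi_inv G2) \<longleftrightarrow> almost_more_convex G1 G2"
  unfolding almost_more_convex_iff_grid[OF G1] almost_convex_comp_iff_grid[OF G1 G2]
proof
  assume "\<exists>a>1. grid_more_convex G1 G2 (\<lambda>n. phi_inv G2 (a powi n))"
  then obtain a where a: "a > 1" and g: "grid_more_convex G1 G2 (\<lambda>n. phi_inv G2 (a powi n))" by blast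
  obtain \<alpha>0 where \<alpha>0: "\<alpha>0 \<ge> 1" "\<And>t. t \<ge> 0 \<Longrightarrow> G2 (\<alpha>0 * t) \<ge> a * G2 t"
    using dilatory_iterate[OF G2 dil] by blast
  define \<alpha> where "\<alpha> = \<alpha>0 + 1"
  have \<alpha>: "\<alpha> > 1" using \<alpha>0 by (simp add: \<alpha>_def)
  have G\<alpha>: "G2 (\<alpha> * t) \<ge> a * G2 t" if "t \<ge> 0" for t
  proof -
    have "G2 (\<alpha>0 * t) \<le> G2 (\<alpha> * t)" using that \<alpha>0(1) by (intro phi_mono[OF G2]) (auto simp: \<alpha>_def algebra_simps)
    then show ?thesis using \<alpha>0(2)[OF that] by simp
  qed
  obtain A where A: "A \<ge> 1" "\<And>t. t \<ge> 0 \<Longrightarrow> G2 (\<alpha> * t) \<le> A * G2 t"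
    using Delta2_iterate[OF G2 D, of \<alpha>] \<alpha> by auto
  obtain q where q: "A < a ^ q" using real_arch_pow[OF a] by blast
  have "grid_more_convex G1 G2 (\<lambda>n. \<alpha> powi n)"
  proof (rule grid_more_convex_change[OF G1 G2 _ _ _ _ _ _ _ g, where A = a and q = q])
    show "0 < phi_inv G2 (a powi j)" for j using a by (intro phi_inv_pos[OF G2]) simp
    show "phi_inv G2 (a powi i) \<le> phi_inv G2 (a powi j)" if "i \<le> j" for i j
      using a that by (subst phi_inv_le_iff[OF G2]) (auto intro: power_int_increasing)
    show "0 < \<alpha> powi n" for n using \<alpha> by simp
    show "\<exists>j. phi_inv G2 (a powi j) \<le> v \<and> v < phi_inv G2 (a powi (j + 1))" if v: "0 < v" for v
    proof -
      obtain j where j: "a powi j \<le> G2 v" "G2 v < a powi (j + 1)" using powi_cover[OF a phi_pos[OF G2 v]] by blast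
      have "v < phi_inv G2 (a powi (j + 1))"
        using j a v phi_inv_less_iff[OF G2, of "G2 v" "a powi (j + 1)"] phi_inv_phi[OF G2, of v] phi_nonneg[OF G2, of v]
        by simp
      then show ?thesis using j a v by (intro exI[of _ j]) (simp add: phi_inv_le_iff'[OF G2])
    qed
    show "G2 (phi_inv G2 (a powi (j + 1))) \<le> a * G2 (phi_inv G2 (a powi j))" for j
      using a by (simp add: phi_phi_inv[OF G2] power_int_add)
    show "phi_inv G2 (a powi (j + 1)) \<le> \<alpha> powi (n + 1)" if "phi_inv G2 (a powi j) \<le> \<alpha> powi n" for j n
    proof -
      have "a powi j \<le> G2 (\<alpha> powi n)" using that a \<alpha> by (simp add: phi_inv_le_iff'[OF G2])
      then have "a * a powi j \<le> a * G2 (\<alpha> powi n)" using a by simp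
      also have "\<dots> \<le> G2 (\<alpha> * \<alpha> powi n)" using \<alpha> by (intro G\<alpha>) simp
      finally show ?thesis using a \<alpha> by (simp add: phi_inv_le_iff'[OF G2] power_int_add mult.commute)
    qed
    show "\<alpha> powi (n + 1) < phi_inv G2 (a powi (j + int q))" if "\<alpha> powi n < phi_inv G2 (a powi j)" for j n
    proof -
      have lt: "t < phi_inv G2 s \<longleftrightarrow> G2 t < s" if "0 \<le> t" "0 \<le> s" for t s
        using that phi_inv_le_iff'[OF G2, of t s] by (auto simp: not_le[symmetric])
      have Gl: "G2 (\<alpha> powi n) < a powi j" using that a \<alpha> by (simp add: lt)
      have "G2 (\<alpha> * \<alpha> powi n) \<le> A * G2 (\<alpha> powi n)" using \<alpha> by (intro A) simp
      also have "\<dots> \<le> a ^ q * G2 (\<alpha> powi n)" using q \<alpha> by (intro mult_right_mono phi_nonneg[OF G2]) auto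
      also have "\<dots> < a ^ q * a powi j" using Gl a by simp
      finally show ?thesis using a \<alpha> by (simp add: lt power_int_add mult.commute)
    qed
  qed
  then show "\<exists>a>1. grid_more_convex G1 G2 (\<lambda>n. a powi n)" using \<alpha> by blast
next
  assume "\<exists>a>1. grid_more_convex G1 G2 (\<lambda>n. a powi n)"
  then obtain \<alpha> where \<alpha>: "\<alpha> > 1" and g: "grid_more_convex G1 G2 (\<lambda>n. \<alpha> powi n)" by blast
  obtain a0 where a0: "a0 \<ge> 1" "\<And>t. t \<ge> 0 \<Longrightarrow> G2 (\<alpha> * t) \<le> a0 * G2 t"
    using Delta2_iterate[OF G2 D, of \<alpha>] \<alpha> by auto
  define a where "a = a0 + 1"
  have a: "a > 1" using a0 by (simp add: a_def)
  have Ga: "G2 (\<alpha> * t) \<le> a * G2 t" if "t \<ge> 0" for t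
    using a0(2)[OF that] phi_nonneg[OF G2 that] by (simp add: a_def distrib_right)
  obtain C where C: "C \<ge> 1" "\<And>t. t \<ge> 0 \<Longrightarrow> G2 (C * t) \<ge> a * G2 t"
    using dilatory_iterate[OF G2 dil] by blast
  obtain q where q: "C < \<alpha> ^ q" using real_arch_pow[OF \<alpha>] by blast
  have y: "0 < phi_inv G2 (a powi n)" for n using a by (intro phi_inv_pos[OF G2]) simp
  have "grid_more_convex G1 G2 (\<lambda>n. phi_inv G2 (a powi n))"
  proof (rule grid_more_convex_change[OF G1 G2 _ _ _ _ _ _ _ g, where A = a and q = q])
    show "0 < \<alpha> powi j" for j using \<alpha> by simp
    show "\<alpha> powi i \<le> \<alpha> powi j" if "i \<le> j" for i j using \<alpha> that by (auto intro: power_int_increasing)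
    show "0 < phi_inv G2 (a powi n)" for n by (rule y)
    show "\<exists>j. \<alpha> powi j \<le> v \<and> v < \<alpha> powi (j + 1)" if v: "0 < v" for v by (rule powi_cover[OF \<alpha> v])
    show "G2 (\<alpha> powi (j + 1)) \<le> a * G2 (\<alpha> powi j)" for j
      using Ga[of "\<alpha> powi j"] \<alpha> by (simp add: power_int_add mult.commute)
    show "\<alpha> powi (j + 1) \<le> phi_inv G2 (a powi (n + 1))" if "\<alpha> powi j \<le> phi_inv G2 (a powi n)" for j n
    proof -
      have "G2 (\<alpha> * \<alpha> powi j) \<le> a * G2 (\<alpha> powi j)" using \<alpha> by (intro Ga) simp
      also have "\<dots> \<le> a * a powi n" using that a \<alpha> by (simp add: le_phi_inv_iff[OF G2])
      finally show ?thesis using a \<alpha> by (simp add: le_phi_inv_iff[OF G2] power_int_add mult.commute)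
    qed
    show "phi_inv G2 (a powi (n + 1)) < \<alpha> powi (j + int q)" if "phi_inv G2 (a powi n) < \<alpha> powi j" for j n
    proof -
      have "a * a powi n \<le> G2 (C * phi_inv G2 (a powi n))"
        using C(2)[of "phi_inv G2 (a powi n)"] y[of n] a by (simp add: phi_phi_inv[OF G2])
      then have "phi_inv G2 (a powi (n + 1)) \<le> C * phi_inv G2 (a powi n)"
        using a C(1) y[of n] by (subst phi_inv_le_iff'[OF G2]) (auto simp: power_int_add mult.commute)
      also have "\<dots> \<le> \<alpha> ^ q * phi_inv G2 (a powi n)" using q y[of n] by (intro mult_right_mono) auto
      also have "\<dots> < \<alpha> ^ q * \<alpha> powi j" using that \<alpha> by simp
      finally show ?thesis using \<alpha> by (simp add: power_int_add mult.commute)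
    qed
  qed
  then show "\<exists>a>1. grid_more_convex G1 G2 (\<lambda>n. phi_inv G2 (a powi n))" using a by blast
qed

subsection \<open>Construction of the N-function\<close>

lemma sum_int_interval_Suc:
  fixes d :: "int \<Rightarrow> real"
  shows "sum d {n..<n + int (Suc m)} = sum d {n..<n + int m} + d (n + int m)"
proof -
  have "{n..<n + int (Suc m)} = insert (n + int m) {n..<n + int m}" by auto
  then show ?thesis by simp
qed

lemma primitive_exists:
  fixes d :: "int \<Rightarrow> real"
  obtains p :: "int \<Rightarrow> real" where "\<And>n m. p (n + int m) - p n = sum d {n..<n + int m}"
proof -
  define p where "p n = sum d {0..<n} - sum d {n..<0}" for n
  have step: "p (n + 1) - p n = d n" for n
  proof (cases "n \<ge> 0")
    case True
    then have "{0..<n + 1} = insert n {0..<n}" by auto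
    then show ?thesis using True by (simp add: p_def)
  next
    case False
    then have "{n..<0} = insert n {n + 1..<0}" by auto
    then show ?thesis using False by (simp add: p_def)
  qed
  have "p (n + int m) - p n = sum d {n..<n + int m}" for n m
  proof (induction m)
    case (Suc m)
    then show ?case unfolding sum_int_interval_Suc using step[of "n + int m"] by (simp add: ac_simps)
  qed simp
  then show thesis by (rule that)
qed

text \<open>
  \<open>\<kappa>\<close> decreases by more than \<open>N\<close> only on few intervals of a given length \<open>m\<close>. The function \<open>p\<close>
  compensates each of these decreases with the smallest possible slope, about \<open>N / m\<close>. Its
  increase over the window \<open>{n - R k..<n}\<close> exceeds \<open>R (N + 1)\<close> only if this window meets one of
  these intervals of length less than \<open>k\<close>; the exponential bound for the number of such \<open>n\<close> has
  a base \<open>D\<close> that does not depend on \<open>R\<close>. The intervals starting in \<open>{- 2 m..2 m}\<close> serve to make \<open>p\<close>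
  unbounded.
\<close>

lemma compensating_function:
  fixes \<kappa> :: "int \<Rightarrow> real" and N :: nat and b :: real
  assumes step: "\<And>n. \<kappa> n \<le> \<kappa> (n + 1) + 1" and b: "b > 1"
    and fin: "\<And>m. m \<ge> 1 \<Longrightarrow> finite {n. real N < \<kappa> n - \<kappa> (n + int m)}"
    and card: "\<And>m. m \<ge> 1 \<Longrightarrow> real (card {n. real N < \<kappa> n - \<kappa> (n + int m)}) \<le> b ^ m"
  obtains p :: "int \<Rightarrow> real" and C D M :: real where
    "\<And>n. p n < p (n + 1)" "\<And>n. p (n + 1) \<le> p n + 1 / 2"
    "\<And>n m. \<kappa> n - \<kappa> (n + int m) \<le> p (n + int m) - p n + C"
    "\<And>Z. \<exists>n. Z < p n" "\<And>Z. \<exists>n. p n < Z"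
    "D \<ge> 1" "M > 0"
    "\<And>R k. finite {n. real R * M < p n - p (n - int (R * k))}"
    "\<And>R k. real (card {n. real R * M < p n - p (n - int (R * k))}) \<le> real (R * k) * D ^ k"
    "\<And>R n. \<not> real R * M < p n - p (n - int R)"
proof -
  define E where "E m = {n. real N < \<kappa> n - \<kappa> (n + int m)}" for m
  define E' where "E' m = E m \<union> {- 2 * int m..2 * int m}" for m
  \<comment> \<open>Shorter intervals are ignored, which keeps the slope (N + 1) / l at most
    1/2.\<close>
  define L where "L = 2 * (N + 1)"
  define P where "P i m \<longleftrightarrow> L \<le> m \<and> (\<exists>n\<in>E' m. n \<le> i \<and> i < n + int m)" for i m
  \<comment> \<open>The shortest admissible interval through i. On an interval of length m from the
    enlarged family all these lengths are at most m, so p gains at least N + 1 across it.\<close>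
  define l where "l i = (LEAST m. P i m)" for i
  have "P i (L + nat \<bar>i\<bar>)" for i
    unfolding P_def by (intro conjI bexI[of _ i]) (auto simp: E'_def L_def)
  then have Pl: "P i (l i)" for i unfolding l_def by (rule LeastI)
  have lL: "L \<le> l i" for i using Pl[of i] by (simp add: P_def)
  have lle: "l i \<le> m" if "P i m" for i m unfolding l_def using that by (rule Least_le)
  have l0: "0 < real (l i)" for i using lL[of i] by (simp add: L_def)
  obtain p where p: "\<And>n m. p (n + int m) - p n = (\<Sum>i\<in>{n..<n + int m}. (real N + 1) / real (l i))"
    using primitive_exists[of "\<lambda>i. (real N + 1) / real (l i)"] by blast
  have mono: "p n \<le> p (n + int m)" for n m
  proof -
    have "0 \<le> (\<Sum>i\<in>{n..<n + int m}. (real N + 1) / real (l i))" by (intro sum_nonneg) simp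
    then show ?thesis using p[of n m] by simp
  qed
  have gain: "real N + 1 \<le> p (n + int m) - p n" if "n \<in> E' m" "L \<le> m" for n m
  proof -
    have "of_nat (card {n..<n + int m}) * ((real N + 1) / real m) \<le> p (n + int m) - p n"
      unfolding p
    proof (rule sum_bounded_below)
      fix i assume i: "i \<in> {n..<n + int m}"
      then have "P i m" unfolding P_def using that by auto
      then have "real (l i) \<le> real m" using lle by simp
      then show "(real N + 1) / real m \<le> (real N + 1) / real (l i)"
        using l0[of i] by (intro divide_left_mono) auto
    qed
    then show ?thesis using that(2) by (simp add: L_def)
  qed
  have finE: "finite (E m)" "real (card (E m)) \<le> b ^ m" if "m \<ge> 1" for m
    using fin[OF that] card[OF that] by (simp_all add: E_def)
  have finE': "finite (E' m)" if "m \<ge> 1" for m using finE that by (simp add: E'_def)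
  \<comment> \<open>The starts of the ignored short intervals: finitely many, each costing N + 1 in
    the constant C.\<close>
  define S where "S = (\<Union>m\<in>{1..<L}. E m)"
  have finS: "finite S" unfolding S_def using finE by auto
  \<comment> \<open>Induction on m, splitting off the shortest exceptional interval that starts at
    n. By minimality \<kappa> loses at most N before its last step and at most 1 in that step; the
    loss N + 1 is paid by the gain of p or by the element n of S.\<close>
  have comp: "\<kappa> n - \<kappa> (n + int m) \<le> p (n + int m) - p n + real N + (real N + 1) * real (card (S \<inter> {n..<n + int m}))" for n m
  proof (induction m arbitrary: n rule: less_induct)
    case (less m)
    show ?case
    proof (cases "\<exists>m'. 1 \<le> m' \<and> m' \<le> m \<and> n \<in> E m'")
      case False
      have "\<kappa> n - \<kappa> (n + int m) \<le> real N"
      proof (cases "m = 0")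
        case False
        then have "n \<notin> E m" using \<open>\<not> (\<exists>m'. 1 \<le> m' \<and> m' \<le> m \<and> n \<in> E m')\<close> by auto
        then show ?thesis by (simp add: E_def)
      qed simp
      moreover have "0 \<le> (real N + 1) * real (card (S \<inter> {n..<n + int m}))" by simp
      ultimately show ?thesis using mono[of n m] by linarith
    next
      case True
      define m' where "m' = (LEAST m'. 1 \<le> m' \<and> m' \<le> m \<and> n \<in> E m')"
      have m': "1 \<le> m'" "m' \<le> m" "n \<in> E m'"
        using LeastI_ex[OF True] unfolding m'_def by auto
      have least: "n \<notin> E j" if "1 \<le> j" "j < m'" for j
        using not_less_Least[of j "\<lambda>m'. 1 \<le> m' \<and> m' \<le> m \<and> n \<in> E m'"] that m'(2) unfolding m'_def by auto
      have "\<kappa> n - \<kappa> (n + int (m' - 1)) \<le> real N"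
      proof (cases "m' = 1")
        case False
        then have "n \<notin> E (m' - 1)" using m'(1) by (intro least) auto
        then show ?thesis unfolding E_def by simp
      qed simp
      moreover have "\<kappa> (n + int (m' - 1)) \<le> \<kappa> (n + int m') + 1"
        using step[of "n + int (m' - 1)"] m'(1) by (simp add: of_nat_diff)
      ultimately have k1: "\<kappa> n - \<kappa> (n + int m') \<le> real N + 1" by simp
      have eq: "n + int m' + int (m - m') = n + int m" using m' by (simp add: of_nat_diff)
      have IH: "\<kappa> (n + int m') - \<kappa> (n + int m) \<le> p (n + int m) - p (n + int m') + real N
          + (real N + 1) * real (card (S \<inter> {n + int m'..<n + int m}))"
        using less.IH[of "m - m'" "n + int m'"] m' unfolding eq by simp
      have fin': "finite (S \<inter> {n..<n + int m})" using finS by simp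
      show ?thesis
      proof (cases "L \<le> m'")
        case True
        then have "real N + 1 \<le> p (n + int m') - p n" using gain[of n m'] m' by (simp add: E'_def)
        moreover have "real (card (S \<inter> {n + int m'..<n + int m})) \<le> real (card (S \<inter> {n..<n + int m}))"
          using fin' by (intro of_nat_mono card_mono) auto
        then have "(real N + 1) * real (card (S \<inter> {n + int m'..<n + int m}))
          \<le> (real N + 1) * real (card (S \<inter> {n..<n + int m}))" by (intro mult_left_mono) auto
        ultimately show ?thesis using IH k1 by linarith
      next
        case False
        then have "n \<in> S" using m' by (auto simp: S_def)
        then have sub: "insert n (S \<inter> {n + int m'..<n + int m}) \<subseteq> S \<inter> {n..<n + int m}" using m' by auto
        have "Suc (card (S \<inter> {n + int m'..<n + int m})) = card (insert n (S \<inter> {n + int m'..<n + int m}))"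
          using finS m'(1) by (subst card_insert_disjoint) auto
        also have "\<dots> \<le> card (S \<inter> {n..<n + int m})" by (rule card_mono[OF fin' sub])
        finally have "real (card (S \<inter> {n + int m'..<n + int m})) + 1 \<le> real (card (S \<inter> {n..<n + int m}))" by simp
        then have "(real N + 1) * (real (card (S \<inter> {n + int m'..<n + int m})) + 1)
          \<le> (real N + 1) * real (card (S \<inter> {n..<n + int m}))" by (intro mult_left_mono) auto
        then show ?thesis using IH k1 mono[of n m'] unfolding distrib_left by simp
      qed
    qed
  qed
  \<comment> \<open>The added interval that starts at 2^j L and has the same length gives p a gain
    of at least 1 per doubling.\<close>
  have dbl_up: "p (int L) + real j \<le> p (2 ^ j * int L)" for j
  proof (induction j)
    case (Suc j)
    have "int (2 ^ j * L) \<in> E' (2 ^ j * L)" by (simp add: E'_def)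
    moreover have "L \<le> 2 ^ j * L" by simp
    ultimately have g: "real N + 1 \<le> p (int (2 ^ j * L) + int (2 ^ j * L)) - p (int (2 ^ j * L))"
      by (rule gain)
    have "int (2 ^ j * L) = 2 ^ j * int L" "int (2 ^ j * L) + int (2 ^ j * L) = 2 ^ Suc j * int L" by simp_all
    with g have "real N + 1 \<le> p (2 ^ Suc j * int L) - p (2 ^ j * int L)" by (simp only:)
    then show ?case using Suc by simp
  qed simp
  have dbl_down: "p (- (2 ^ j * int L)) \<le> p (- int L) - real j" for j
  proof (induction j)
    case (Suc j)
    have "- 2 * int (2 ^ j * L) \<in> E' (2 ^ j * L)" by (simp add: E'_def)
    moreover have "L \<le> 2 ^ j * L" by simp
    ultimately have g: "real N + 1 \<le> p (- 2 * int (2 ^ j * L) + int (2 ^ j * L)) - p (- 2 * int (2 ^ j * L))"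
      by (rule gain)
    have "- 2 * int (2 ^ j * L) + int (2 ^ j * L) = - (2 ^ j * int L)" "- 2 * int (2 ^ j * L) = - (2 ^ Suc j * int L)"
      by simp_all
    with g have "real N + 1 \<le> p (- (2 ^ j * int L)) - p (- (2 ^ Suc j * int L))" by (simp only:)
    then show ?case using Suc by simp
  qed simp
  define X where "X k = {i. l i < k}" for k
  \<comment> \<open>X k is covered by fewer than k lengths and k shifts of sets with at most 6 (2
    b)^k elements. With k \<le> 2^k and 6 \<le> 6^k the base becomes 2 . 2 . 6 . 2 b.\<close>
  have cX: "finite (X k) \<and> real (card (X k)) \<le> (48 * b) ^ k" for k
  proof (cases "k = 0")
    case True
    then show ?thesis by (simp add: X_def)
  next
    case False
    let ?U = "\<Union>m\<in>{1..<k}. \<Union>j\<in>{..<m}. (\<lambda>n. n + int j) ` E' m"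
    have sub: "X k \<subseteq> ?U"
    proof
      fix i assume i: "i \<in> X k"
      obtain n where n: "n \<in> E' (l i)" "n \<le> i" "i < n + int (l i)" using Pl[of i] by (auto simp: P_def)
      have "i \<in> (\<lambda>n. n + int (nat (i - n))) ` E' (l i)" using n by (intro image_eqI[of _ _ n]) auto
      moreover have "nat (i - n) \<in> {..<l i}" using n by auto
      moreover have "l i \<in> {1..<k}" using i lL[of i] by (auto simp: X_def L_def)
      ultimately show "i \<in> ?U" using n by (intro UN_I[of "l i"] UN_I[of "nat (i - n)"]) auto
    qed
    have finU: "finite ?U" using finE' by auto
    have cE': "real (card (E' m)) \<le> 6 * (2 * b) ^ k" if m: "m \<in> {1..<k}" for m
    proof -
      have "card (E' m) \<le> card (E m) + card {- 2 * int m..2 * int m}" unfolding E'_def by (rule card_Un_le)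
      then have "real (card (E' m)) \<le> real (card (E m)) + real (4 * m + 1)" by simp
      also have "real (card (E m)) \<le> b ^ m" using finE m by simp
      also have "b ^ m \<le> b ^ k" using b m by (intro power_increasing) auto
      also have "b ^ k \<le> (2 * b) ^ k" using b by (intro power_mono) auto
      also have "real (4 * m + 1) \<le> 5 * 2 ^ k"
      proof -
        have "real m < 2 ^ m" by (rule of_nat_less_two_power)
        also have "(2::real) ^ m \<le> 2 ^ k" using m by (intro power_increasing) auto
        finally have "real m < 2 ^ k" .
        moreover have "(1::real) \<le> 2 ^ k" by simp
        moreover have "real (4 * m + 1) = 4 * real m + 1" by simp
        ultimately show ?thesis by linarith
      qed
      also have "5 * 2 ^ k \<le> 5 * (2 * b) ^ k" using b by (intro mult_left_mono power_mono) auto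
      finally show ?thesis by linarith
    qed
    have "card (X k) \<le> card ?U" using sub finU by (intro card_mono)
    also have "\<dots> \<le> (\<Sum>m\<in>{1..<k}. card (\<Union>j\<in>{..<m}. (\<lambda>n. n + int j) ` E' m))" by (intro card_UN_le) simp
    also have "\<dots> \<le> (\<Sum>m\<in>{1..<k}. \<Sum>j\<in>{..<m}. card ((\<lambda>n. n + int j) ` E' m))" by (intro sum_mono card_UN_le) simp
    also have "\<dots> = (\<Sum>m\<in>{1..<k}. m * card (E' m))" by (simp add: card_image inj_on_def)
    finally have "real (card (X k)) \<le> real (\<Sum>m\<in>{1..<k}. m * card (E' m))" by (simp only: of_nat_le_iff)
    also have "\<dots> = (\<Sum>m\<in>{1..<k}. real m * real (card (E' m)))" by simp
    also have "\<dots> \<le> of_nat (card {1..<k}) * (real k * (6 * (2 * b) ^ k))"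
      using cE' by (intro sum_bounded_above mult_mono) auto
    also have "\<dots> \<le> real k * (real k * (6 * (2 * b) ^ k))" using b by (intro mult_right_mono) auto
    also have "\<dots> \<le> 2 ^ k * (2 ^ k * (6 ^ k * (2 * b) ^ k))"
    proof -
      have k: "real k \<le> 2 ^ k" using of_nat_less_two_power[of k, where 'a = real] by simp
      have "(6::real) \<le> 6 ^ k" using False by (intro self_le_power) auto
      then show ?thesis using k b by (intro mult_mono[OF k] mult_right_mono mult_nonneg_nonneg) simp_all
    qed
    also have "\<dots> = (2 * (2 * (6 * (2 * b)))) ^ k" by (simp only: power_mult_distrib)
    also have "\<dots> = (48 * b) ^ k" by simp
    finally show ?thesis using finite_subset[OF sub finU] by simp
  qed
  have win: "\<exists>j\<in>{1..R * k}. n - int j \<in> X k" if "real R * (real N + 1) < p n - p (n - int (R * k))" for R k n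
  proof (rule ccontr)
    assume neg: "\<not> ?thesis"
    have k: "k \<noteq> 0"
    proof
      assume "k = 0"
      then have "real R * (real N + 1) < 0" using that by simp
      moreover have "0 \<le> real R * (real N + 1)" by simp
      ultimately show False by linarith
    qed
    have "p n - p (n - int (R * k)) = (\<Sum>i\<in>{n - int (R * k)..<n}. (real N + 1) / real (l i))"
      using p[of "n - int (R * k)" "R * k"] by simp
    also have "\<dots> \<le> of_nat (card {n - int (R * k)..<n}) * ((real N + 1) / real k)"
    proof (rule sum_bounded_above)
      fix i assume i: "i \<in> {n - int (R * k)..<n}"
      have "k \<le> l i"
      proof (rule ccontr)
        assume "\<not> k \<le> l i"
        then have "n - int (nat (n - i)) \<in> X k" using i by (simp add: X_def)
        moreover have "nat (n - i) \<in> {1..R * k}" using i by (auto simp: nat_le_iff)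
        ultimately show False using neg by blast
      qed
      then show "(real N + 1) / real (l i) \<le> (real N + 1) / real k"
        using k by (intro divide_left_mono) auto
    qed
    also have "\<dots> = real R * (real N + 1)" using k by simp
    finally show False using that by simp
  qed
  show thesis
  proof (rule that[of p "real N + (real N + 1) * real (card S)" "48 * b" "real N + 1"])
    have one: "p (n + 1) - p n = (real N + 1) / real (l n)" for n
    proof -
      have "{n..<n + 1} = {n}" by auto
      then show ?thesis using p[of n 1] by simp
    qed
    show "p n < p (n + 1)" for n
    proof -
      have "0 < (real N + 1) / real (l n)" using l0[of n] by simp
      then show ?thesis using one[of n] by simp
    qed
    show "p (n + 1) \<le> p n + 1 / 2" for n
    proof -
      have "(real N + 1) / real (l n) \<le> (real N + 1) / real L"
        using lL[of n] by (intro divide_left_mono) (auto simp: L_def)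
      also have "\<dots> = 1 / 2" by (simp add: L_def field_simps)
      finally show ?thesis using one[of n] by linarith
    qed
    show "\<kappa> n - \<kappa> (n + int m) \<le> p (n + int m) - p n + (real N + (real N + 1) * real (card S))" for n m
    proof -
      have "(real N + 1) * real (card (S \<inter> {n..<n + int m})) \<le> (real N + 1) * real (card S)"
        using finS by (intro mult_left_mono of_nat_mono card_mono) auto
      then show ?thesis using comp[of n m] by linarith
    qed
    show "\<exists>n. Z < p n" for Z
    proof -
      obtain j :: nat where "Z - p (int L) < real j" using reals_Archimedean2 by blast
      then show ?thesis using dbl_up[of j] by (intro exI[of _ "2 ^ j * int L"]) simp
    qed
    show "\<exists>n. p n < Z" for Z
    proof -
      obtain j :: nat where "p (- int L) - Z < real j" using reals_Archimedean2 by blast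
      then show ?thesis using dbl_down[of j] by (intro exI[of _ "- (2 ^ j * int L)"]) simp
    qed
    show "48 * b \<ge> 1" "real N + 1 > 0" using b by auto
    have sub: "{n. real R * (real N + 1) < p n - p (n - int (R * k))} \<subseteq> (\<Union>j\<in>{1..R * k}. (\<lambda>i. i + int j) ` X k)" for R k
    proof
      fix n assume "n \<in> {n. real R * (real N + 1) < p n - p (n - int (R * k))}"
      then obtain j where "j \<in> {1..R * k}" "n - int j \<in> X k" using win by blast
      then show "n \<in> (\<Union>j\<in>{1..R * k}. (\<lambda>i. i + int j) ` X k)"
        by (intro UN_I[of j] image_eqI[of _ _ "n - int j"]) auto
    qed
    have finU: "finite (\<Union>j\<in>{1..R * k}. (\<lambda>i. i + int j) ` X k)" for R k using cX[of k] by auto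
    show "finite {n. real R * (real N + 1) < p n - p (n - int (R * k))}" for R k
      using finite_subset[OF sub finU] .
    show "real (card {n. real R * (real N + 1) < p n - p (n - int (R * k))}) \<le> real (R * k) * (48 * b) ^ k" for R k
    proof -
      have "card {n. real R * (real N + 1) < p n - p (n - int (R * k))} \<le> card (\<Union>j\<in>{1..R * k}. (\<lambda>i. i + int j) ` X k)"
        using sub finU by (intro card_mono)
      also have "\<dots> \<le> (\<Sum>j\<in>{1..R * k}. card ((\<lambda>i. i + int j) ` X k))" by (intro card_UN_le) simp
      also have "\<dots> = R * k * card (X k)" by (simp add: card_image inj_on_def)
      finally have "real (card {n. real R * (real N + 1) < p n - p (n - int (R * k))}) \<le> real (R * k * card (X k))"
        by (simp only: of_nat_le_iff)
      also have "\<dots> \<le> real (R * k) * (48 * b) ^ k" using cX[of k] by (simp add: mult_left_mono)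
      finally show ?thesis .
    qed
    show "\<not> real R * (real N + 1) < p n - p (n - int R)" for R n
    proof
      assume "real R * (real N + 1) < p n - p (n - int R)"
      then obtain j where "n - int j \<in> X 1" using win[of R n 1] by auto
      then show False using lL[of "n - int j"] by (simp add: X_def L_def)
    qed
  qed
qed

text \<open>Piecewise linear interpolation keeps all slopes in (0, 1/2]. The upper bound makes x -
  \<phi> x increasing and unbounded in both directions as well.\<close>

lemma interpolate_int:
  fixes p :: "int \<Rightarrow> real"
  assumes p: "\<And>n. p n < p (n + 1)" "\<And>n. p (n + 1) \<le> p n + 1 / 2"
  obtains \<phi> :: "real \<Rightarrow> real" where "\<And>n. \<phi> (of_int n) = p n" "\<And>x y. x < y \<Longrightarrow> \<phi> x < \<phi> y"
    "\<And>x y. x \<le> y \<Longrightarrow> \<phi> y - \<phi> x \<le> (y - x) / 2"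
proof -
  define \<phi> where "\<phi> x = p \<lfloor>x\<rfloor> + (x - of_int \<lfloor>x\<rfloor>) * (p (\<lfloor>x\<rfloor> + 1) - p \<lfloor>x\<rfloor>)" for x
  have int: "\<phi> (of_int n) = p n" for n by (simp add: \<phi>_def)
  have loc: "\<phi> x = p n + (x - of_int n) * (p (n + 1) - p n)" if "of_int n \<le> x" "x \<le> of_int n + 1" for x n
  proof (cases "x = of_int n + 1")
    case True
    then show ?thesis using int[of "n + 1"] by simp
  next
    case False
    then have "\<lfloor>x\<rfloor> = n" using that by (intro floor_unique) auto
    then show ?thesis by (simp add: \<phi>_def)
  qed
  have near: "\<phi> x < \<phi> y \<and> \<phi> y - \<phi> x \<le> (y - x) / 2" if "of_int n \<le> x" "x < y" "y \<le> of_int n + 1" for x y n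
  proof -
    have "\<phi> y - \<phi> x = (y - x) * (p (n + 1) - p n)" using that by (simp add: loc[of n] algebra_simps)
    moreover have "0 < (y - x) * (p (n + 1) - p n)" using p(1)[of n] that by simp
    moreover have "(y - x) * (p (n + 1) - p n) \<le> (y - x) * (1 / 2)"
      using p(2)[of n] that by (intro mult_left_mono) auto
    ultimately show ?thesis by simp
  qed
  have grid: "p n \<le> p (n + int m) \<and> p (n + int m) - p n \<le> real m / 2" for n m
  proof (induction m)
    case (Suc m)
    have "n + int (Suc m) = n + int m + 1" by simp
    then have "p (n + int (Suc m)) = p (n + int m + 1)" by (rule arg_cong)
    moreover have "real (Suc m) / 2 = real m / 2 + 1 / 2" by (simp add: field_simps)
    ultimately show ?case using Suc p[of "n + int m"] by linarith
  qed simp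
  have all: "\<phi> x < \<phi> y \<and> \<phi> y - \<phi> x \<le> (y - x) / 2" if "x < y" for x y
  proof (cases "\<lfloor>x\<rfloor> = \<lfloor>y\<rfloor>")
    case True
    have "of_int \<lfloor>x\<rfloor> \<le> x" "y \<le> of_int \<lfloor>x\<rfloor> + 1" using True by linarith+
    then show ?thesis using near that by blast
  next
    case False
    define n m where "n = \<lfloor>x\<rfloor>" and "m = \<lfloor>y\<rfloor>"
    have nm: "n + 1 \<le> m" using False floor_mono[of x y] that by (auto simp: n_def m_def)
    have "of_int n \<le> x" "x < of_int (n + 1)" unfolding n_def by linarith+
    then have 1: "\<phi> x < p (n + 1) \<and> p (n + 1) - \<phi> x \<le> (of_int (n + 1) - x) / 2"
      using near[of n x "of_int (n + 1)"] int[of "n + 1"] by simp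
    have 2: "p (n + 1) \<le> p m \<and> p m - p (n + 1) \<le> (of_int m - of_int (n + 1)) / 2"
      using grid[of "n + 1" "nat (m - (n + 1))"] nm by simp
    have "of_int m \<le> y" "y < of_int m + 1" unfolding m_def by linarith+
    then have 3: "p m \<le> \<phi> y \<and> \<phi> y - p m \<le> (y - of_int m) / 2"
      using near[of m "of_int m" y] int[of m] by (cases "y = of_int m") auto
    show ?thesis using 1 2 3 by (simp add: field_simps)
  qed
  show thesis
  proof (rule that[of \<phi>])
    show "\<phi> y - \<phi> x \<le> (y - x) / 2" if "x \<le> y" for x y using all[of x y] that by (cases "x = y") auto
  qed (use int all in auto)
qed

section \<open>From logarithmic coordinates to N-functions\<close>

lemma surj_if_strict_mono_unbounded:
  fixes \<psi> :: "real \<Rightarrow> real"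
  assumes cont: "continuous_on UNIV \<psi>" and mono: "\<And>x y. x < y \<Longrightarrow> \<psi> x < \<psi> y"
    and unb: "\<And>Z. \<exists>x. Z < \<psi> x" "\<And>Z. \<exists>x. \<psi> x < Z"
  shows "\<exists>x. \<psi> x = z"
proof -
  obtain x1 x2 where x: "\<psi> x1 < z" "z < \<psi> x2" using unb by blast
  then have "x1 \<le> x2" using mono[of x2 x1] by (cases "x1 \<le> x2") auto
  moreover have "continuous_on {x1..x2} \<psi>" using cont by (rule continuous_on_subset) simp
  ultimately show ?thesis using IVT'[of \<psi> x1 z x2] x by auto
qed

lemma phi_function_powr_log:
  assumes a: "a > 1" and mono: "\<And>x y. x < y \<Longrightarrow> \<psi> x < \<psi> y" and surj: "\<And>z. \<exists>x. \<psi> x = z"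
  shows "phi_function (\<lambda>v. if v > 0 then a powr \<psi> (log a v) else 0)"
proof (rule phi_functionI)
  fix x y :: real assume "0 \<le> x" "x < y"
  then show "(if x > 0 then a powr \<psi> (log a x) else 0) < (if y > 0 then a powr \<psi> (log a y) else 0)"
    using a mono[of "log a x" "log a y"] by auto
next
  fix y :: real assume y: "0 \<le> y"
  show "\<exists>x\<ge>0. (if x > 0 then a powr \<psi> (log a x) else 0) = y"
  proof (cases "y = 0")
    case False
    obtain t where "\<psi> t = log a y" using surj by blast
    then show ?thesis using a y False by (intro exI[of _ "a powr t"]) auto
  qed auto
qed simp

text \<open>Kc is the supremum of the convex functions t -> (\<Phi> s / s) max 0 (t - s). The choice
  s = t / 2 gives \<Phi> (t / 2) \<le> Kc t. The hypothesis gives Kc t \<le> C \<Phi> t and,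
  comparing slopes at t and C^2 t, also C \<Phi> t \<le> \<Phi> (C^2 t).\<close>

lemma phi_equiv_convex:
  assumes \<Phi>: "phi_function \<Phi>" and C: "C \<ge> 1"
    and inc: "\<And>s t. 0 < s \<Longrightarrow> s \<le> t \<Longrightarrow> \<Phi> s / s \<le> C * (\<Phi> t / t)"
  obtains Kc where "convex_on {0..} Kc" "phi_equiv \<Phi> Kc"
proof -
  define g where "g s t = \<Phi> s / s * max 0 (t - s)" for s t
  define Kc where "Kc t = (SUP s\<in>{0<..}. g s t)" for t
  have q: "0 \<le> \<Phi> s / s" if "0 < s" for s using phi_pos[OF \<Phi> that] that by simp
  have g_le: "g s t \<le> C * \<Phi> t" if s: "0 < s" and t: "0 \<le> t" for s t
  proof (cases "s < t")
    case True
    have "g s t \<le> C * (\<Phi> t / t) * t"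
      unfolding g_def using inc[OF s, of t] True s q[OF s] by (intro mult_mono) auto
    then show ?thesis using True s by simp
  next
    case False
    then show ?thesis using phi_nonneg[OF \<Phi> t] C by (simp add: g_def)
  qed
  have bdd: "bdd_above ((\<lambda>s. g s t) ` {0<..})" if "0 \<le> t" for t
    using g_le that by (intro bdd_aboveI[of _ "C * \<Phi> t"]) auto
  have g_Kc: "g s t \<le> Kc t" if "0 < s" "0 \<le> t" for s t
    unfolding Kc_def using that bdd by (intro cSUP_upper) auto
  have Kc_le: "Kc t \<le> C * \<Phi> t" if "0 \<le> t" for t
    unfolding Kc_def using that g_le by (intro cSUP_least) auto
  have "convex_on {0..} Kc"
  proof (rule convex_onI)
    fix l x y :: real
    assume l: "0 < l" "l < 1" and xy: "x \<in> {0..}" "y \<in> {0..}"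
    show "Kc ((1 - l) *\<^sub>R x + l *\<^sub>R y) \<le> (1 - l) * Kc x + l * Kc y"
      unfolding Kc_def[of "(1 - l) *\<^sub>R x + l *\<^sub>R y"]
    proof (rule cSUP_least)
      fix s :: real assume s: "s \<in> {0<..}"
      have "max 0 ((1 - l) * x + l * y - s) \<le> (1 - l) * max 0 (x - s) + l * max 0 (y - s)"
      proof -
        have "(1 - l) * x + l * y - s = (1 - l) * (x - s) + l * (y - s)" by (simp add: algebra_simps)
        also have "\<dots> \<le> (1 - l) * max 0 (x - s) + l * max 0 (y - s)"
          using l by (intro add_mono mult_left_mono) auto
        finally show ?thesis using l by (auto intro!: add_nonneg_nonneg)
      qed
      then have "g s ((1 - l) *\<^sub>R x + l *\<^sub>R y) \<le> \<Phi> s / s * ((1 - l) * max 0 (x - s) + l * max 0 (y - s))"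
        unfolding g_def using q[of s] s by (intro mult_left_mono) auto
      also have "\<dots> = (1 - l) * g s x + l * g s y" unfolding g_def by (simp only: algebra_simps)
      also have "\<dots> \<le> (1 - l) * Kc x + l * Kc y"
        using g_Kc s xy l by (intro add_mono mult_left_mono) auto
      finally show "g s ((1 - l) *\<^sub>R x + l *\<^sub>R y) \<le> (1 - l) * Kc x + l * Kc y" .
    qed simp
  qed simp
  moreover have "phi_equiv \<Phi> Kc"
    unfolding phi_equiv_def
  proof (intro exI[of _ "2 * C\<^sup>2"] conjI allI impI)
    show "0 < 2 * C\<^sup>2" using C by simp
    have C2: "1 \<le> C\<^sup>2" using C by simp
    fix t :: real assume t: "0 \<le> t"
    show "\<Phi> (t / (2 * C\<^sup>2)) \<le> Kc t"
    proof (cases "t = 0")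
      case True
      have "0 \<le> g 1 0" using q[of 1] by (simp add: g_def)
      then show ?thesis using g_Kc[of 1 0] True by (simp add: phi_zero[OF \<Phi>])
    next
      case False
      have "\<Phi> (t / (2 * C\<^sup>2)) \<le> \<Phi> (t / 2)"
        using t C2 by (intro phi_mono[OF \<Phi>] divide_left_mono) auto
      also have "\<dots> = g (t / 2) t" using t False by (simp add: g_def)
      also have "\<dots> \<le> Kc t" using t False by (intro g_Kc) auto
      finally show ?thesis .
    qed
    show "Kc t \<le> \<Phi> (2 * C\<^sup>2 * t)"
    proof (cases "t = 0")
      case True
      then show ?thesis using Kc_le[of 0] by (simp add: phi_zero[OF \<Phi>])
    next
      case False
      have ct: "t \<le> C\<^sup>2 * t" using C2 t by (simp add: mult_le_cancel_right1)
      have "C * \<Phi> t \<le> \<Phi> (C\<^sup>2 * t)"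
      proof -
        have "\<Phi> t / t \<le> C * (\<Phi> (C\<^sup>2 * t) / (C\<^sup>2 * t))" using inc[OF _ ct] t False by simp
        also have "\<dots> = \<Phi> (C\<^sup>2 * t) / C / t" using C by (simp add: power2_eq_square)
        finally have "\<Phi> t / t \<le> \<Phi> (C\<^sup>2 * t) / C / t" .
        from mult_right_mono[OF this t] have "\<Phi> t \<le> \<Phi> (C\<^sup>2 * t) / C" using False by simp
        then show ?thesis using C by (simp add: pos_le_divide_eq mult.commute)
      qed
      also have "\<dots> \<le> \<Phi> (2 * C\<^sup>2 * t)" using t C2 by (intro phi_mono[OF \<Phi>]) auto
      finally show ?thesis using Kc_le[OF t] by simp
    qed
  qed
  ultimately show thesis by (rule that)
qed

text \<open>The quotient H t / t coincides with P o H, which is a \<phi>-function, so H serves as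
  its own F0.\<close>

lemma N_functionI:
  assumes H: "phi_function H" and P: "phi_function P" and eq: "\<And>t. t > 0 \<Longrightarrow> H t / t = P (H t)"
  shows "N_function H"
  unfolding N_function_def
proof (intro conjI exI[of _ H] H)
  have PH: "phi_function (P \<circ> H)" by (rule phi_function_comp[OF P H])
  show "phi_equiv H H" unfolding phi_equiv_def by (intro exI[of _ 1]) auto
  show "strict_mono_on {0<..} (\<lambda>t. H t / t)"
    using phi_strict[OF PH] by (auto simp: strict_mono_on_def eq)
  have "filterlim (P \<circ> H) at_top at_top" using PH by (simp add: phi_function_def)
  moreover have "eventually (\<lambda>t. (P \<circ> H) t = H t / t) at_top"
    using eventually_gt_at_top[of 0] by eventually_elim (simp add: eq)
  ultimately show "filterlim (\<lambda>t. H t / t) at_top at_top"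
    by (rule filterlim_cong[OF refl refl, THEN iffD1, rotated])
  have "continuous_on {0..} (P \<circ> H)" using PH by (simp add: phi_function_def)
  then have "((P \<circ> H) \<longlongrightarrow> (P \<circ> H) 0) (at 0 within {0..})" by (simp add: continuous_on_def comp_def)
  then have "((P \<circ> H) \<longlongrightarrow> 0) (at_right 0)"
    unfolding phi_zero[OF PH] by (rule tendsto_within_subset) auto
  moreover have "eventually (\<lambda>t. (P \<circ> H) t = H t / t) (at_right 0)"
    unfolding eventually_at_right_field by (intro exI[of _ 1]) (simp add: eq)
  ultimately show "((\<lambda>t. H t / t) \<longlongrightarrow> 0) (at_right 0)" by (rule Lim_transform_eventually)
qed

text \<open>Grouping by the value of kk leaves a geometric series in \<eta> that starts at exponent
  1, so the total becomes small with \<eta>.\<close>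

lemma sum_geometric_layers_le:
  fixes kk :: "'i \<Rightarrow> nat" and A :: "'i set"
  assumes fin: "finite A" and kk: "\<And>n. n \<in> A \<Longrightarrow> 1 \<le> kk n" and \<rho>: "0 \<le> \<rho>" and \<eta>: "0 \<le> \<eta>" "\<eta> \<le> 1 / 2"
    and W: "0 \<le> W" and card: "\<And>k. 1 \<le> k \<Longrightarrow> \<rho> ^ k * real (card {n \<in> A. kk n = k}) \<le> W * \<eta> ^ k"
  shows "(\<Sum>n\<in>A. \<rho> ^ kk n) \<le> 2 * W * \<eta>"
proof -
  have geo: "(\<Sum>k\<in>{1..K}. \<eta> ^ k) \<le> 2 * \<eta> - 2 * \<eta> ^ Suc K" for K
  proof (induction K)
    case (Suc K)
    have "\<eta> ^ Suc K * (2 * \<eta>) \<le> \<eta> ^ Suc K * 1" using \<eta> by (intro mult_left_mono) auto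
    moreover have "\<eta> ^ Suc K * (2 * \<eta>) = 2 * \<eta> ^ Suc (Suc K)" by simp
    moreover have "(\<Sum>k\<in>{1..Suc K}. \<eta> ^ k) = (\<Sum>k\<in>{1..K}. \<eta> ^ k) + \<eta> ^ Suc K" by simp
    ultimately show ?case using Suc by linarith
  qed (use \<eta> in simp)
  obtain K where K: "kk ` A \<subseteq> {..K}" using fin finite_nat_iff_bounded_le[of "kk ` A"] by auto
  have "(\<Sum>n\<in>A. \<rho> ^ kk n) = (\<Sum>k\<in>kk ` A. \<Sum>n\<in>{n \<in> A. kk n = k}. \<rho> ^ kk n)"
    by (rule sum.image_gen[OF fin])
  also have "\<dots> = (\<Sum>k\<in>kk ` A. \<rho> ^ k * real (card {n \<in> A. kk n = k}))"
    by (intro sum.cong refl) simp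
  also have "\<dots> \<le> (\<Sum>k\<in>{1..K}. \<rho> ^ k * real (card {n \<in> A. kk n = k}))"
    using K kk \<rho> by (intro sum_mono2) force+
  also have "\<dots> \<le> (\<Sum>k\<in>{1..K}. W * \<eta> ^ k)" using card by (intro sum_mono) auto
  also have "\<dots> = W * (\<Sum>k\<in>{1..K}. \<eta> ^ k)" by (simp only: sum_distrib_left)
  also have "\<dots> \<le> W * (2 * \<eta>)"
    using geo[of K] \<eta> W by (intro mult_left_mono) (auto intro: order_trans)
  finally show ?thesis by simp
qed

text \<open>With a = s^2, Bernoulli gives R (s - 1) \<le> s^R, and the other factor s^R absorbs c /
  (s - 1).\<close>

lemma exponential_dominates_linear:
  fixes a c :: real
  assumes a: "a > 1"
  obtains R :: nat where "R \<ge> 1" "c * real R \<le> a ^ R"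
proof -
  define s where "s = sqrt a"
  have s: "s > 1" using a by (simp add: s_def)
  obtain R where R: "max 1 (c / (s - 1)) < s ^ R" using real_arch_pow[OF s] by blast
  have "R \<ge> 1" using R by (cases R) auto
  moreover have "c * real R \<le> a ^ R"
  proof -
    have "c \<le> s ^ R * (s - 1)" using R s by (simp add: field_simps)
    then have "c * real R \<le> s ^ R * (s - 1) * real R" by (intro mult_right_mono) auto
    also have "\<dots> = s ^ R * (real R * (s - 1))" by simp
    also have "\<dots> \<le> s ^ R * s ^ R"
      using Bernoulli_inequality[of "s - 1" R] s by (intro mult_left_mono) auto
    also have "\<dots> = a ^ R" using a by (simp add: s_def power_mult_distrib[symmetric])
    finally show ?thesis .
  qed
  ultimately show thesis by (rule that)
qed

text \<open>
  With \<open>P (a\<^sup>n) = a powr p n\<close>, where \<open>p\<close> is the compensating function for \<open>log K (a\<^sup>n) - n\<close>, the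
  function \<open>K v P v / v\<close> is essentially increasing, which means that \<open>K \<circ> H\<close> is equivalent to a
  convex function if \<open>H\<close> is the inverse of \<open>v / P v\<close>. The inverse of \<open>P\<close> is complementary to \<open>H\<close>,
  and condition (J) expresses that \<open>P\<close> grows slowly.
\<close>

lemma N_function_if_almost_convex:
  assumes K: "phi_function K" and ac: "almost_convex K"
  shows "\<exists>H. N_function H \<and> condition_J H \<and> phi_succ K (phi_inv H)"
proof -
  obtain a b :: real and N :: nat where a: "a > 1" and b: "b > 1" and fin: "\<And>m. m \<ge> 1 \<Longrightarrow>
    finite {n. \<not> K (a powi (n + int m)) \<ge> a powi (int m - int N) * K (a powi n)} \<and>
    real (card {n. \<not> K (a powi (n + int m)) \<ge> a powi (int m - int N) * K (a powi n)}) < b ^ m"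
    using ac unfolding almost_convex_def Let_def by blast
  have a0: "a > 0" using a by simp
  have powi: "a powi n = a powr of_int n" for n :: int using a by (simp add: powr_real_of_int')
  define \<kappa> where "\<kappa> n = log a (K (a powi n)) - of_int n" for n
  have Kp: "K (a powi n) > 0" for n using a by (intro phi_pos[OF K]) simp
  have E: "real N < \<kappa> n - \<kappa> (n + int m) \<longleftrightarrow> \<not> K (a powi (n + int m)) \<ge> a powi (int m - int N) * K (a powi n)" for n m
  proof -
    have "\<not> K (a powi (n + int m)) \<ge> a powi (int m - int N) * K (a powi n) \<longleftrightarrow>
      log a (K (a powi (n + int m))) < log a (a powi (int m - int N) * K (a powi n))"
      using a Kp by (simp add: not_le)
    also have "log a (a powi (int m - int N) * K (a powi n)) = (real m - real N) + log a (K (a powi n))"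
      using a Kp[of n] by (simp add: log_mult powi)
    finally show ?thesis by (auto simp: \<kappa>_def)
  qed
  obtain p C D M where p: "\<And>n. p n < p (n + 1)" "\<And>n. p (n + 1) \<le> p n + 1 / 2"
    and comp: "\<And>n m. \<kappa> n - \<kappa> (n + int m) \<le> p (n + int m) - p n + C"
    and unb: "\<And>Z. \<exists>n. Z < p n" "\<And>Z. \<exists>n. p n < Z" and D: "D \<ge> 1" and M: "M > 0"
    and Xfin: "\<And>R k. finite {n. real R * M < p n - p (n - int (R * k))}"
    and Xcard: "\<And>R k. real (card {n. real R * M < p n - p (n - int (R * k))}) \<le> real (R * k) * D ^ k"
    and X1: "\<And>R n. \<not> real R * M < p n - p (n - int R)"
  proof (rule compensating_function[of \<kappa> b N])
    show "\<kappa> n \<le> \<kappa> (n + 1) + 1" for n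
    proof -
      have "K (a powi n) \<le> K (a powi (n + 1))"
        using a by (intro phi_mono[OF K]) (auto intro: power_int_increasing)
      then show ?thesis using a Kp[of n] Kp[of "n + 1"] by (simp add: \<kappa>_def)
    qed
    show "finite {n. real N < \<kappa> n - \<kappa> (n + int m)}" "real (card {n. real N < \<kappa> n - \<kappa> (n + int m)}) \<le> b ^ m"
      if "m \<ge> 1" for m using fin[OF that] unfolding E by auto
  qed (use b that in blast)+
  have C0: "0 \<le> C" using comp[of 0 0] by simp
  obtain \<phi> where \<phi>: "\<And>n. \<phi> (of_int n) = p n" "\<And>x y. x < y \<Longrightarrow> \<phi> x < \<phi> y"
    "\<And>x y. x \<le> y \<Longrightarrow> \<phi> y - \<phi> x \<le> (y - x) / 2"
    using interpolate_int[of p, OF p] by blast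
  have \<phi>mono: "\<phi> x \<le> \<phi> y" if "x \<le> y" for x y using \<phi>(2)[of x y] that by (cases "x = y") auto
  have lip: "\<bar>\<phi> x - \<phi> y\<bar> \<le> \<bar>x - y\<bar>" for x y
  proof (cases "x \<le> y")
    case True
    then show ?thesis using \<phi>(3)[OF True] \<phi>mono[OF True] by auto
  next
    case False
    then show ?thesis using \<phi>(3)[of y x] \<phi>mono[of y x] by auto
  qed
  have cont: "continuous_on UNIV \<phi>"
  proof (rule lipschitz_on_continuous_on)
    show "1-lipschitz_on UNIV \<phi>" using lip by (intro lipschitz_onI) (auto simp: dist_real_def)
  qed
  have surj\<phi>: "\<exists>x. \<phi> x = z" for z
    using unb by (intro surj_if_strict_mono_unbounded[OF cont \<phi>(2)]) (metis \<phi>(1))+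
  \<comment> \<open>The exponent of Q v = v / P v. Slopes of \<phi> are at most 1/2, so those of
    \<psi> are at least 1/2 and Q is a \<phi>-function.\<close>
  define \<psi> where "\<psi> x = x - \<phi> x" for x
  have \<psi>mono: "\<psi> x < \<psi> y" if "x < y" for x y using \<phi>(3)[of x y] that by (simp add: \<psi>_def)
  have surj\<psi>: "\<exists>x. \<psi> x = z" for z
  proof (rule surj_if_strict_mono_unbounded[OF _ \<psi>mono])
    show "continuous_on UNIV \<psi>" unfolding \<psi>_def by (intro continuous_intros cont)
    fix Z :: real
    define t where "t = \<bar>Z\<bar> + \<bar>\<phi> 0\<bar> + 1"
    have t: "0 \<le> t" "Z + \<phi> 0 < t" "- Z - \<phi> 0 < t" unfolding t_def by linarith+
    have "\<phi> (2 * t) - \<phi> 0 \<le> t" "\<phi> 0 - \<phi> (- 2 * t) \<le> t"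
      using \<phi>(3)[of 0 "2 * t"] \<phi>(3)[of "- 2 * t" 0] t(1) by simp_all
    then have "Z < \<psi> (2 * t)" "\<psi> (- 2 * t) < Z" unfolding \<psi>_def using t by linarith+
    then show "\<exists>x. Z < \<psi> x" "\<exists>x. \<psi> x < Z" by blast+
  qed
  define P Q where "P = (\<lambda>v. if v > 0 then a powr \<phi> (log a v) else 0)"
    and "Q = (\<lambda>v. if v > 0 then a powr \<psi> (log a v) else 0)"
  have P: "phi_function P" unfolding P_def by (rule phi_function_powr_log[OF a \<phi>(2) surj\<phi>])
  have Q: "phi_function Q" unfolding Q_def by (rule phi_function_powr_log[OF a \<psi>mono surj\<psi>])
  have PQ: "P v * Q v = v" if "v \<ge> 0" for v
    using a that by (auto simp: P_def Q_def \<psi>_def powr_add[symmetric])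
  define Hs H where "Hs = phi_inv P" and "H = phi_inv Q"
  have Hs: "phi_function Hs" and H: "phi_function H"
    unfolding Hs_def H_def by (intro phi_function_phi_inv P Q)+
  have invHs: "phi_inv Hs t = P t" and invH: "phi_inv H t = Q t" if "t \<ge> 0" for t
    unfolding Hs_def H_def using phi_inv_phi_inv P Q that by blast+
  have HsP: "Hs (P t) = t" if "t \<ge> 0" for t unfolding Hs_def by (rule phi_inv_phi[OF P that])
  have QH: "Q (H t) = t" if "t \<ge> 0" for t unfolding H_def by (rule phi_phi_inv[OF Q that])
  have "N_function H"
  proof (rule N_functionI[OF H P])
    fix t :: real assume t: "t > 0"
    have "P (H t) * t = H t" using PQ[of "H t"] QH[of t] phi_nonneg[OF H, of t] t by simp
    then show "H t / t = P (H t)" using t by (simp add: field_simps)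
  qed
  moreover have "condition_J H"
    unfolding condition_J_iff
  proof (intro exI[of _ Hs] conjI Hs)
    show "complementary Hs H"
      unfolding complementary_def using invHs invH PQ by (intro exI[of _ 1]) auto
    \<comment> \<open>Layer k will have at most R (k + 1) D^(k+1) \<le> R (4 D^2)^k elements of
      weight a^(-R k). The condition says R \<eta> \<le> 1 / (4 a) for the ratio \<eta> = 4 D^2 /
      a^R.\<close>
    obtain R where R: "R \<ge> 1" "16 * a * D\<^sup>2 * real R \<le> a ^ R"
      using exponential_dominates_linear[OF a] by blast
    define c where "c = a powr (real R * M)"
    have c: "c > 0" using a by (simp add: c_def)
    have Pn: "P (a powi n) = a powr p n" for n
      using a \<phi>(1)[of n] by (simp add: P_def powi)
    define \<theta> where "\<theta> n = Hs (P (a powi n) / c)" for n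
    define X where "X k = {n. real R * M < p n - p (n - int (R * k))}" for k
    \<comment> \<open>Outside X k, p changes by at most R M over R k steps, and division by c lowers
      the exponent by exactly R M; so \<theta> n \<le> a^(n - R k).\<close>
    have \<theta>le: "\<theta> n / a powi n \<le> (1 / a ^ R) ^ k" if "n \<notin> X k" for n k
    proof -
      have "P (a powi n) / c = a powr (p n - real R * M)" by (simp add: Pn c_def powr_diff)
      also have "\<dots> \<le> a powr p (n - int (R * k))" using that a by (intro powr_mono) (auto simp: X_def)
      also have "\<dots> = P (a powi (n - int (R * k)))" by (rule Pn[symmetric])
      finally have "\<theta> n \<le> Hs (P (a powi (n - int (R * k))))"
        unfolding \<theta>_def using c a by (intro phi_mono[OF Hs]) (auto simp: Pn)
      also have "\<dots> = a powi (n - int (R * k))" using a by (intro HsP) simp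
      also have "\<dots> = a powi n / a ^ (R * k)" using a by (simp add: power_int_diff del: of_nat_mult)
      finally have "\<theta> n / a powi n \<le> a powi n / a ^ (R * k) / a powi n"
        using a by (intro divide_right_mono) auto
      also have "\<dots> = (1 / a ^ R) ^ k" using a by (simp add: power_mult power_divide)
      finally show ?thesis .
    qed
    have pmono: "p n \<le> p n'" if "n \<le> n'" for n n' using \<phi>mono[of "of_int n" "of_int n'"] that by (simp add: \<phi>(1))
    have exX: "\<exists>k. n \<in> X (Suc k)" for n
    proof -
      obtain n' where n': "p n' < p n - real R * M" using unb by blast
      have "int (nat \<bar>n - n'\<bar>) \<le> int (R * Suc (nat \<bar>n - n'\<bar>))"
        using R(1) by (intro of_nat_mono) (metis le_SucI mult.commute mult_le_mono1 nat_mult_1_right order_trans le_refl)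
      then have "p (n - int (R * Suc (nat \<bar>n - n'\<bar>))) \<le> p n'" by (intro pmono) linarith
      then show ?thesis using n' by (intro exI[of _ "nat \<bar>n - n'\<bar>"]) (simp add: X_def)
    qed
    \<comment> \<open>The layer of n: n lies in X (kk n + 1) but not in X (kk n). Since X 1 is
      empty, kk n \<ge> 1.\<close>
    define kk where "kk n = (LEAST k. n \<in> X (Suc k))" for n
    have kkX: "n \<in> X (Suc (kk n))" for n unfolding kk_def using exX by (rule LeastI_ex)
    have kk1: "1 \<le> kk n" for n
      using kkX[of n] X1[of R n] by (cases "kk n") (auto simp: X_def)
    have kkn: "n \<notin> X (kk n)" for n
    proof -
      obtain j where j: "kk n = Suc j" using kk1[of n] by (cases "kk n") auto
      then have "n \<notin> X (Suc j)" using not_less_Least[of j "\<lambda>k. n \<in> X (Suc k)"] unfolding kk_def by simp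
      then show ?thesis by (simp add: j)
    qed
    define \<eta> where "\<eta> = 4 * D\<^sup>2 / a ^ R"
    have \<eta>: "0 \<le> \<eta>" "real R * \<eta> \<le> 1 / (4 * a)" "\<eta> \<le> 1 / 2"
    proof -
      show "0 \<le> \<eta>" using a by (simp add: \<eta>_def)
      show 1: "real R * \<eta> \<le> 1 / (4 * a)" using R a by (simp add: \<eta>_def field_simps)
      have "1 * \<eta> \<le> real R * \<eta>" using R(1) \<open>0 \<le> \<eta>\<close> by (intro mult_right_mono) auto
      also have "\<dots> \<le> 1 / (4 * a)" by (rule 1)
      also have "\<dots> \<le> 1 / 2" using a by (simp add: field_simps)
      finally show "\<eta> \<le> 1 / 2" by simp
    qed
    have sum\<theta>: "(\<Sum>n\<in>A. \<theta> n / a powi n) \<le> 1 / a" if A: "finite A" for A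
    proof -
      have "(\<Sum>n\<in>A. \<theta> n / a powi n) \<le> (\<Sum>n\<in>A. (1 / a ^ R) ^ kk n)"
        by (intro sum_mono \<theta>le kkn)
      also have "\<dots> \<le> 2 * real R * \<eta>"
      proof (rule sum_geometric_layers_le[OF A])
        show "(1 / a ^ R) ^ k * real (card {n \<in> A. kk n = k}) \<le> real R * \<eta> ^ k" if k: "1 \<le> k" for k
        proof -
          have "{n \<in> A. kk n = k} \<subseteq> X (Suc k)" using kkX by auto
          moreover have "finite (X (Suc k))" unfolding X_def by (rule Xfin)
          ultimately have "real (card {n \<in> A. kk n = k}) \<le> real (card (X (Suc k)))"
            by (intro of_nat_mono card_mono)
          also have "\<dots> \<le> real (R * Suc k) * D ^ Suc k" unfolding X_def by (rule Xcard)
          also have "\<dots> \<le> real R * (2 ^ Suc k * D ^ Suc k)"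
            using of_nat_less_two_power[of "Suc k", where 'a = real] D
            by (simp only: of_nat_mult mult.assoc) (intro mult_left_mono mult_right_mono, auto)
          also have "\<dots> = real R * (2 * D) ^ Suc k" by (simp only: power_mult_distrib)
          also have "\<dots> \<le> real R * (2 * D) ^ (2 * k)"
            using D k by (intro mult_left_mono power_increasing) auto
          also have "(2 * D) ^ (2 * k) = (4 * D\<^sup>2) ^ k" by (simp add: power_mult power_mult_distrib)
          finally have "(1 / a ^ R) ^ k * real (card {n \<in> A. kk n = k}) \<le> (1 / a ^ R) ^ k * (real R * (4 * D\<^sup>2) ^ k)"
            using a by (intro mult_left_mono) auto
          also have "\<dots> = real R * \<eta> ^ k" by (simp add: \<eta>_def power_divide power_mult_distrib)
          finally show ?thesis .
        qed
      qed (use kk1 \<eta> a in auto)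
      also have "\<dots> \<le> 1 / a" using \<eta>(2) a by (simp add: field_simps)
      finally show ?thesis .
    qed
    define u where "u n = P (a powi n)" for n
    have u: "0 < u n" "u n \<le> u (n + 1)" "Hs (u n) = a powi n" for n
      using a phi_pos[OF P, of "a powi n"] p(1)[of n] HsP[of "a powi n"]
      by (auto simp: u_def Pn less_imp_le)
    \<comment> \<open>The value at the right end, of index n + 1, over the left value a^n; the
      resulting factor a is offset by the bound 1 / a in \<open>sum\<theta>\<close>.\<close>
    define \<beta> where "\<beta> n = a * (\<theta> (n + 1) / a powi (n + 1))" for n
    have \<theta>0: "0 \<le> \<theta> n" for n unfolding \<theta>_def using c by (intro phi_nonneg[OF Hs]) (simp add: Pn)
    have "modular Hs (\<lambda>v. ennreal (v / c)) \<le> ennreal 1"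
    proof (rule modular_le_cover[OF Hs, of u])
      show "0 < u n" for n by (rule u)
      show "\<exists>n. u n \<le> v \<and> v < u (n + 1)" if v: "0 < v" for v
      proof -
        have pos: "0 < Hs v" by (rule phi_pos[OF Hs v])
        obtain n where "a powi n \<le> Hs v" "Hs v < a powi (n + 1)" using powi_cover[OF a pos] by blast
        then have "Hs (u n) \<le> Hs v" "Hs v < Hs (u (n + 1))" by (simp_all add: u(3))
        then show ?thesis using u(1) v
          by (intro exI[of _ n]) (simp add: phi_le_iff[OF Hs] phi_less_iff[OF Hs] less_imp_le)
      qed
      show "0 \<le> \<beta> n" for n using \<theta>0 a by (simp add: \<beta>_def)
      show "sum \<beta> A \<le> 1" if "finite A" for A
      proof -
        have "sum \<beta> A = a * (\<Sum>n\<in>A. \<theta> (n + 1) / a powi (n + 1))" unfolding \<beta>_def by (rule sum_distrib_left[symmetric])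
        also have "(\<Sum>n\<in>A. \<theta> (n + 1) / a powi (n + 1)) = (\<Sum>n\<in>(\<lambda>n. n + 1) ` A. \<theta> n / a powi n)"
          by (simp add: sum.reindex inj_on_def)
        also have "a * \<dots> \<le> a * (1 / a)" using that a by (intro mult_left_mono sum\<theta>) auto
        finally show ?thesis using a by simp
      qed
      fix n
      let ?V = "\<lambda>i::nat. if i = 0 then u (n + 1) else u n"
      have "slice_le Hs (\<lambda>v. ennreal (v / c)) (?V 1) (?V 0) (\<beta> n)"
      proof (rule slice_le_steps[OF Hs, where z = "\<lambda>_. u (n + 1) / c" and h = "\<lambda>v. ennreal (v / c)"])
        show "(\<Sum>i<1. Hs (u (n + 1) / c) / Hs (?V (Suc i))) \<le> \<beta> n"
          using a by (simp add: u(3)) (simp add: \<beta>_def \<theta>_def u_def power_int_add)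
        show "0 \<le> u (n + 1) / c" using u(1)[of "n + 1"] c by simp
      qed (use u c in \<open>auto intro!: ennreal_leI divide_right_mono\<close>)
      then show "slice_le Hs (\<lambda>v. ennreal (v / c)) (u n) (u (n + 1)) (\<beta> n)"
        by simp
    qed
    then show "\<exists>c>0. modular Hs (\<lambda>u. ennreal (u / c)) \<le> 1" using c by auto
  qed
  moreover have "phi_succ K (phi_inv H)"
  proof -
    have KH: "phi_function (K \<circ> H)" by (rule phi_function_comp[OF K H])
    \<comment> \<open>The logarithm of K v / Q v. Rounding log v up and log v' down to integers
      costs 1 at each end, hence C + 2.\<close>
    define \<Lambda> where "\<Lambda> v = log a (K v) + \<phi> (log a v) - log a v" for v
    have \<Lambda>inc: "\<Lambda> v \<le> \<Lambda> v' + (C + 2)" if vv: "0 < v" "v \<le> v'" for v v'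
    proof -
      define n n' where "n = \<lfloor>log a v\<rfloor>" and "n' = \<lfloor>log a v'\<rfloor>"
      have lv: "log a v \<le> log a v'" using vv a by simp
      have n: "of_int n \<le> log a v" "log a v \<le> of_int n + 1" "of_int n' \<le> log a v'" "log a v' \<le> of_int n' + 1"
        unfolding n_def n'_def by linarith+
      have vn: "v \<le> a powi (n + 1)" "a powi n' \<le> v'"
        using n(2,3) a vv unfolding powi by (simp_all add: log_le_iff[symmetric] le_log_iff[symmetric])
      have "K v \<le> K (a powi (n + 1))" using vn(1) vv by (intro phi_mono[OF K]) auto
      then have K1: "log a (K v) \<le> log a (K (a powi (n + 1)))"
        using a phi_pos[OF K vv(1)] by simp
      have "K (a powi n') \<le> K v'" using vn(2) a by (intro phi_mono[OF K]) auto
      then have K2: "log a (K (a powi n')) \<le> log a (K v')" using a Kp[of n'] by simp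
      have K3: "log a (K v) \<le> log a (K v')"
        using a phi_pos[OF K vv(1)] phi_mono[OF K, of v v'] vv by simp
      show ?thesis
      proof (cases "n + 1 \<le> n'")
        case True
        have "\<kappa> (n + 1) - \<kappa> n' \<le> p n' - p (n + 1) + C" using comp[of "n + 1" "nat (n' - (n + 1))"] True by simp
        moreover have "\<phi> (log a v) \<le> p (n + 1)" using \<phi>mono[of "log a v" "of_int (n + 1)"] n by (simp only: \<phi>(1))
        moreover have "p n' \<le> \<phi> (log a v')" using \<phi>mono[of "of_int n'" "log a v'"] n by (simp only: \<phi>(1))
        ultimately show ?thesis using K1 K2 n by (simp add: \<Lambda>_def \<kappa>_def)
      next
        case False
        then have "n' \<le> n" by simp
        then have "log a v' \<le> log a v + 1" using n by linarith
        then show ?thesis using K3 \<phi>mono[OF lv] C0 by (simp add: \<Lambda>_def)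
      qed
    qed
    have \<Lambda>eq: "K v / Q v = a powr \<Lambda> v" if "0 < v" for v
      using a that phi_pos[OF K that] by (simp add: Q_def \<psi>_def \<Lambda>_def powr_add powr_diff)
    have "(K \<circ> H) s / s \<le> a powr (C + 2) * ((K \<circ> H) t / t)" if st: "0 < s" "s \<le> t" for s t
    proof -
      have h: "0 < H s" "H s \<le> H t" using phi_pos[OF H] phi_mono[OF H] st by auto
      have "K (H s) / Q (H s) = a powr \<Lambda> (H s)" using \<Lambda>eq h by simp
      also have "\<dots> \<le> a powr (\<Lambda> (H t) + (C + 2))" using \<Lambda>inc h a by (intro powr_mono) auto
      also have "\<dots> = a powr (C + 2) * (K (H t) / Q (H t))" using \<Lambda>eq[of "H t"] h by (simp add: powr_add)
      finally show ?thesis using QH st by simp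
    qed
    then obtain Kc where Kc: "convex_on {0..} Kc" "phi_equiv (K \<circ> H) Kc"
      using phi_equiv_convex[OF KH, of "a powr (C + 2)"] a C0 by (auto simp: ge_one_powr_ge_zero)
    have "phi_equiv (K \<circ> phi_inv (phi_inv H)) Kc"
      using Kc(2) unfolding phi_equiv_def by (simp add: phi_inv_phi_inv[OF H] cong: conj_cong)
    then show ?thesis unfolding phi_succ_def phi_prec_def using Kc(1) by blast
  qed
  ultimately show ?thesis by blast
qed

theorem theorem4p2:
  fixes F G1 G2 :: "real \<Rightarrow> real"
  assumes "phi_function F" and "phi_function G1" and "phi_function G2"
  shows
    "(dilatory G1 \<or> dilatory G2 \<longrightarrow>
        almost_convex (G1 \<circ> phi_inv G2) \<longrightarrow>
        (\<exists>c>0. \<forall>f \<in> (borel_measurable (lebesgue_on {0..}) :: (real \<Rightarrow> complex) set).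
           orlicz_lorentz (lebesgue_on {0..}) F G1 f
             \<le> ennreal c * orlicz_lorentz (lebesgue_on {0..}) F G2 f)) \<and>
     (((dilatory G1 \<or> dilatory G2) \<and> Delta2 G1) \<or> Delta2 G2 \<longrightarrow>
        (\<exists>c>0. \<forall>f \<in> (borel_measurable (lebesgue_on {0..}) :: (real \<Rightarrow> complex) set).
           orlicz_lorentz (lebesgue_on {0..}) F G1 f
             \<le> ennreal c * orlicz_lorentz (lebesgue_on {0..}) F G2 f) \<longrightarrow>
        almost_convex (G1 \<circ> phi_inv G2)) \<and>
     (dilatory G2 \<and> Delta2 G2 \<longrightarrow>
        (almost_convex (G1 \<circ> phi_inv G2) \<longleftrightarrow> almost_more_convex G1 G2)) \<and>
     (almost_convex (G1 \<circ> phi_inv G2) \<longleftrightarrow>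
        (\<exists>H. N_function H \<and> condition_J H \<and> phi_succ (G1 \<circ> phi_inv G2) (phi_inv H)))"
proof -
  define K where "K = G1 \<circ> phi_inv G2"
  have K: "phi_function K"
    unfolding K_def by (intro phi_function_comp phi_function_phi_inv assms)
  have majorant: "summable_majorant K" if "N_function H" "condition_J H" "phi_succ K (phi_inv H)" for H
    using that by (intro summable_majorant_if_condition_J[OF K]) (auto simp: N_function_def)
  have iii: "almost_convex K \<longleftrightarrow> (\<exists>H. N_function H \<and> condition_J H \<and> phi_succ K (phi_inv H))"
    using N_function_if_almost_convex[OF K] almost_convex_if_summable_majorant[OF K] majorant by blast
  \<comment> \<open>Almost convexity reaches the majorant by way of the N-function constructed for
    (iii).\<close>
  then have "summable_majorant K" if "almost_convex K" using that majorant by blast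
  then show ?thesis
    using orlicz_lorentz_bound[OF assms] almost_convex_if_orlicz_lorentz_bound[OF assms]
      almost_convex_iff_almost_more_convex[OF assms(2,3)] iii unfolding K_def
    by (intro conjI) blast+
qed

end
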